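(* Every knot in $\mathbb{R}^3$ is ambient isotopic to an ultraknot.
   Context: $\mathbb{N}=\{1,2,3,\ldots\}$ and $S^1\cong\mathbb{R}/2\pi\mathbb{Z}$. All knots are smooth knots in $\mathbb{R}^3$: a knot is the image of a smooth embedding $S^1\to\mathbb{R}^3$, i.e. of an injective smooth map with nowhere vanishing derivative. A smooth map $h:S^1\to\mathbb{R}^3$ parametrises a knot if it is such an embedding (in particular $h$ itself must be injective). For a smooth map $f=(x,y,z):S^1\to\mathbb{R}^3$, let $f^{(n)}=(x^{(n)},y^{(n)},z^{(n)})$ be its $n$th derivative with respect to $t\in\mathbb{R}/2\pi\mathbb{Z}$, and let $K_n$ be the loop in $\mathbb{R}^3$ parametrised by $f^{(n)}$. A knot $K$ is called an ultraknot if there is a smooth $f:S^1\to\mathbb{R}^3$ parametrising $K$ (with image $K$) such that $f^{(n)}$ parametrises a knot $K_n$ for all $n\in\mathbb{N}$, and for every knot $L$ there is an $n\in\mathbb{N}$ such that $K_n$ is ambient isotopic to $L$. *)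

theory Defs
  imports "HOL-Analysis.Analysis"
begin

text \<open>
  In finite dimension, f is k+1 times continuously differentiable iff it is differentiable
  and each of its directional derivatives is k times continuously differentiable.
  The class of smooth maps is used for curves (domain \<^typ>\<open>real\<close>) as well as for
  self-maps and isotopies of space.
\<close>

primrec C_times :: "nat \<Rightarrow> ('a::euclidean_space \<Rightarrow> 'b::euclidean_space) \<Rightarrow> bool" where
  "C_times 0 f \<longleftrightarrow> continuous_on UNIV f"
| "C_times (Suc k) f \<longleftrightarrow>
     (\<forall>x. f differentiable (at x)) \<and>
     (\<forall>v. C_times k (\<lambda>x. frechet_derivative f (at x) v))"

definition smooth :: "('a::euclidean_space \<Rightarrow> 'b::euclidean_space) \<Rightarrow> bool" where
  "smooth f \<longleftrightarrow> (\<forall>k. C_times k f)"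

definition diffeomorphism :: "('a::euclidean_space \<Rightarrow> 'a) \<Rightarrow> bool" where
  "diffeomorphism \<phi> \<longleftrightarrow> bij \<phi> \<and> smooth \<phi> \<and> smooth (inv \<phi>)"

text \<open>
  Maps on the circle, identified with the reals modulo \<open>2 * pi\<close>, are represented by
  \<open>2 * pi\<close>-periodic functions on the reals; injectivity on the circle is injectivity on
  one half-open period.
\<close>

definition smooth_loop :: "(real \<Rightarrow> real ^ 3) \<Rightarrow> bool" where
  "smooth_loop h \<longleftrightarrow> smooth h \<and> (\<forall>t. h (t + 2 * pi) = h t)"

definition nth_deriv :: "nat \<Rightarrow> (real \<Rightarrow> real ^ 3) \<Rightarrow> real \<Rightarrow> real ^ 3" where
  "nth_deriv n h = ((\<lambda>g t. vector_derivative g (at t)) ^^ n) h"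

definition parametrises_knot :: "(real \<Rightarrow> real ^ 3) \<Rightarrow> bool" where
  "parametrises_knot h \<longleftrightarrow>
     smooth_loop h \<and> inj_on h {0..<2 * pi} \<and> (\<forall>t. vector_derivative h (at t) \<noteq> 0)"

definition knot :: "(real ^ 3) set \<Rightarrow> bool" where
  "knot K \<longleftrightarrow> (\<exists>h. parametrises_knot h \<and> K = range h)"

text \<open>
  Ambient isotopy in the smooth category. Smoothness of the isotopy on the closed time interval
  \<open>{0..1}\<close> is expressed as usual by a smooth extension, here to all real times; nothing
  else is required of the extension outside \<open>{0..1}\<close>.
\<close>

definition ambient_isotopic :: "(real ^ 3) set \<Rightarrow> (real ^ 3) set \<Rightarrow> bool" where
  "ambient_isotopic K L \<longleftrightarrow>
     (\<exists>H :: real \<Rightarrow> real ^ 3 \<Rightarrow> real ^ 3.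
        smooth (\<lambda>(s, x). H s x) \<and>
        (\<forall>s\<in>{0..1}. diffeomorphism (H s)) \<and>
        H 0 = id \<and> H 1 ` K = L)"

definition ultraknot :: "(real ^ 3) set \<Rightarrow> bool" where
  "ultraknot K \<longleftrightarrow>
     (\<exists>f. parametrises_knot f \<and> K = range f \<and>
        (\<forall>n\<ge>1. parametrises_knot (nth_deriv n f)) \<and>
        (\<forall>L. knot L \<longrightarrow> (\<exists>n\<ge>1. ambient_isotopic (range (nth_deriv n f)) L)))"

end

theory Submission
  imports Defs "HOL-Computational_Algebra.Polynomial"
begin

text \<open>
  The ultraknot is the range of a rapidly convergent sum \<open>f = p + g\<^sub>0 + g\<^sub>1 + \<dots>\<close> of
  trigonometric polynomials. The first one, \<open>p\<close>, is close to a parametrisation of the given knot.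
  The term \<open>g\<^sub>k\<close> is small together with many of its derivatives, but one derivative of very high
  order \<open>n\<^sub>k\<close> of it is a huge multiple of a knot of the \<open>k\<close>-th type. In the derivative of order
  \<open>n\<^sub>k\<close> of the sum the earlier terms are negligible against this multiple, and the later terms
  are small, so the whole derivative has the \<open>k\<close>-th knot type. Four facts make this work.

  Stability (\<open>knot_stable\<close>): a loop that is close to a knot together with its derivative is a knot
  of the same type. The displacement along the knot extends to a vector field \<open>V\<close> on space with
  a small Lipschitz constant, and \<open>x + s * V x\<close> is an ambient isotopy. The extension is glued from
  local ones, in which the parameter of the knot is a smooth function of space.

  Countability (\<open>trig_poly_knot_types\<close>): by the Stone--Weierstrass theorem, trigonometric polynomials
  with coefficients in a countable dense set approximate every loop together with its derivative,
  so stability leaves only countably many knot types, all represented by trigonometric polynomials.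

  High frequencies (\<open>remove_low_frequencies\<close>): every knot type is represented by a trigonometric
  polynomial whose frequencies are at least any given \<open>N\<close>. If \<open>N\<close> exceeds the degree \<open>D\<close> of
  the earlier terms, their derivatives of order \<open>n\<close> grow like \<open>D ^ n\<close>, while the \<open>n\<close>-fold
  antiderivative of the new knot decays like \<open>N ^ - n\<close>. For large \<open>n\<close> a factor between these two rates
  exists. Low frequencies are removed by polynomial shears, which change one coordinate by a
  polynomial in the two others. Cancelling finitely many Fourier coefficients in this way is a
  linear system. After a small perturbation of the other two coordinates by a special high
  frequency curve its determinant does not vanish, because along the line spanned by this curve
  the system is asymptotically diagonal.

  Genericity (\<open>generic_derivatives_knots\<close>): finally, all derivatives of \<open>f\<close> have to be embedded.
  After adding \<open>cos t a + sin t b\<close> they are, for almost every pair \<open>(a, b)\<close>: a double point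
  or a critical point of a fixed derivative confines \<open>(a, b)\<close> to the image of a differentiable map
  from a space of dimension at most five to one of dimension six. Since the realised knots were
  scaled up, a single small pair does not disturb any of them.
\<close>

section \<open>Calculus of smooth maps\<close>

lemma C_times_SucI:
  assumes "\<And>x. (f has_derivative D x) (at x)" "\<And>v. C_times k (\<lambda>x. D x v)"
  shows "C_times (Suc k) f"
proof -
  have "frechet_derivative f (at x) = D x" for x
    using frechet_derivative_at[OF assms(1)] by simp
  then show ?thesis
    using assms by (auto simp: differentiable_def)
qed

lemma C_times_SucE:
  assumes "C_times (Suc k) f"
  obtains D where "\<And>x. (f has_derivative D x) (at x)" "\<And>v. C_times k (\<lambda>x. D x v)"
  using assms that[of "\<lambda>x. frechet_derivative f (at x)"]
  by (auto simp: frechet_derivative_works)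

lemma C_times_Suc_imp: "C_times (Suc k) f \<Longrightarrow> C_times k f"
proof (induction k arbitrary: f)
  case 0
  then show ?case
    by (auto intro!: continuous_at_imp_continuous_on differentiable_imp_continuous_within)
next
  case (Suc k)
  then show ?case by (metis C_times.simps(2))
qed

lemma C_times_continuous: "C_times k f \<Longrightarrow> continuous_on UNIV f"
  by (induction k) (auto dest: C_times_Suc_imp simp del: C_times.simps(2))

lemma C_times_const: "C_times k (\<lambda>x. c)"
proof (induction k arbitrary: c)
  case (Suc k)
  show ?case by (rule C_times_SucI[where D="\<lambda>x v. 0"]) (auto intro: Suc)
qed auto

lemma C_times_linear_comp:
  assumes "bounded_linear L" "C_times k f"
  shows "C_times k (\<lambda>x. L (f x))"
  using assms(2)
proof (induction k arbitrary: f)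
  case 0
  then show ?case using assms(1)
    by (auto intro: bounded_linear.continuous_on)
next
  case (Suc k)
  from Suc.prems obtain D where D: "\<And>x. (f has_derivative D x) (at x)" "\<And>v. C_times k (\<lambda>x. D x v)"
    by (metis C_times_SucE)
  show ?case
    by (rule C_times_SucI[where D="\<lambda>x v. L (D x v)"])
       (auto intro: bounded_linear.has_derivative[OF assms(1)] D Suc.IH)
qed

lemma C_times_ident: "C_times k (\<lambda>x. x)"
  by (cases k) (auto intro!: C_times_SucI[where D="\<lambda>x v. v"] C_times_const continuous_on_id simp del: C_times.simps(2))

lemma C_times_add:
  assumes "C_times k f" "C_times k g"
  shows "C_times k (\<lambda>x. f x + g x)"
  using assms
proof (induction k arbitrary: f g)
  case 0
  then show ?case by (auto intro: continuous_on_add)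
next
  case (Suc k)
  from Suc.prems obtain D E where
    D: "\<And>x. (f has_derivative D x) (at x)" "\<And>v. C_times k (\<lambda>x. D x v)" and
    E: "\<And>x. (g has_derivative E x) (at x)" "\<And>v. C_times k (\<lambda>x. E x v)"
    by (metis C_times_SucE)
  show ?case
    by (rule C_times_SucI[where D="\<lambda>x v. D x v + E x v"])
       (auto intro: has_derivative_add D E Suc.IH)
qed

lemma C_times_sum: "(\<And>i. i \<in> I \<Longrightarrow> C_times k (f i)) \<Longrightarrow> C_times k (\<lambda>x. \<Sum>i\<in>I. f i x)"
  by (induction I rule: infinite_finite_induct) (auto intro: C_times_const C_times_add)

lemma C_times_bilinear:
  assumes B: "bounded_bilinear B"
  assumes "C_times k f" "C_times k g"
  shows "C_times k (\<lambda>x. B (f x) (g x))"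
  using assms(2,3)
proof (induction k arbitrary: f g)
  case 0
  then show ?case using bounded_bilinear.continuous_on[OF B] by auto
next
  case (Suc k)
  from Suc.prems obtain D E where
    D: "\<And>x. (f has_derivative D x) (at x)" "\<And>v. C_times k (\<lambda>x. D x v)" and
    E: "\<And>x. (g has_derivative E x) (at x)" "\<And>v. C_times k (\<lambda>x. E x v)"
    by (metis C_times_SucE)
  show ?case
    by (rule C_times_SucI[where D="\<lambda>x v. B (f x) (E x v) + B (D x v) (g x)"])
       (auto intro!: C_times_add Suc.IH D E bounded_bilinear.FDERIV[OF B] C_times_Suc_imp[OF Suc.prems(1)] C_times_Suc_imp[OF Suc.prems(2)])
qed

lemma C_times_compose:
  fixes f :: "'b::euclidean_space \<Rightarrow> 'c::euclidean_space" and g :: "'a::euclidean_space \<Rightarrow> 'b"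
  assumes "C_times k f" "C_times k g"
  shows "C_times k (\<lambda>x. f (g x))"
  using assms
proof (induction k arbitrary: f g)
  case 0
  then show ?case by (auto intro: continuous_on_compose2)
next
  case (Suc k)
  from Suc.prems obtain D E where
    D: "\<And>x. (f has_derivative D x) (at x)" "\<And>v. C_times k (\<lambda>x. D x v)" and
    E: "\<And>x. (g has_derivative E x) (at x)" "\<And>v. C_times k (\<lambda>x. E x v)"
    by (metis C_times_SucE)
  \<comment> \<open>Expanding the inner derivative in a basis makes the chain rule a sum of products
    of maps to which the induction hypothesis applies.\<close>
  have *: "D (g x) (E x v) = (\<Sum>b\<in>Basis. (E x v \<bullet> b) *\<^sub>R D (g x) b)" for x v
  proof -
    interpret linear "D (g x)" using D(1) has_derivative_linear by blast
    have "D (g x) (E x v) = D (g x) (\<Sum>b\<in>Basis. (E x v \<bullet> b) *\<^sub>R b)"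
      by (simp add: euclidean_representation)
    then show ?thesis by (simp add: sum scaleR)
  qed
  show ?case
  proof (rule C_times_SucI[where D="\<lambda>x v. D (g x) (E x v)"])
    show "((\<lambda>x. f (g x)) has_derivative (\<lambda>v. D (g x) (E x v))) (at x)" for x
      using diff_chain_at[OF E(1) D(1)] by (simp add: o_def)
    show "C_times k (\<lambda>x. D (g x) (E x v))" for v
      unfolding *
      by (intro C_times_sum C_times_bilinear[OF bounded_bilinear_scaleR]
           C_times_linear_comp[OF bounded_linear_inner_left] E Suc.IH D C_times_Suc_imp[OF Suc.prems(2)])
  qed
qed

lemma smooth_const: "smooth (\<lambda>x. c)"
  by (simp add: smooth_def C_times_const)

lemma smooth_ident: "smooth (\<lambda>x. x)"
  by (simp add: smooth_def C_times_ident)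

lemma smooth_linear_comp: "bounded_linear L \<Longrightarrow> smooth f \<Longrightarrow> smooth (\<lambda>x. L (f x))"
  by (simp add: smooth_def C_times_linear_comp)

lemma smooth_linear: "bounded_linear L \<Longrightarrow> smooth L"
  using smooth_linear_comp[OF _ smooth_ident] by blast

lemma smooth_add: "smooth f \<Longrightarrow> smooth g \<Longrightarrow> smooth (\<lambda>x. f x + g x)"
  by (simp add: smooth_def C_times_add)

lemma smooth_sum: "(\<And>i. i \<in> I \<Longrightarrow> smooth (f i)) \<Longrightarrow> smooth (\<lambda>x. \<Sum>i\<in>I. f i x)"
  by (simp add: smooth_def C_times_sum)

lemma smooth_bilinear: "bounded_bilinear B \<Longrightarrow> smooth f \<Longrightarrow> smooth g \<Longrightarrow> smooth (\<lambda>x. B (f x) (g x))"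
  by (simp add: smooth_def C_times_bilinear)

lemma smooth_compose: "smooth f \<Longrightarrow> smooth g \<Longrightarrow> smooth (\<lambda>x. f (g x))"
  by (simp add: smooth_def C_times_compose)

lemma smooth_minus: "smooth f \<Longrightarrow> smooth (\<lambda>x. - f x)"
  using smooth_linear_comp[OF bounded_linear_minus[OF bounded_linear_ident]] .

lemma smooth_diff: "smooth f \<Longrightarrow> smooth g \<Longrightarrow> smooth (\<lambda>x. f x - g x)"
  using smooth_add[OF _ smooth_minus, of f g] by simp

lemmas smooth_scaleR = smooth_bilinear[OF bounded_bilinear_scaleR]

lemma smooth_mult:
  fixes f g :: "'a::euclidean_space \<Rightarrow> 'b::{euclidean_space,real_normed_algebra}"
  shows "smooth f \<Longrightarrow> smooth g \<Longrightarrow> smooth (\<lambda>x. f x * g x)"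
  using smooth_bilinear[OF bounded_bilinear_mult] .

lemma smooth_power:
  fixes f :: "'a::euclidean_space \<Rightarrow> 'b::{euclidean_space,real_normed_algebra_1}"
  shows "smooth f \<Longrightarrow> smooth (\<lambda>x. f x ^ n)"
  by (induction n) (auto intro: smooth_const smooth_mult)

lemma smooth_Pair: "smooth f \<Longrightarrow> smooth g \<Longrightarrow> smooth (\<lambda>x. (f x, g x))"
proof -
  assume "smooth f" "smooth g"
  then have "smooth (\<lambda>x. (f x, 0) + (0, g x))"
    by (intro smooth_add smooth_linear_comp[of "\<lambda>x. (x, 0)"] smooth_linear_comp[of "\<lambda>x. (0, x)"])
       (auto intro!: bounded_linear_Pair bounded_linear_ident bounded_linear_zero)
  then show ?thesis by simp
qed

lemma smooth_fst: "smooth f \<Longrightarrow> smooth (\<lambda>x. fst (f x))"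
  by (rule smooth_linear_comp[OF bounded_linear_fst])

lemma smooth_snd: "smooth f \<Longrightarrow> smooth (\<lambda>x. snd (f x))"
  by (rule smooth_linear_comp[OF bounded_linear_snd])

lemma smooth_nth: "smooth f \<Longrightarrow> smooth (\<lambda>x. f x $ i)"
  by (rule smooth_linear_comp[OF bounded_linear_vec_nth])

lemma C_times_vec:
  fixes f :: "'a::euclidean_space \<Rightarrow> real ^ 'n"
  assumes "\<And>i. C_times k (\<lambda>x. f x $ i)"
  shows "C_times k f"
proof -
  have "C_times k (\<lambda>x. \<Sum>i\<in>UNIV. (f x $ i) *\<^sub>R axis i (1::real))"
    by (intro C_times_sum C_times_bilinear[OF bounded_bilinear_scaleR] assms C_times_const)
  moreover have "(\<Sum>i\<in>UNIV. (f x $ i) *\<^sub>R axis i (1::real)) = f x" for x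
    using basis_expansion[of "f x"] by (simp add: scalar_mult_eq_scaleR)
  ultimately show ?thesis by simp
qed

lemma C_times_inverse:
  fixes f :: "'a::euclidean_space \<Rightarrow> real"
  assumes nz: "\<And>x. f x \<noteq> 0" and "C_times k f"
  shows "C_times k (\<lambda>x. inverse (f x))"
  using assms(2)
proof (induction k)
  case 0
  then show ?case using nz by (auto intro: continuous_on_inverse)
next
  case (Suc k)
  from Suc.prems obtain D where D: "\<And>x. (f has_derivative D x) (at x)" "\<And>v. C_times k (\<lambda>x. D x v)"
    by (metis C_times_SucE)
  show ?case
    by (rule C_times_SucI[where D="\<lambda>x v. - (inverse (f x) * D x v * inverse (f x))"])
       (auto intro!: Deriv.has_derivative_inverse nz D C_times_linear_comp[of uminus]
          C_times_bilinear[OF bounded_bilinear_mult] C_times_Suc_imp[OF Suc.prems] Suc.IH bounded_linear_minus bounded_linear_ident)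
qed

lemma smooth_inverse:
  fixes f :: "'a::euclidean_space \<Rightarrow> real"
  shows "(\<And>x. f x \<noteq> 0) \<Longrightarrow> smooth f \<Longrightarrow> smooth (\<lambda>x. inverse (f x))"
  by (simp add: smooth_def C_times_inverse)

lemma smooth_imp_continuous_on: "smooth f \<Longrightarrow> continuous_on S f"
  using C_times_continuous continuous_on_subset smooth_def by blast

lemma smooth_frechet:
  assumes "smooth f"
  shows "(f has_derivative frechet_derivative f (at x)) (at x)"
    and "smooth (\<lambda>x. frechet_derivative f (at x) v)"
proof -
  show "(f has_derivative frechet_derivative f (at x)) (at x)"
    using assms frechet_derivative_works unfolding smooth_def by (metis C_times.simps(2))
  show "smooth (\<lambda>x. frechet_derivative f (at x) v)"
    using assms unfolding smooth_def by (metis C_times.simps(2))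
qed

subsection \<open>Curves\<close>

text \<open>
  A curve is handled together with all its derivatives: limits, sums and antiderivatives
  are then formed order by order, and smoothness is automatic.
\<close>

definition derivatives :: "(nat \<Rightarrow> real \<Rightarrow> 'a::real_normed_vector) \<Rightarrow> bool" where
  "derivatives F \<longleftrightarrow> (\<forall>j t. (F j has_vector_derivative F (Suc j) t) (at t))"

lemma derivativesD: "derivatives F \<Longrightarrow> (F j has_vector_derivative F (Suc j) t) (at t)"
  by (simp add: derivatives_def)

lemma derivatives_add: "derivatives F \<Longrightarrow> derivatives G \<Longrightarrow> derivatives (\<lambda>j t. F j t + G j t)"
  by (auto simp: derivatives_def intro: has_vector_derivative_add)

lemma derivatives_scaleR: "derivatives F \<Longrightarrow> derivatives (\<lambda>j t. c *\<^sub>R F j t)"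
  by (auto simp: derivatives_def intro: bounded_linear.has_vector_derivative[OF bounded_linear_scaleR_right])

lemma derivatives_imp_smooth:
  fixes F :: "nat \<Rightarrow> real \<Rightarrow> 'a::euclidean_space"
  assumes "derivatives F"
  shows "smooth (F n)"
proof -
  have "C_times k (F n)" for k
  proof (induction k arbitrary: n)
    case 0
    then show ?case using assms
      by (auto intro!: continuous_at_imp_continuous_on has_vector_derivative_continuous simp: derivatives_def)
  next
    case (Suc k)
    show ?case
      using assms
      by (intro C_times_SucI[where D="\<lambda>t v. v *\<^sub>R F (Suc n) t"] C_times_bilinear[OF bounded_bilinear_scaleR] C_times_const Suc.IH)
         (auto simp: derivatives_def has_vector_derivative_def)
  qed
  then show ?thesis by (simp add: smooth_def)
qed

lemma smooth_has_vector_derivative: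
  assumes "smooth (f :: real \<Rightarrow> 'a::euclidean_space)"
  shows "(f has_vector_derivative vector_derivative f (at t)) (at t)"
  by (metis differentiableI smooth_frechet(1)[OF assms] vector_derivative_works)

lemma smooth_vector_derivative:
  assumes "smooth (f :: real \<Rightarrow> 'a::euclidean_space)"
  shows "smooth (\<lambda>t. vector_derivative f (at t))"
proof -
  have "vector_derivative f (at t) = frechet_derivative f (at t) 1" for t
    using frechet_derivative_at[of f "\<lambda>v. v *\<^sub>R vector_derivative f (at t)" t]
      smooth_has_vector_derivative[OF assms, of t]
    by (metis has_vector_derivative_def scaleR_one)
  then show ?thesis using smooth_frechet(2)[OF assms, of 1] by simp
qed

lemma smooth_imp_derivatives:
  assumes "smooth f"
  shows "derivatives (\<lambda>n. nth_deriv n f)"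
proof -
  have "smooth (nth_deriv n f)" for n
    using assms by (induction n) (auto simp: nth_deriv_def intro: smooth_vector_derivative)
  then have "(nth_deriv n f has_vector_derivative nth_deriv (Suc n) f t) (at t)" for n t
    using smooth_has_vector_derivative[of "nth_deriv n f" t] by (simp add: nth_deriv_def)
  then show ?thesis by (simp add: derivatives_def)
qed

lemma nth_deriv_eq:
  assumes "derivatives F"
  shows "nth_deriv n (F 0) = F n"
proof (induction n)
  case (Suc n)
  have "vector_derivative (F n) (at t) = F (Suc n) t" for t
    using assms by (auto simp: derivatives_def intro: vector_derivative_at)
  with Suc show ?case by (auto simp: nth_deriv_def)
qed (simp add: nth_deriv_def)

lemma derivatives_unique:
  fixes F G :: "nat \<Rightarrow> real \<Rightarrow> real ^ 3"
  assumes "derivatives F" "derivatives G" "F 0 = G 0"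
  shows "F = G"
proof
  show "F n = G n" for n
    by (metis assms nth_deriv_eq)
qed

lemma periodic_vector_derivative:
  assumes "\<And>t. f (t + p) = f t"
  shows "vector_derivative f (at (t + p)) = vector_derivative f (at t)"
proof -
  have shift: "(f has_vector_derivative d) (at (t + q))"
    if "(f has_vector_derivative d) (at t)" "\<And>t. f (t - q) = f t" for d t q
  proof -
    have "((\<lambda>t. t - q) has_vector_derivative 1) (at (t + q))"
      by (auto intro!: derivative_eq_intros simp: has_vector_derivative_def)
    moreover have "(f has_vector_derivative d) (at ((t + q) - q))" using that by simp
    ultimately have "(f \<circ> (\<lambda>t. t - q) has_vector_derivative 1 *\<^sub>R d) (at (t + q))"
      by (rule vector_diff_chain_at)
    moreover have "f \<circ> (\<lambda>t. t - q) = f" using that(2) by auto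
    ultimately show ?thesis by simp
  qed
  have "f (t - p) = f t" for t using assms[of "t - p"] by simp
  then have "(f has_vector_derivative d) (at (t + p)) \<longleftrightarrow> (f has_vector_derivative d) (at t)" for d
    using shift[of d t p] shift[of d "t + p" "- p"] assms by auto
  then show ?thesis by (simp add: vector_derivative_def)
qed

lemma vector_derivative_bound_lipschitz:
  assumes "\<And>t. (u has_vector_derivative u' t) (at t)" "\<And>t. norm (u' t) \<le> B"
  shows "B-lipschitz_on UNIV u"
proof (rule bounded_derivative_imp_lipschitz[where f'="\<lambda>t h. h *\<^sub>R u' t"])
  show "(u has_derivative (\<lambda>h. h *\<^sub>R u' t)) (at t within UNIV)" for t
    using assms(1) by (simp add: has_vector_derivative_def)
  show "0 \<le> B" using assms(2)[of 0] norm_ge_zero order_trans by blast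
  then show "onorm (\<lambda>h. h *\<^sub>R u' t) \<le> B" for t
    using assms(2)[of t] by (intro onorm_bound) (auto simp: mult.commute[of B] intro: mult_left_mono)
qed auto

subsection \<open>Bump functions\<close>

text \<open>
  The family \<open>x ^ -n * exp (- 1 / x)\<close>, extended by zero to the left half line, is closed under
  differentiation up to linear combinations, which gives smoothness of all its members at once.
\<close>

definition flat :: "nat \<Rightarrow> real \<Rightarrow> real" where
  "flat n x = (if x > 0 then exp (- inverse x) * inverse x ^ n else 0)"

text \<open>Exponential decay beats the pole, which makes the functions flat at the origin.\<close>

lemma flat_le: "\<bar>flat n x\<bar> \<le> fact (n + 2) * x\<^sup>2"
proof (cases "x > 0")
  case True
  define y where "y = inverse x"
  have y: "y > 0" using True by (simp add: y_def)
  define c :: real where "c = fact (n + 2)"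
  have c: "c > 0" unfolding c_def by (rule fact_gt_zero)
  have "y ^ (n + 2) / c \<le> exp y"
  proof -
    have "(\<Sum>i\<in>{n+2}. y ^ i /\<^sub>R fact i) \<le> (\<Sum>i. y ^ i /\<^sub>R fact i)"
      using y by (intro sum_le_suminf summable_exp_generic) auto
    then show ?thesis by (simp add: exp_def c_def divide_inverse mult.commute)
  qed
  then have "exp (- y) * y ^ (n + 2) \<le> c"
    using y c by (simp add: exp_minus field_simps)
  then have "exp (- y) * y ^ n \<le> c * x\<^sup>2"
    using True by (simp add: y_def power_add field_simps power2_eq_square)
  then show ?thesis using True by (simp add: flat_def y_def c_def)
qed (simp add: flat_def)

lemma flat_DERIV: "(flat n has_real_derivative flat (n + 2) x - n * flat (n + 1) x) (at x)"
proof -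
  consider "x > 0" | "x < 0" | "x = 0" by linarith
  then show ?thesis
  proof cases
    case 1
    have "((\<lambda>x. exp (- inverse x) * inverse x ^ n) has_real_derivative flat (n + 2) x - n * flat (n + 1) x) (at x)"
      using 1
      apply (auto intro!: derivative_eq_intros simp: flat_def)
      apply (cases n)
       apply (simp_all add: field_simps power2_eq_square)
      done
    then show ?thesis
      by (rule has_field_derivative_transform_within_open[where S="{0<..}"]) (use 1 in \<open>auto simp: flat_def\<close>)
  next
    case 2
    have "((\<lambda>x. 0) has_real_derivative flat (n + 2) x - n * flat (n + 1) x) (at x)"
      using 2 by (auto simp: flat_def)
    then show ?thesis
      by (rule has_field_derivative_transform_within_open[where S="{..<0}"]) (use 2 in \<open>auto simp: flat_def\<close>)
  next
    case 3
    define c :: real where "c = fact (n + 2)"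
    have "(\<lambda>h. (flat n (0 + h) - flat n 0) / h) \<midarrow>0\<rightarrow> 0"
    proof (rule Lim_null_comparison)
      have "((\<lambda>h::real. c * \<bar>h\<bar>) \<longlongrightarrow> c * \<bar>0\<bar>) (at 0)"
        by (intro tendsto_intros)
      then show "((\<lambda>h::real. c * \<bar>h\<bar>) \<longlongrightarrow> 0) (at 0)" by simp
      show "\<forall>\<^sub>F h in at 0. norm ((flat n (0 + h) - flat n 0) / h) \<le> c * \<bar>h\<bar>"
      proof (rule eventuallyI)
        fix h :: real
        have "\<bar>flat n h\<bar> / \<bar>h\<bar> \<le> (c * h\<^sup>2) / \<bar>h\<bar>"
          unfolding c_def by (intro divide_right_mono flat_le) auto
        also have "\<dots> = c * \<bar>h\<bar>"
          by (cases "h > 0"; cases "h = 0") (auto simp: power2_eq_square)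
        finally show "norm ((flat n (0 + h) - flat n 0) / h) \<le> c * \<bar>h\<bar>"
          by (simp add: flat_def[of n 0])
      qed
    qed
    then show ?thesis using 3 by (simp add: DERIV_def flat_def[of _ 0])
  qed
qed

lemma smooth_flat: "smooth (flat n)"
proof -
  have "C_times k (flat n)" for k
  proof (induction k arbitrary: n)
    case 0
    then show ?case
      by (auto intro!: continuous_at_imp_continuous_on DERIV_isCont flat_DERIV)
  next
    case (Suc k)
    have "C_times k (\<lambda>x. flat (n + 2) x + (- real n) * flat (n + 1) x)"
      by (intro C_times_add C_times_bilinear[OF bounded_bilinear_mult] C_times_const Suc.IH)
    then have *: "C_times k (\<lambda>x. flat (n + 2) x - real n * flat (n + 1) x)" by simp
    show ?case
      by (rule C_times_SucI[where D="\<lambda>x v. (flat (n + 2) x - real n * flat (n + 1) x) * v"])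
         (use flat_DERIV[of n] in \<open>simp add: has_field_derivative_def\<close>,
          intro C_times_bilinear[OF bounded_bilinear_mult] C_times_const *)
  qed
  then show ?thesis by (simp add: smooth_def)
qed

text \<open>The quotient of flat functions that interpolates between the constants 0 and 1.\<close>

definition smooth_step :: "real \<Rightarrow> real" where
  "smooth_step x = flat 0 x * inverse (flat 0 x + flat 0 (1 - x))"

lemma flat_0: "flat 0 x \<ge> 0" "x \<le> 0 \<Longrightarrow> flat 0 x = 0" "x > 0 \<Longrightarrow> flat 0 x > 0"
  by (auto simp: flat_def)

lemma smooth_step_denominator: "flat 0 x + flat 0 (1 - x) > 0"
  using flat_0(1,3)[of x] flat_0(1,3)[of "1 - x"] by (cases "x > 0") (auto intro: add_pos_nonneg add_nonneg_pos)

lemma smooth_step_simps: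
  "x \<le> 0 \<Longrightarrow> smooth_step x = 0" "x \<ge> 1 \<Longrightarrow> smooth_step x = 1"
  "0 \<le> smooth_step x" "smooth_step x \<le> 1"
  using smooth_step_denominator[of x] flat_0[of x] flat_0[of "1 - x"]
  by (auto simp: smooth_step_def divide_simps simp flip: divide_inverse)

lemma smooth_smooth_step: "smooth smooth_step"
proof -
  have s: "smooth (\<lambda>x. flat 0 x + flat 0 (1 - x))"
    by (intro smooth_add smooth_flat smooth_compose[OF smooth_flat] smooth_diff smooth_const smooth_ident)
  have "smooth (\<lambda>x. flat 0 x * inverse (flat 0 x + flat 0 (1 - x)))"
    by (intro smooth_mult smooth_flat smooth_inverse s) (metis less_irrefl smooth_step_denominator)
  then show ?thesis by (simp add: smooth_step_def[abs_def])
qed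

lemma smooth_step_lipschitz: obtains C where "C > 0" "C-lipschitz_on UNIV smooth_step"
proof -
  define d where "d t = vector_derivative smooth_step (at t)" for t
  have d: "(smooth_step has_vector_derivative d t) (at t)" for t
    using smooth_has_vector_derivative[OF smooth_smooth_step] by (simp add: d_def)
  have "continuous_on {0..1} d"
    using smooth_imp_continuous_on[OF smooth_vector_derivative[OF smooth_smooth_step]] by (simp add: d_def)
  then have "bounded (d ` {0..1})" by (intro compact_imp_bounded compact_continuous_image) auto
  then obtain B where B: "B > 0" "\<And>t. t \<in> {0..1} \<Longrightarrow> norm (d t) \<le> B"
    by (auto simp: bounded_pos)
  have L: "\<bar>smooth_step x - smooth_step y\<bar> \<le> B * \<bar>x - y\<bar>" if "x \<in> {0..1}" "y \<in> {0..1}" for x y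
    using field_differentiable_bound[of "{0..1}" smooth_step d B x y] d B(2) that
    by (simp add: has_real_derivative_iff_has_vector_derivative has_vector_derivative_at_within)
  define c :: "real \<Rightarrow> real" where "c x = max 0 (min 1 x)" for x
  have c: "smooth_step (c x) = smooth_step x" "c x \<in> {0..1}" for x
    by (auto simp: c_def max_def min_def smooth_step_simps)
  have "B-lipschitz_on UNIV smooth_step"
  proof (rule lipschitz_onI)
    show "dist (smooth_step x) (smooth_step y) \<le> B * dist x y" for x y
    proof -
      have "\<bar>smooth_step (c x) - smooth_step (c y)\<bar> \<le> B * \<bar>c x - c y\<bar>" by (intro L c)
      also have "\<dots> \<le> B * \<bar>x - y\<bar>" using B by (intro mult_left_mono) (auto simp: c_def)
      finally show ?thesis by (simp add: c dist_real_def)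
    qed
  qed (use B in auto)
  with B that show ?thesis by blast
qed

definition plateau :: "real \<Rightarrow> real \<Rightarrow> real" where
  "plateau r x = smooth_step (2 - x / r) * smooth_step (2 + x / r)"

lemma plateau_simps:
  assumes "r > 0"
  shows "\<bar>x\<bar> \<le> r \<Longrightarrow> plateau r x = 1" "\<bar>x\<bar> \<ge> 2 * r \<Longrightarrow> plateau r x = 0"
    "0 \<le> plateau r x" "plateau r x \<le> 1"
proof -
  assume "\<bar>x\<bar> \<le> r"
  then have "x / r \<le> 1" "- 1 \<le> x / r" using assms by (auto simp: field_simps)
  then show "plateau r x = 1" by (simp add: plateau_def smooth_step_simps)
next
  assume "\<bar>x\<bar> \<ge> 2 * r"
  then have "x / r \<ge> 2 \<or> x / r \<le> - 2" using assms by (auto simp: field_simps abs_if split: if_splits)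
  then show "plateau r x = 0" by (auto simp add: plateau_def smooth_step_simps)
qed (auto simp: plateau_def smooth_step_simps mult_le_one)

lemma smooth_plateau: "smooth (plateau r)"
proof -
  have "smooth (\<lambda>x. x / r)" using smooth_linear[of "\<lambda>x. x / r"] bounded_linear_divide by blast
  then have "smooth (\<lambda>x. smooth_step (2 - x / r) * smooth_step (2 + x / r))"
    by (intro smooth_mult smooth_compose[OF smooth_smooth_step] smooth_add smooth_diff smooth_const)
  then show ?thesis by (simp add: plateau_def[abs_def])
qed

lemma lipschitz_bounded_mult:
  fixes f :: "'a::metric_space \<Rightarrow> real" and g :: "'a \<Rightarrow> 'b::real_normed_vector"
  assumes "C-lipschitz_on S f" "D-lipschitz_on S g" "\<And>x. x \<in> S \<Longrightarrow> \<bar>f x\<bar> \<le> A" "\<And>x. x \<in> S \<Longrightarrow> norm (g x) \<le> B"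
    "A \<ge> 0" "B \<ge> 0"
  shows "(A * D + C * B)-lipschitz_on S (\<lambda>x. f x *\<^sub>R g x)"
proof (rule lipschitz_onI)
  have CD: "C \<ge> 0" "D \<ge> 0" using assms by (auto simp: lipschitz_on_def)
  then show "0 \<le> A * D + C * B" using assms by simp
  fix x y assume xy: "x \<in> S" "y \<in> S"
  have "f x *\<^sub>R g x - f y *\<^sub>R g y = f x *\<^sub>R (g x - g y) + (f x - f y) *\<^sub>R g y"
    by (simp add: algebra_simps)
  then have "norm (f x *\<^sub>R g x - f y *\<^sub>R g y) \<le> \<bar>f x\<bar> * norm (g x - g y) + \<bar>f x - f y\<bar> * norm (g y)"
    using norm_triangle_ineq by (metis norm_scaleR)
  also have "\<dots> \<le> A * (D * dist x y) + (C * dist x y) * B"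
    using assms xy CD by (intro add_mono mult_mono) (auto simp: lipschitz_on_def dist_norm dist_real_def)
  finally show "dist (f x *\<^sub>R g x) (f y *\<^sub>R g y) \<le> (A * D + C * B) * dist x y"
    by (simp add: dist_norm algebra_simps)
qed

text \<open>
  The Lipschitz constant grows only like \<open>1 / r\<close>. This is what makes a cutoff of a function
  with vanishing value and derivative at the origin small in the Lipschitz sense.
\<close>

lemma plateau_lipschitz:
  obtains C where "C > 0" "\<And>r. r > 0 \<Longrightarrow> (C / r)-lipschitz_on UNIV (plateau r)"
proof -
  obtain B where B: "B > 0" "B-lipschitz_on UNIV smooth_step" by (rule smooth_step_lipschitz)
  have "(2 * B / r)-lipschitz_on UNIV (plateau r)" if r: "r > 0" for r
  proof -
    have s: "(B / r)-lipschitz_on UNIV (\<lambda>x. smooth_step (2 + c * x / r))" if "\<bar>c\<bar> = 1" for c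
    proof (rule lipschitz_onI)
      fix x y
      have "dist (smooth_step (2 + c * x / r)) (smooth_step (2 + c * y / r)) \<le> B * dist (2 + c * x / r) (2 + c * y / r)"
        using B(2) by (blast dest: lipschitz_onD)
      also have "dist (2 + c * x / r) (2 + c * y / r) = \<bar>c * (x - y) / r\<bar>"
        by (simp add: dist_real_def algebra_simps diff_divide_distrib)
      also have "\<dots> = dist x y / r"
        using r that by (simp add: dist_real_def abs_mult abs_divide)
      finally show "dist (smooth_step (2 + c * x / r)) (smooth_step (2 + c * y / r)) \<le> B / r * dist x y" by simp
    qed (use B r in auto)
    have "(1 * (B / r) + B / r * 1)-lipschitz_on UNIV (\<lambda>x. smooth_step (2 + (- 1) * x / r) *\<^sub>R smooth_step (2 + 1 * x / r))"
      by (intro lipschitz_bounded_mult s) (auto simp: smooth_step_simps)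
    then show ?thesis by (simp add: plateau_def[abs_def])
  qed
  with B that[of "2 * B"] show ?thesis by auto
qed

text \<open>
  Products of one-dimensional plateaus are supported in cubes; all that matters later is that the
  support shrinks in proportion to \<open>r\<close>.
\<close>

lemma cutoff_cube:
  fixes a :: "real ^ 'n"
  assumes "r > 0"
  obtains b :: "real ^ 'n \<Rightarrow> real" and L where "smooth b" "L-lipschitz_on UNIV b"
    "\<And>x. 0 \<le> b x" "\<And>x. b x \<le> 1" "\<And>x. norm (x - a) \<le> r \<Longrightarrow> b x = 1"
    "\<And>x. b x \<noteq> 0 \<Longrightarrow> norm (x - a) \<le> real CARD('n) * (2 * r)"
proof -
  define p where "p i x = plateau r (x $ i - a $ i)" for i and x :: "real ^ 'n"
  obtain C where C: "C > 0" "\<And>r. r > 0 \<Longrightarrow> (C / r)-lipschitz_on UNIV (plateau r)" using plateau_lipschitz by blast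
  have pl: "(C / r)-lipschitz_on UNIV (p i)" for i
  proof (rule lipschitz_onI)
    fix x y :: "real ^ 'n"
    have "dist (p i x) (p i y) \<le> C / r * dist (x $ i - a $ i) (y $ i - a $ i)"
      using C(2)[OF assms] by (auto simp: lipschitz_on_def p_def)
    also have "\<dots> \<le> C / r * dist x y"
      using C assms component_le_norm_cart[of "x - y" i]
      by (intro mult_left_mono) (auto simp: dist_norm)
    finally show "dist (p i x) (p i y) \<le> C / r * dist x y" .
  qed (use C assms in auto)
  have ps: "smooth (p i)" for i
    unfolding p_def by (intro smooth_compose[OF smooth_plateau] smooth_diff smooth_const smooth_nth smooth_ident)
  have "\<exists>L. L-lipschitz_on UNIV (\<lambda>x. \<Prod>i\<in>I. p i x) \<and> smooth (\<lambda>x. \<Prod>i\<in>I. p i x) \<and> (\<forall>x. 0 \<le> (\<Prod>i\<in>I. p i x) \<and> (\<Prod>i\<in>I. p i x) \<le> 1)"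
    if "finite I" for I :: "'n set"
    using that
  proof induction
    case empty
    show ?case by (auto intro!: smooth_const exI[of _ 0] lipschitz_onI)
  next
    case (insert i I)
    then obtain L where L: "L-lipschitz_on UNIV (\<lambda>x. \<Prod>i\<in>I. p i x)" "smooth (\<lambda>x. \<Prod>i\<in>I. p i x)"
      "\<And>x. 0 \<le> (\<Prod>i\<in>I. p i x) \<and> (\<Prod>i\<in>I. p i x) \<le> 1" by blast
    have "(1 * L + C / r * 1)-lipschitz_on UNIV (\<lambda>x. p i x *\<^sub>R (\<Prod>i\<in>I. p i x))"
      using L(3) plateau_simps(3,4)[OF assms] by (intro lipschitz_bounded_mult L pl) (auto simp: p_def)
    moreover have "smooth (\<lambda>x. p i x * (\<Prod>i\<in>I. p i x))" by (intro smooth_mult ps L)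
    ultimately show ?case using insert L(3) plateau_simps(3,4)[OF assms]
      by (auto simp: p_def intro!: mult_le_one)
  qed
  from this[of UNIV] obtain L where L: "L-lipschitz_on UNIV (\<lambda>x. \<Prod>i\<in>UNIV. p i x)" "smooth (\<lambda>x. \<Prod>i\<in>UNIV. p i x)"
      "\<And>x. 0 \<le> (\<Prod>i\<in>UNIV. p i x)" "\<And>x. (\<Prod>i\<in>UNIV. p i x) \<le> 1" by auto
  show ?thesis
  proof (rule that[OF L(2,1,3,4)])
    fix x
    show "(\<Prod>i\<in>UNIV. p i x) = 1" if "norm (x - a) \<le> r"
    proof -
      have "\<bar>x $ i - a $ i\<bar> \<le> r" for i
        using component_le_norm_cart[of "x - a" i] that by simp
      then show ?thesis by (simp add: p_def plateau_simps[OF assms])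
    qed
    show "norm (x - a) \<le> real CARD('n) * (2 * r)" if "(\<Prod>i\<in>UNIV. p i x) \<noteq> 0"
    proof -
      have "\<bar>x $ i - a $ i\<bar> \<le> 2 * r" for i
        using that plateau_simps(2)[OF assms, of "x $ i - a $ i"] by (force simp: p_def)
      then have "(\<Sum>i\<in>UNIV. \<bar>(x - a) $ i\<bar>) \<le> (\<Sum>i\<in>(UNIV::'n set). 2 * r)" by (intro sum_mono) auto
      then show ?thesis using norm_le_l1_cart[of "x - a"] by simp
    qed
  qed
qed

section \<open>Diffeomorphisms and ambient isotopies of space\<close>

lemma diffeomorphism_compose:
  assumes "diffeomorphism \<phi>" "diffeomorphism \<psi>"
  shows "diffeomorphism (\<lambda>x. \<phi> (\<psi> x))"
proof -
  have b: "bij (\<phi> \<circ> \<psi>)" using assms by (auto simp: diffeomorphism_def intro: bij_comp)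
  have "inv (\<phi> \<circ> \<psi>) = inv \<psi> \<circ> inv \<phi>"
    using assms by (auto simp: diffeomorphism_def intro: o_inv_distrib)
  then show ?thesis
    using b assms smooth_compose[of \<phi> \<psi>] smooth_compose[of "inv \<psi>" "inv \<phi>"]
    by (simp add: diffeomorphism_def o_def)
qed

lemma diffeomorphism_inv: "diffeomorphism \<phi> \<Longrightarrow> diffeomorphism (inv \<phi>)"
  by (simp add: diffeomorphism_def bij_imp_bij_inv inv_inv_eq)

lemma diffeomorphismI:
  assumes "smooth \<phi>" "smooth \<psi>" "\<And>x. \<psi> (\<phi> x) = x" "\<And>x. \<phi> (\<psi> x) = x"
  shows "diffeomorphism \<phi>"
proof -
  have "bij \<phi>" using assms(3,4) by (metis bijI')
  moreover have "inv \<phi> = \<psi>" using assms(3,4) by (intro inv_equality)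
  ultimately show ?thesis using assms by (simp add: diffeomorphism_def)
qed

text \<open>The two isotopies are composed at each time instead of being run one after the other,
  so that no smoothing at an intermediate time is needed.\<close>

lemma ambient_isotopic_trans:
  assumes "ambient_isotopic K L" "ambient_isotopic L M"
  shows "ambient_isotopic K M"
proof -
  obtain G :: "real \<Rightarrow> real ^ 3 \<Rightarrow> real ^ 3" where G: "smooth (\<lambda>(s, x). G s x)" "\<forall>s\<in>{0..1}. diffeomorphism (G s)" "G 0 = id" "G 1 ` K = L"
    using assms(1) unfolding ambient_isotopic_def by blast
  obtain H :: "real \<Rightarrow> real ^ 3 \<Rightarrow> real ^ 3" where H: "smooth (\<lambda>(s, x). H s x)" "\<forall>s\<in>{0..1}. diffeomorphism (H s)" "H 0 = id" "H 1 ` L = M"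
    using assms(2) unfolding ambient_isotopic_def by blast
  have "smooth (\<lambda>p. (\<lambda>(s, x). H s x) (fst p, (\<lambda>(s, x). G s x) p))"
    by (intro smooth_compose[OF H(1)] smooth_Pair smooth_fst smooth_ident G(1))
  then have "smooth (\<lambda>(s, x). H s (G s x))" by (simp add: case_prod_beta')
  moreover have "\<forall>s\<in>{0..1}. diffeomorphism (\<lambda>x. H s (G s x))"
    using G(2) H(2) by (auto intro: diffeomorphism_compose)
  moreover have "(\<lambda>x. H 1 (G 1 x)) ` K = M" using G(4) H(4) by auto
  ultimately show ?thesis
    unfolding ambient_isotopic_def
    by (intro exI[of _ "\<lambda>s x. H s (G s x)"]) (auto simp: G(3) H(3))
qed

text \<open>Reversing time and normalising by the final map inverts an isotopy, without any inversion
  of the extension outside the unit time interval.\<close>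

lemma ambient_isotopic_sym:
  assumes "ambient_isotopic K L"
  shows "ambient_isotopic L K"
proof -
  obtain H :: "real \<Rightarrow> real ^ 3 \<Rightarrow> real ^ 3" where H: "smooth (\<lambda>(s, x). H s x)" "\<forall>s\<in>{0..1}. diffeomorphism (H s)" "H 0 = id" "H 1 ` K = L"
    using assms(1) unfolding ambient_isotopic_def by blast
  have d: "diffeomorphism (H 1)" using H by simp
  then have i: "bij (H 1)" "smooth (inv (H 1))" by (auto simp: diffeomorphism_def)
  have "smooth (\<lambda>p :: real \<times> (real ^ 3). inv (H 1) (snd p))"
    by (rule smooth_compose[OF i(2)]) (rule smooth_snd[OF smooth_ident])
  moreover have "smooth (\<lambda>p :: real \<times> (real ^ 3). 1 - fst p)"
    by (intro smooth_diff smooth_const smooth_fst smooth_ident)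
  ultimately have "smooth (\<lambda>p. (\<lambda>(s, x). H s x) (1 - fst p, inv (H 1) (snd p)))"
    by (intro smooth_compose[OF H(1)] smooth_Pair)
  then have "smooth (\<lambda>(s, x). H (1 - s) (inv (H 1) x))"
    by (simp only: case_prod_beta' fst_conv snd_conv)
  moreover have "\<forall>s\<in>{0..1}. diffeomorphism (\<lambda>x. H (1 - s) (inv (H 1) x))"
  proof
    fix s :: real assume "s \<in> {0..1}"
    then have "1 - s \<in> {0..1}" by auto
    then show "diffeomorphism (\<lambda>x. H (1 - s) (inv (H 1) x))"
      using H(2) by (intro diffeomorphism_compose[OF _ diffeomorphism_inv[OF d]]) blast
  qed
  moreover have "(\<lambda>x. H (1 - 1) (inv (H 1) x)) ` L = K"
    using H(3,4) i(1) by (auto simp: image_image bij_is_inj)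
  moreover have "(\<lambda>x. H (1 - 0) (inv (H 1) x)) = id"
    using i(1) by (auto simp: bij_is_surj surj_f_inv_f)
  ultimately show ?thesis
    unfolding ambient_isotopic_def
    by (intro exI[of _ "\<lambda>s x. H (1 - s) (inv (H 1) x)"]) auto
qed

text \<open>
  Every elementary isotopy used below moves points along straight lines with constant speed. Joint smoothness
  in time and space is then evident, and only the individual stages have to be inverted.
\<close>

lemma ambient_isotopic_line:
  assumes "smooth V" "\<And>s. s \<in> {0..1} \<Longrightarrow> diffeomorphism (\<lambda>x. x + s *\<^sub>R V x)"
  shows "ambient_isotopic K ((\<lambda>x. x + V x) ` K)"
proof -
  have "smooth (\<lambda>p. snd p + fst p *\<^sub>R V (snd p))"
    by (intro smooth_add smooth_snd smooth_ident smooth_scaleR smooth_fst smooth_compose[OF assms(1)])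
  then have "smooth (\<lambda>(s, x). x + s *\<^sub>R V x)" by (simp add: case_prod_beta')
  then show ?thesis
    unfolding ambient_isotopic_def
    using assms(2) by (intro exI[of _ "\<lambda>s x. x + s *\<^sub>R V x"]) auto
qed

lemma diffeomorphism_shear:
  fixes A :: "'a::euclidean_space \<Rightarrow> real"
  assumes "smooth A" "\<And>x c. A (x + c *\<^sub>R e) = A x"
  shows "diffeomorphism (\<lambda>x. x + A x *\<^sub>R e)"
proof (rule diffeomorphismI[where \<psi>="\<lambda>x. x - A x *\<^sub>R e"])
  have "A (x - c *\<^sub>R e) = A x" for x c using assms(2)[of x "- c"] by simp
  then show "x - A x *\<^sub>R e + A (x - A x *\<^sub>R e) *\<^sub>R e = x" for x by simp
qed (use assms in \<open>auto intro!: smooth_add smooth_diff smooth_ident smooth_scaleR smooth_const\<close>)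

lemma ambient_isotopic_shear:
  assumes "smooth A" "\<And>x c. A (x + c *\<^sub>R e) = A x"
  shows "ambient_isotopic K ((\<lambda>x. x + A x *\<^sub>R e) ` K)"
proof (rule ambient_isotopic_line)
  show "smooth (\<lambda>x. A x *\<^sub>R e)" by (intro smooth_scaleR smooth_const assms)
  show "diffeomorphism (\<lambda>x. x + s *\<^sub>R A x *\<^sub>R e)" for s
    using diffeomorphism_shear[of "\<lambda>x. s * A x" e] assms smooth_mult[OF smooth_const assms(1), of s]
    by simp
qed

lemma ambient_isotopic_scale:
  assumes "c > 0"
  shows "ambient_isotopic K ((\<lambda>x. c *\<^sub>R x) ` K)"
proof -
  have "ambient_isotopic K ((\<lambda>x. x + (c - 1) *\<^sub>R x) ` K)"
  proof (rule ambient_isotopic_line)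
    show "smooth (\<lambda>x. (c - 1) *\<^sub>R x)" by (intro smooth_scaleR smooth_const smooth_ident)
    fix s :: real assume s: "s \<in> {0..1}"
    define d where "d = 1 + s * (c - 1)"
    have "d = (1 - s) + s * c" by (simp add: d_def algebra_simps)
    then have "d > 0" using s assms
      by (cases "s = 1") (auto intro: add_pos_nonneg)
    have "diffeomorphism (\<lambda>x::real^3. d *\<^sub>R x)"
      by (rule diffeomorphismI[where \<psi>="\<lambda>x. inverse d *\<^sub>R x"])
         (use \<open>d > 0\<close> in \<open>auto intro!: smooth_scaleR smooth_const smooth_ident\<close>)
    then show "diffeomorphism (\<lambda>x::real^3. x + s *\<^sub>R (c - 1) *\<^sub>R x)"
      by (simp add: d_def algebra_simps)
  qed
  then show ?thesis by (simp add: algebra_simps)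
qed

subsection \<open>Small perturbations of the identity\<close>

lemma lipschitz_derivative_bound:
  assumes "C-lipschitz_on UNIV V" "(V has_derivative D) (at x)"
  shows "norm (D h) \<le> C * norm h"
proof (cases "h = 0")
  case True
  then show ?thesis using assms(2) has_derivative_linear linear_0 by fastforce
next
  case False
  interpret D: linear D using assms(2) has_derivative_linear by blast
  show ?thesis
  proof (rule field_le_epsilon)
    fix e :: real assume "e > 0"
    define e' where "e' = e / norm h"
    have "e' > 0" using \<open>e > 0\<close> False by (simp add: e'_def)
    then obtain d where d: "d > 0" "\<And>y. norm (y - x) < d \<Longrightarrow> norm (V y - V x - D (y - x)) \<le> e' * norm (y - x)"
      using assms(2) unfolding has_derivative_at_alt by blast
    define t where "t = d / (2 * norm h)"
    have t: "t > 0" "norm (t *\<^sub>R h) < d" using d False by (auto simp: t_def)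
    have "t * norm (D h) = norm (D (t *\<^sub>R h))" using t by (simp add: D.scaleR)
    also have "\<dots> \<le> norm (V (x + t *\<^sub>R h) - V x) + norm (V (x + t *\<^sub>R h) - V x - D (t *\<^sub>R h))"
      by (metis norm_minus_commute norm_triangle_sub)
    also have "\<dots> \<le> C * norm (t *\<^sub>R h) + e' * norm (t *\<^sub>R h)"
      using d(2)[of "x + t *\<^sub>R h"] t(2) lipschitz_onD[OF assms(1), of "x + t *\<^sub>R h" x]
      by (intro add_mono) (auto simp: dist_norm)
    also have "\<dots> = t * (C * norm h + e)" using t False by (simp add: e'_def field_simps)
    finally show "norm (D h) \<le> C * norm h + e" using t by simp
  qed
qed

lemma C_times_det3:
  fixes M :: "'a::euclidean_space \<Rightarrow> real ^ 3 ^ 3"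
  assumes "\<And>i j. C_times k (\<lambda>x. M x $ i $ j)"
  shows "C_times k (\<lambda>x. det (M x))"
proof -
  show ?thesis unfolding det_3 diff_conv_add_uminus
    by (intro C_times_add C_times_bilinear[OF bounded_bilinear_mult] assms
        C_times_linear_comp[OF bounded_linear_minus[OF bounded_linear_ident]])
qed

text \<open>By the inverse function theorem the derivative of the inverse solves a linear system whose
  coefficients are derivatives of \<open>F\<close> evaluated along the inverse itself. Cramer's rule therefore lifts every order of
  differentiability of the inverse to the next one.\<close>

lemma smooth_inv:
  fixes F :: "real ^ 3 \<Rightarrow> real ^ 3"
  assumes F: "smooth F" "bij F" and cont: "continuous_on UNIV (inv F)"
    and inj: "\<And>x. inj (frechet_derivative F (at x))"
  shows "smooth (inv F)"
proof -
  define G where "G = inv F"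
  define DF where "DF x = frechet_derivative F (at x)" for x
  have FG: "F (G y) = y" for y using F(2) by (simp add: G_def bij_is_surj surj_f_inv_f)
  have DF: "(F has_derivative DF x) (at x)" "smooth (\<lambda>x. DF x v)" for x v
    using smooth_frechet[OF F(1)] by (simp_all add: DF_def)
  define A where "A y = matrix (DF (G y))" for y
  have lin: "linear (DF x)" for x using DF(1) has_derivative_linear by blast
  have Av: "A y *v v = DF (G y) v" for y v
    using lin by (simp add: A_def matrix_works)
  have det: "det (A y) \<noteq> 0" for y
    using det_nz_iff_inj[OF lin, of "G y"] inj[of "G y"] by (simp add: A_def DF_def)
  have Aij: "A y $ i $ j = DF (G y) (axis j 1) $ i" for y i j
    by (simp add: A_def matrix_def)
  have "\<exists>D. \<forall>y. (G has_derivative D y) (at y) \<and> (\<forall>v. A y *v D y v = v)"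
  proof -
    have "\<exists>D. (G has_derivative D) (at y) \<and> (\<forall>v. A y *v D v = v)" for y
    proof -
      obtain g where g: "linear g" "g \<circ> DF (G y) = id" "DF (G y) \<circ> g = id"
        using linear_injective_isomorphism[OF lin, of "G y"] inj[of "G y"]
        by (auto simp: DF_def fun_eq_iff)
      have "(G has_derivative g) (at y)"
      proof (rule has_derivative_inverse_basic[where T=UNIV, OF DF(1)])
        show "bounded_linear g" using g(1) linear_conv_bounded_linear by blast
        show "continuous (at y) G" using cont by (simp add: G_def continuous_on_eq_continuous_at)
      qed (use g(2) FG in \<open>auto intro: open_UNIV\<close>)
      moreover have "A y *v g v = v" for v using g(3) by (simp add: Av fun_eq_iff)
      ultimately show ?thesis by blast
    qed
    then show ?thesis by metis
  qed
  then obtain D where D: "\<And>y. (G has_derivative D y) (at y)" "\<And>y v. A y *v D y v = v" by blast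
  have "C_times k G" for k
  proof (induction k)
    case 0
    then show ?case using cont by (simp add: G_def)
  next
    case (Suc k)
    have A: "C_times k (\<lambda>y. A y $ i $ j)" for i j
      unfolding Aij using DF(2) by (intro C_times_linear_comp[OF bounded_linear_vec_nth] C_times_compose[OF _ Suc.IH])
        (simp add: smooth_def)
    have "C_times k (\<lambda>y. D y v)" for v
    proof (rule C_times_vec)
      fix m
      have "D y v = (\<chi> m. det (\<chi> i j. if j = m then v $ i else A y $ i $ j) / det (A y))" for y
        using cramer[OF det] D(2) by blast
      then have "D y v $ m = det (\<chi> i j. if j = m then v $ i else A y $ i $ j) * inverse (det (A y))" for y
        by (simp add: divide_inverse)
      moreover have "C_times k (\<lambda>y. if j = m then v $ i else A y $ i $ j)" for i j
        using A by (cases "j = m") (auto intro: C_times_const)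
      ultimately show "C_times k (\<lambda>y. D y v $ m)"
        using det by (auto intro!: C_times_bilinear[OF bounded_bilinear_mult] C_times_det3 C_times_inverse A)
    qed
    then show ?case using D(1) by (intro C_times_SucI)
  qed
  then show ?thesis by (simp add: smooth_def G_def)
qed

text \<open>
  The equation \<open>x = y - V x\<close> has a unique solution by Banach's fixed point theorem, and the
  same contraction estimate, applied to the derivative, excludes kernel vectors.
\<close>

lemma diffeomorphism_perturb_id:
  fixes V :: "real ^ 3 \<Rightarrow> real ^ 3"
  assumes V: "smooth V" "(1/2)-lipschitz_on UNIV V"
  shows "diffeomorphism (\<lambda>x. x + V x)" and "2-lipschitz_on UNIV (inv (\<lambda>x. x + V x))"
proof -
  define F where "F x = x + V x" for x
  have sF: "smooth F" unfolding F_def by (intro smooth_add smooth_ident V)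
  have L: "norm (V x - V y) \<le> 1/2 * norm (x - y)" for x y
    using lipschitz_onD[OF V(2)] by (simp add: dist_norm)
  have exp: "norm (x - y) \<le> 2 * norm (F x - F y)" for x y
  proof -
    have "norm (x - y) \<le> norm (F x - F y) + norm (V x - V y)"
      unfolding F_def using norm_triangle_ineq4[of "x + V x - (y + V y)" "V x - V y"] by (simp add: algebra_simps)
    then show ?thesis using L[of x y] by simp
  qed
  have "inj F" using exp by (intro injI) (metis diff_self norm_le_zero_iff norm_zero mult_zero_right right_minus_eq)
  moreover have "surj F"
  proof -
    have "\<exists>x. y = F x" for y
    proof -
      have "\<exists>!x. y - V x = x"
        by (rule banach_fix_type[of "1/2"]) (use L in \<open>auto simp: dist_norm norm_minus_commute\<close>)
      then show ?thesis by (metis F_def diff_add_cancel)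
    qed
    then show ?thesis by blast
  qed
  ultimately have bij: "bij F" by (simp add: bij_def)
  have lip: "2-lipschitz_on UNIV (inv F)"
  proof (rule lipschitz_onI)
    show "dist (inv F x) (inv F y) \<le> 2 * dist x y" for x y
      using exp[of "inv F x" "inv F y"] \<open>surj F\<close> by (simp add: dist_norm surj_f_inv_f)
  qed auto
  then show "2-lipschitz_on UNIV (inv (\<lambda>x. x + V x))" by (simp add: F_def[abs_def])
  from lip have cont: "continuous_on UNIV (inv F)" by (rule lipschitz_on_continuous_on)
  have "inj (frechet_derivative F (at x))" for x
  proof -
    define D where "D = frechet_derivative V (at x)"
    have D: "(V has_derivative D) (at x)" using smooth_frechet[OF V(1)] by (simp add: D_def)
    have "(F has_derivative (\<lambda>h. h + D h)) (at x)"
      unfolding F_def by (intro has_derivative_add has_derivative_ident D)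
    then have *: "frechet_derivative F (at x) = (\<lambda>h. h + D h)" by (rule frechet_derivative_at[symmetric])
    have l: "linear (\<lambda>h. h + D h)"
      using has_derivative_linear[OF smooth_frechet(1)[OF sF, of x]] by (simp only: *)
    have "h = 0" if "h + D h = 0" for h
    proof -
      have "norm h = norm (D h)" using that by (metis add_eq_0_iff norm_minus_cancel)
      then show ?thesis using lipschitz_derivative_bound[OF V(2) D, of h] by simp
    qed
    then show ?thesis unfolding * linear_injective_0[OF l] by blast
  qed
  then have "smooth (inv F)" by (intro smooth_inv sF bij cont)
  then have "diffeomorphism F" using sF bij by (simp add: diffeomorphism_def)
  then show "diffeomorphism (\<lambda>x. x + V x)" by (simp add: F_def[abs_def])
qed

lemma ambient_isotopic_perturb:
  assumes V: "smooth V" "(1/2)-lipschitz_on UNIV V"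
  shows "ambient_isotopic K ((\<lambda>x. x + V x) ` K)"
proof (rule ambient_isotopic_line[OF V(1)])
  fix s :: real assume s: "s \<in> {0..1}"
  have "(1/2)-lipschitz_on UNIV (\<lambda>x. s *\<^sub>R V x)"
  proof (rule lipschitz_onI)
    fix x y
    have "dist (s *\<^sub>R V x) (s *\<^sub>R V y) = \<bar>s\<bar> * dist (V x) (V y)" by (simp add: dist_norm flip: scaleR_diff_right)
    also have "\<dots> \<le> 1 * dist (V x) (V y)" using s by (intro mult_right_mono) auto
    finally show "dist (s *\<^sub>R V x) (s *\<^sub>R V y) \<le> 1/2 * dist x y"
      using lipschitz_onD[OF V(2), of x y] by simp
  qed auto
  then show "diffeomorphism (\<lambda>x. x + s *\<^sub>R V x)"
    by (intro diffeomorphism_perturb_id smooth_scaleR smooth_const V)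
qed

subsection \<open>Images of knots\<close>

lemma parametrises_knot_diffeomorphism:
  assumes "diffeomorphism \<phi>" "parametrises_knot g"
  shows "parametrises_knot (\<lambda>t. \<phi> (g t))"
proof -
  have \<phi>: "bij \<phi>" "smooth \<phi>" "smooth (inv \<phi>)" using assms(1) by (auto simp: diffeomorphism_def)
  have g: "smooth g" "\<And>t. g (t + 2 * pi) = g t" "inj_on g {0..<2*pi}" "\<And>t. vector_derivative g (at t) \<noteq> 0"
    using assms(2) by (auto simp: parametrises_knot_def smooth_loop_def)
  have s: "smooth (\<lambda>t. \<phi> (g t))" by (rule smooth_compose[OF \<phi>(2) g(1)])
  have "inj_on (\<lambda>t. \<phi> (g t)) {0..<2*pi}"
    using g(3) bij_is_inj[OF \<phi>(1)] by (auto simp: inj_on_def)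
  moreover have "vector_derivative (\<lambda>t. \<phi> (g t)) (at t) \<noteq> 0" for t
  proof
    assume "vector_derivative (\<lambda>t. \<phi> (g t)) (at t) = 0"
    then have 1: "((\<lambda>t. \<phi> (g t)) has_derivative (\<lambda>h. h *\<^sub>R 0)) (at t)"
      using smooth_has_vector_derivative[OF s, of t] by (simp add: has_vector_derivative_def)
    define D where "D = frechet_derivative (inv \<phi>) (at (\<phi> (g t)))"
    have D: "(inv \<phi> has_derivative D) (at (\<phi> (g t)))" using smooth_frechet[OF \<phi>(3)] by (simp add: D_def)
    have "(inv \<phi> \<circ> (\<lambda>t. \<phi> (g t)) has_derivative (D \<circ> (\<lambda>h. h *\<^sub>R 0))) (at t)"
      using diff_chain_at[OF 1, of "inv \<phi>" D] D by simp
    moreover have "inv \<phi> \<circ> (\<lambda>t. \<phi> (g t)) = g" using \<phi>(1) by (auto simp: bij_is_inj)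
    moreover have "D \<circ> (\<lambda>h. h *\<^sub>R 0) = (\<lambda>h::real. h *\<^sub>R (0 :: real^3))"
      using linear_0[OF has_derivative_linear[OF D]] by auto
    ultimately have "(g has_vector_derivative 0) (at t)" by (simp add: has_vector_derivative_def)
    then show False using g(4) vector_derivative_at by blast
  qed
  ultimately show ?thesis using s g(2) by (simp add: parametrises_knot_def smooth_loop_def)
qed

section \<open>Stability of knots under perturbations that are small together with their derivative\<close>

text \<open>
  Projecting onto the tangent line makes the parameter near \<open>t0\<close> the inverse of a
  function \<open>\<tau> + v \<tau>\<close> of one variable, where \<open>v\<close> vanishes to second order. Cutting \<open>v\<close>
  off close to the origin turns this into a global diffeomorphism, whose inverse is defined
  everywhere. It is formed in space, along the first coordinate axis, so that
  \<open>diffeomorphism_perturb_id\<close> applies.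
\<close>

lemma local_parameter:
  fixes g :: "real \<Rightarrow> real ^ 3"
  assumes g: "smooth g" and nz: "vector_derivative g (at t0) \<noteq> 0"
  obtains \<theta> :: "real ^ 3 \<Rightarrow> real" and L \<eta> where "smooth \<theta>" "L-lipschitz_on UNIV \<theta>" "\<eta> > 0"
    "\<And>t. \<bar>t - t0\<bar> \<le> \<eta> \<Longrightarrow> \<theta> (g t) = t"
proof -
  define e where "e = vector_derivative g (at t0)"
  define c where "c = e \<bullet> e"
  have c: "c > 0" using nz by (simp add: c_def e_def)
  define u where "u x = ((x - g t0) \<bullet> e) / c" for x
  define v where "v \<tau> = u (g (t0 + \<tau>)) - \<tau>" for \<tau>
  define v' where "v' \<tau> = (vector_derivative g (at (t0 + \<tau>)) \<bullet> e) / c - 1" for \<tau>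
  have su: "smooth u"
  proof -
    have "smooth (\<lambda>x. inverse c *\<^sub>R ((x - g t0) \<bullet> e))"
      by (intro smooth_scaleR smooth_const smooth_linear_comp[OF bounded_linear_inner_left] smooth_diff smooth_ident)
    then show ?thesis by (simp add: u_def[abs_def] divide_inverse mult.commute)
  qed
  have sv: "smooth v" unfolding v_def
    by (intro smooth_diff smooth_ident smooth_compose[OF su] smooth_compose[OF g] smooth_add smooth_const)
  have dv: "(v has_real_derivative v' \<tau>) (at \<tau>)" for \<tau>
  proof -
    have "((\<lambda>\<tau>. t0 + \<tau>) has_vector_derivative 1) (at \<tau>)"
      by (auto intro!: derivative_eq_intros simp: has_vector_derivative_def)
    from vector_diff_chain_at[OF this smooth_has_vector_derivative[OF g]]
    have "((\<lambda>\<tau>. g (t0 + \<tau>)) has_vector_derivative vector_derivative g (at (t0 + \<tau>))) (at \<tau>)"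
      by (simp add: o_def)
    then have "((\<lambda>\<tau>. g (t0 + \<tau>)) has_derivative (\<lambda>h. h *\<^sub>R vector_derivative g (at (t0 + \<tau>)))) (at \<tau>)"
      by (simp add: has_vector_derivative_def)
    then have "((\<lambda>\<tau>. (g (t0 + \<tau>) - g t0) \<bullet> e) has_derivative (\<lambda>h. (h *\<^sub>R vector_derivative g (at (t0 + \<tau>)) - 0) \<bullet> e)) (at \<tau>)"
      by (intro has_derivative_inner_left has_derivative_diff has_derivative_const)
    then have "((\<lambda>\<tau>. (g (t0 + \<tau>) - g t0) \<bullet> e) has_real_derivative (vector_derivative g (at (t0 + \<tau>)) \<bullet> e)) (at \<tau>)"
      by (simp add: has_field_derivative_def mult_commute_abs)
    then show ?thesis unfolding v_def v'_def u_def
      by (intro DERIV_diff DERIV_cdivide DERIV_ident)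
  qed
  obtain C where C: "C > 0" "\<And>r. r > 0 \<Longrightarrow> (C / r)-lipschitz_on UNIV (plateau r)" using plateau_lipschitz by blast
  define \<kappa> where "\<kappa> = 1 / (2 * (1 + 2 * C))"
  have \<kappa>: "\<kappa> > 0" "\<kappa> * (1 + 2 * C) = 1/2" using C by (auto simp: \<kappa>_def field_simps)
  have v0: "v 0 = 0" "v' 0 = 0" using c by (simp_all add: v_def v'_def u_def e_def c_def)
  have "isCont v' 0"
  proof -
    have "continuous_on UNIV v'" unfolding v'_def
      using c smooth_imp_continuous_on[OF smooth_vector_derivative[OF g], of UNIV]
      by (auto intro!: continuous_intros continuous_on_compose2[of UNIV "\<lambda>t. vector_derivative g (at t)"])
    then show ?thesis by (simp add: continuous_on_eq_continuous_at)
  qed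
  then obtain d where d: "d > 0" "\<And>\<tau>. \<bar>\<tau>\<bar> < d \<Longrightarrow> \<bar>v' \<tau>\<bar> < \<kappa>"
    using \<kappa>(1) v0(2) unfolding continuous_at_eps_delta by (auto simp: dist_real_def)
  define \<eta> where "\<eta> = d / 3"
  have \<eta>: "\<eta> > 0" "2 * \<eta> < d" using d by (auto simp: \<eta>_def)
  let ?S = "{- (2 * \<eta>)..2 * \<eta>}"
  have Lv: "\<kappa>-lipschitz_on ?S v"
  proof (rule lipschitz_onI)
    show "dist (v x) (v y) \<le> \<kappa> * dist x y" if "x \<in> ?S" "y \<in> ?S" for x y
    proof -
      have "norm (v x - v y) \<le> \<kappa> * norm (x - y)"
      proof (rule field_differentiable_bound[of ?S v v'])
        fix z assume "z \<in> ?S"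
        then have "\<bar>v' z\<bar> < \<kappa>" using \<eta> by (intro d(2)) auto
        then show "norm (v' z) \<le> \<kappa>" by simp
        show "(v has_field_derivative v' z) (at z within ?S)"
          using dv by (rule has_field_derivative_at_within)
      qed (use that in auto)
      then show ?thesis by (simp add: dist_norm)
    qed
  qed (use \<kappa> in auto)
  \<comment> \<open>Cut the nonlinear part off so that the correction is globally Lipschitz with constant one half.\<close>
  define w where "w \<tau> = plateau \<eta> \<tau> * v \<tau>" for \<tau>
  have sw: "smooth w" unfolding w_def by (intro smooth_mult smooth_plateau sv)
  have wS: "(1 * \<kappa> + (C / \<eta>) * (\<kappa> * (2 * \<eta>)))-lipschitz_on ?S (\<lambda>\<tau>. plateau \<eta> \<tau> *\<^sub>R v \<tau>)"
  proof (intro lipschitz_bounded_mult Lv)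
    show "(C / \<eta>)-lipschitz_on ?S (plateau \<eta>)" using C(2)[OF \<eta>(1)] lipschitz_on_subset by blast
    show "norm (v x) \<le> \<kappa> * (2 * \<eta>)" if "x \<in> ?S" for x
    proof -
      have "norm (v x) \<le> \<kappa> * \<bar>x\<bar>" using lipschitz_onD[OF Lv that, of 0] \<eta> by (simp add: v0 dist_norm)
      also have "\<dots> \<le> \<kappa> * (2 * \<eta>)" using that \<kappa> by (intro mult_left_mono) auto
      finally show ?thesis .
    qed
  qed (use plateau_simps[OF \<eta>(1)] \<kappa> \<eta> in auto)
  have "1 * \<kappa> + (C / \<eta>) * (\<kappa> * (2 * \<eta>)) = 1/2" using \<kappa> \<eta> by (simp add: algebra_simps)
  then have wS: "(1/2)-lipschitz_on ?S w"
    using wS unfolding w_def[abs_def] by (simp only: real_scaleR_def)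
  define cl where "cl \<tau> = max (- (2 * \<eta>)) (min (2 * \<eta>) \<tau>)" for \<tau> :: real
  have cl: "cl \<tau> \<in> ?S" "w (cl \<tau>) = w \<tau>" "\<bar>cl \<tau> - cl \<sigma>\<bar> \<le> \<bar>\<tau> - \<sigma>\<bar>" for \<tau> \<sigma>
    using \<eta> plateau_simps(2)[OF \<eta>(1)]
    by (auto simp: cl_def w_def max_def min_def abs_if)
  have Lw: "\<bar>w x - w y\<bar> \<le> 1/2 * \<bar>x - y\<bar>" for x y
    using lipschitz_onD[OF wS cl(1) cl(1), of x y] cl(3)[of x y] by (simp add: cl(2) dist_real_def)
  define W where "W x = w (x $ 1) *\<^sub>R (axis 1 1 :: real ^ 3)" for x :: "real ^ 3"
  have W: "smooth W" unfolding W_def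
    by (intro smooth_scaleR smooth_compose[OF sw] smooth_nth smooth_ident smooth_const)
  have W2: "(1/2)-lipschitz_on UNIV W"
  proof (rule lipschitz_onI)
    fix x y
    have "dist (W x) (W y) = \<bar>w (x $ 1) - w (y $ 1)\<bar>"
      by (simp add: W_def dist_norm norm_axis_1 flip: scaleR_diff_left)
    also have "\<dots> \<le> 1/2 * \<bar>(x - y) $ 1\<bar>" using Lw by simp
    also have "\<dots> \<le> 1/2 * dist x y" using component_le_norm_cart[of "x - y" 1] by (simp add: dist_norm)
    finally show "dist (W x) (W y) \<le> 1/2 * dist x y" .
  qed auto
  define F where "F x = x + W x" for x
  have F: "bij F" "smooth (inv F)" "2-lipschitz_on UNIV (inv F)"
    using diffeomorphism_perturb_id[OF W W2] by (auto simp: F_def[abs_def] diffeomorphism_def)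
  define \<theta> where "\<theta> x = t0 + inv F (u x *\<^sub>R axis 1 1) $ 1" for x
  show ?thesis
  proof (rule that[of \<theta> "2 * (norm e / c)" \<eta>])
    show "smooth \<theta>" unfolding \<theta>_def
      by (intro smooth_add smooth_const smooth_nth smooth_compose[OF F(2)] smooth_scaleR su)
    show "(2 * (norm e / c))-lipschitz_on UNIV \<theta>"
    proof (rule lipschitz_onI)
      fix x y
      have uu: "\<bar>u x - u y\<bar> \<le> norm e / c * norm (x - y)"
      proof -
        have "u x - u y = ((x - y) \<bullet> e) / c" by (simp add: u_def inner_diff_left diff_divide_distrib)
        then show ?thesis using c Cauchy_Schwarz_ineq2[of "x - y" e]
          by (simp add: abs_divide divide_right_mono mult.commute)
      qed
      have "dist (\<theta> x) (\<theta> y) = \<bar>(inv F (u x *\<^sub>R axis 1 1) - inv F (u y *\<^sub>R axis 1 1)) $ 1\<bar>"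
        by (simp add: \<theta>_def dist_real_def)
      also have "\<dots> \<le> dist (inv F (u x *\<^sub>R axis 1 1)) (inv F (u y *\<^sub>R axis 1 1))"
        using component_le_norm_cart by (simp only: dist_norm)
      also have "\<dots> \<le> 2 * dist (u x *\<^sub>R axis 1 1) (u y *\<^sub>R axis 1 1 :: real ^ 3)"
        using lipschitz_onD[OF F(3)] by blast
      also have "dist (u x *\<^sub>R axis 1 1) (u y *\<^sub>R axis 1 1 :: real ^ 3) = \<bar>u x - u y\<bar>"
        by (simp add: dist_norm norm_axis_1 flip: scaleR_diff_left)
      finally show "dist (\<theta> x) (\<theta> y) \<le> 2 * (norm e / c) * dist x y" using uu by (simp add: dist_norm)
    qed (use c in auto)
    show "\<theta> (g t) = t" if t: "\<bar>t - t0\<bar> \<le> \<eta>" for t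
    proof -
      define \<tau> where "\<tau> = t - t0"
      have "u (g t) = \<tau> + w \<tau>" using t plateau_simps(1)[OF \<eta>(1), of \<tau>] by (simp add: w_def v_def \<tau>_def)
      then have "u (g t) *\<^sub>R axis 1 1 = F (\<tau> *\<^sub>R axis 1 1)"
        by (simp add: F_def W_def axis_def scaleR_add_left)
      then show ?thesis using F(1) by (simp add: \<theta>_def bij_is_inj inv_f_f \<tau>_def axis_def)
    qed
  qed (use \<eta> in auto)
qed

lemma periodic_int:
  fixes f :: "real \<Rightarrow> 'a"
  assumes "\<And>t. f (t + 2 * pi) = f t"
  shows "f (t + 2 * pi * of_int k) = f t"
proof -
  have n: "f (t + 2 * pi * real n) = f t" for n t
  proof (induction n)
    case (Suc n)
    have "f (t + 2 * pi * real (Suc n)) = f ((t + 2 * pi * real n) + 2 * pi)" by (simp add: algebra_simps)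
    then show ?case using Suc assms by simp
  qed simp
  show ?thesis
  proof (cases "k \<ge> 0")
    case True
    then show ?thesis using n[of t "nat k"] by simp
  next
    case False
    then show ?thesis using n[of "t + 2 * pi * of_int k" "nat (- k)"] by simp
  qed
qed

lemma shift_to_period: "\<exists>k::int. t + 2 * pi * of_int k \<in> {a..<a + 2 * pi}"
proof -
  define k where "k = - \<lfloor>(t - a) / (2 * pi)\<rfloor>"
  have "of_int (- k) \<le> (t - a) / (2 * pi)" "(t - a) / (2 * pi) < of_int (- k) + 1"
    unfolding k_def by linarith+
  then have "t + 2 * pi * of_int k \<in> {a..<a + 2 * pi}" by (auto simp: field_simps)
  then show ?thesis by blast
qed

lemma parametrises_knot_inj:
  assumes "parametrises_knot g" "g s = g t"
  shows "\<exists>k::int. s = t + 2 * pi * of_int k"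
proof -
  have per: "\<And>t. g (t + 2 * pi) = g t" and inj: "inj_on g {0..<2 * pi}"
    using assms(1) by (auto simp: parametrises_knot_def smooth_loop_def)
  obtain j k :: int where jk: "s + 2 * pi * of_int j \<in> {0..<0 + 2 * pi}" "t + 2 * pi * of_int k \<in> {0..<0 + 2 * pi}"
    using shift_to_period by meson
  have "g (s + 2 * pi * of_int j) = g (t + 2 * pi * of_int k)"
    using periodic_int[of g, OF per] assms(2) by simp
  then have "s + 2 * pi * of_int j = t + 2 * pi * of_int k" using inj jk by (auto simp: inj_on_def)
  then have "s = t + 2 * pi * of_int (k - j)" by (simp add: algebra_simps)
  then show ?thesis by blast
qed

text \<open>Injectivity and compactness: a knot comes close to one of its points only near the
  corresponding parameter, up to full periods.\<close>

lemma near_point_near_parameter: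
  assumes g: "parametrises_knot g" and \<eta>: "\<eta> > 0"
  obtains \<rho> where "\<rho> > 0" "\<And>t. norm (g t - g t0) < \<rho> \<Longrightarrow> \<exists>k::int. \<bar>t + 2 * pi * of_int k - t0\<bar> \<le> \<eta>"
proof -
  have per: "\<And>t. g (t + 2 * pi) = g t" and sm: "smooth g"
    using g by (auto simp: parametrises_knot_def smooth_loop_def)
  define A where "A = {t0 + \<eta>..t0 + 2 * pi - \<eta>}"
  have "closed (g ` A)"
    unfolding A_def by (intro compact_imp_closed compact_continuous_image smooth_imp_continuous_on[OF sm]) auto
  moreover have "g t0 \<notin> g ` A"
  proof
    assume "g t0 \<in> g ` A"
    then obtain t where t: "t \<in> A" "g t = g t0" by auto
    then obtain k :: int where k: "t = t0 + 2 * pi * of_int k" using parametrises_knot_inj[OF g] by blast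
    have "0 < 2 * pi * of_int k" "2 * pi * real_of_int k < 2 * pi * 1" using t(1) \<eta> unfolding A_def k atLeastAtMost_iff by linarith+
    have "0 < real_of_int k" using \<open>0 < 2 * pi * of_int k\<close> by (simp add: zero_less_mult_iff)
    moreover have "real_of_int k < 1"
      using \<open>2 * pi * real_of_int k < 2 * pi * 1\<close> by (rule mult_left_less_imp_less) simp
    ultimately show False by simp
  qed
  ultimately have "open (- g ` A)" "g t0 \<in> - g ` A" by auto
  then obtain \<rho> where \<rho>: "\<rho> > 0" "ball (g t0) \<rho> \<subseteq> - g ` A" by (rule openE)
  show ?thesis
  proof (rule that[OF \<rho>(1)])
    fix t assume t: "norm (g t - g t0) < \<rho>"
    obtain k :: int where k: "t + 2 * pi * of_int k \<in> {t0 - \<eta>..<t0 - \<eta> + 2 * pi}"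
      using shift_to_period by blast
    have "g (t + 2 * pi * of_int k) \<in> ball (g t0) \<rho>"
      using t periodic_int[of g, OF per] by (simp add: dist_norm norm_minus_commute)
    then have "t + 2 * pi * of_int k \<notin> A" using \<rho>(2) by blast
    then have "\<bar>t + 2 * pi * of_int k - t0\<bar> \<le> \<eta>" using k by (auto simp: A_def)
    then show "\<exists>k::int. \<bar>t + 2 * pi * of_int k - t0\<bar> \<le> \<eta>" by blast
  qed
qed

text \<open>
  Displacement fields along the part of the curve in a region \<open>U\<close> extend to space, with bounds
  that are linear in the size of the field.
\<close>

definition extends_fields :: "(real \<Rightarrow> real ^ 3) \<Rightarrow> (real ^ 3) set \<Rightarrow> bool" where
  "extends_fields g U \<longleftrightarrow> (\<exists>C\<ge>0. \<forall>\<epsilon>\<ge>0. \<forall>\<delta>. smooth_loop \<delta> \<longrightarrow> (\<forall>t. norm (\<delta> t) \<le> \<epsilon>) \<longrightarrow>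
     (\<forall>t. norm (vector_derivative \<delta> (at t)) \<le> \<epsilon>) \<longrightarrow>
     (\<exists>V. smooth V \<and> (C * \<epsilon>)-lipschitz_on UNIV V \<and> (\<forall>x. norm (V x) \<le> C * \<epsilon>) \<and>
          (\<forall>t. g t \<in> U \<longrightarrow> V (g t) = \<delta> t)))"

text \<open>
  Near one point of the knot the parameter is the restriction of a smooth function of space, so
  that the field itself can be transported; a cutoff glues it to an extension already found. Where
  the two regions overlap the glued fields agree along the curve, so that no partition
  of unity is needed.
\<close>

lemma extends_fields_step:
  assumes g: "parametrises_knot g"
  obtains r where "r > 0" "\<And>U. extends_fields g U \<Longrightarrow> extends_fields g (U \<union> ball (g t0) r)"
proof -
  have per: "\<And>t. g (t + 2 * pi) = g t" and sm: "smooth g" and nz: "vector_derivative g (at t0) \<noteq> 0"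
    using g by (auto simp: parametrises_knot_def smooth_loop_def)
  obtain \<theta> :: "real ^ 3 \<Rightarrow> real" and M \<eta> where \<theta>: "smooth \<theta>" "M-lipschitz_on UNIV \<theta>" "\<eta> > 0"
    "\<And>t. \<bar>t - t0\<bar> \<le> \<eta> \<Longrightarrow> \<theta> (g t) = t"
    using local_parameter[OF sm nz] by blast
  obtain \<rho> where \<rho>: "\<rho> > 0" "\<And>t. norm (g t - g t0) < \<rho> \<Longrightarrow> \<exists>k::int. \<bar>t + 2 * pi * of_int k - t0\<bar> \<le> \<eta>"
    using near_point_near_parameter[OF g \<theta>(3)] by blast
  \<comment> \<open>The cutoff below vanishes at distance more than \<open>6 * r\<close>.\<close>
  define r where "r = \<rho> / 7"
  have r: "r > 0" using \<rho> by (simp add: r_def)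
  obtain b :: "real ^ 3 \<Rightarrow> real" and L where b: "smooth b" "L-lipschitz_on UNIV b"
    "\<And>x. 0 \<le> b x" "\<And>x. b x \<le> 1" "\<And>x. norm (x - g t0) \<le> r \<Longrightarrow> b x = 1"
    "\<And>x. b x \<noteq> 0 \<Longrightarrow> norm (x - g t0) \<le> real CARD(3) * (2 * r)"
    using cutoff_cube[OF r, of "g t0"] by blast
  have M0: "M \<ge> 0" and L0: "L \<ge> 0" using \<theta>(2) b(2) by (auto simp: lipschitz_on_def)
  have "extends_fields g (U \<union> ball (g t0) r)" if U: "extends_fields g U" for U
  proof -
    obtain C where C: "C \<ge> 0" and ext: "\<And>\<epsilon> \<delta>. \<epsilon> \<ge> 0 \<Longrightarrow> smooth_loop \<delta> \<Longrightarrow> (\<And>t. norm (\<delta> t) \<le> \<epsilon>) \<Longrightarrow>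
       (\<And>t. norm (vector_derivative \<delta> (at t)) \<le> \<epsilon>) \<Longrightarrow>
       \<exists>V. smooth V \<and> (C * \<epsilon>)-lipschitz_on UNIV V \<and> (\<forall>x. norm (V x) \<le> C * \<epsilon>) \<and> (\<forall>t. g t \<in> U \<longrightarrow> V (g t) = \<delta> t)"
      using U unfolding extends_fields_def by metis
    define C' where "C' = C + (1 * (M + C) + L * (1 + C)) + (1 + C)"
    have C': "C' \<ge> 0" using C M0 L0 by (simp add: C'_def)
    have "\<exists>V. smooth V \<and> (C' * \<epsilon>)-lipschitz_on UNIV V \<and> (\<forall>x. norm (V x) \<le> C' * \<epsilon>) \<and>
        (\<forall>t. g t \<in> U \<union> ball (g t0) r \<longrightarrow> V (g t) = \<delta> t)"
      if \<epsilon>: "\<epsilon> \<ge> 0" and \<delta>: "smooth_loop \<delta>" "\<And>t. norm (\<delta> t) \<le> \<epsilon>" "\<And>t. norm (vector_derivative \<delta> (at t)) \<le> \<epsilon>" for \<epsilon> \<delta>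
    proof -
      obtain V where V: "smooth V" "(C * \<epsilon>)-lipschitz_on UNIV V" "\<And>x. norm (V x) \<le> C * \<epsilon>"
        "\<And>t. g t \<in> U \<Longrightarrow> V (g t) = \<delta> t" using ext[OF \<epsilon> \<delta>] by blast
      have s\<delta>: "smooth \<delta>" and p\<delta>: "\<And>t. \<delta> (t + 2 * pi) = \<delta> t" using \<delta>(1) by (auto simp: smooth_loop_def)
      define W where "W x = V x + b x *\<^sub>R (\<delta> (\<theta> x) - V x)" for x
      have sW: "smooth W" unfolding W_def
        by (intro smooth_add smooth_scaleR smooth_diff V b smooth_compose[OF s\<delta>] \<theta>)
      have "(\<epsilon> * M)-lipschitz_on UNIV (\<lambda>x. \<delta> (\<theta> x))"
        using lipschitz_on_compose2[OF \<theta>(2) lipschitz_on_subset[OF vector_derivative_bound_lipschitz[OF smooth_has_vector_derivative[OF s\<delta>] \<delta>(3)]]]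
        by simp
      then have "(\<epsilon> * M + C * \<epsilon>)-lipschitz_on UNIV (\<lambda>x. \<delta> (\<theta> x) - V x)"
        using V(2) by (rule lipschitz_on_diff)
      moreover have nd: "norm (\<delta> (\<theta> x) - V x) \<le> \<epsilon> + C * \<epsilon>" for x
        using norm_triangle_ineq4[of "\<delta> (\<theta> x)" "V x"] \<delta>(2)[of "\<theta> x"] V(3)[of x] by simp
      ultimately have "(1 * (\<epsilon> * M + C * \<epsilon>) + L * (\<epsilon> + C * \<epsilon>))-lipschitz_on UNIV (\<lambda>x. b x *\<^sub>R (\<delta> (\<theta> x) - V x))"
        using b(3,4) C \<epsilon> by (intro lipschitz_bounded_mult b(2)) auto
      from lipschitz_on_add[OF V(2) this]
      have "(C * \<epsilon> + (1 * (\<epsilon> * M + C * \<epsilon>) + L * (\<epsilon> + C * \<epsilon>)))-lipschitz_on UNIV W"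
        by (simp add: W_def[abs_def])
      moreover have "C * \<epsilon> + (1 * (\<epsilon> * M + C * \<epsilon>) + L * (\<epsilon> + C * \<epsilon>)) \<le> C' * \<epsilon>"
        using C \<epsilon> by (simp add: C'_def algebra_simps)
      ultimately have "(C' * \<epsilon>)-lipschitz_on UNIV W" by (rule lipschitz_on_le)
      moreover have "norm (W x) \<le> C' * \<epsilon>" for x
      proof -
        have "norm (W x) \<le> norm (V x) + \<bar>b x\<bar> * norm (\<delta> (\<theta> x) - V x)"
          unfolding W_def by (metis norm_scaleR norm_triangle_ineq)
        also have "\<dots> \<le> C * \<epsilon> + 1 * (\<epsilon> + C * \<epsilon>)"
          using b(3,4) by (intro add_mono mult_mono nd V) auto
        also have "\<dots> \<le> C' * \<epsilon>" using C \<epsilon> L0 M0 by (simp add: C'_def algebra_simps)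
        finally show ?thesis .
      qed
      moreover have "W (g t) = \<delta> t" if t: "g t \<in> U \<union> ball (g t0) r" for t
      proof -
        have loc: "\<delta> (\<theta> (g t)) = \<delta> t" if "b (g t) \<noteq> 0"
        proof -
          have "norm (g t - g t0) \<le> 3 * (2 * r)" using b(6)[OF that] by simp
          also have "\<dots> < \<rho>" using \<rho>(1) by (simp add: r_def)
          finally obtain k :: int where "\<bar>t + 2 * pi * of_int k - t0\<bar> \<le> \<eta>" using \<rho>(2) by blast
          then have "\<theta> (g (t + 2 * pi * of_int k)) = t + 2 * pi * of_int k" by (rule \<theta>(4))
          then show ?thesis using periodic_int[of g, OF per] periodic_int[of \<delta>, OF p\<delta>] by simp
        qed
        show ?thesis
        proof (cases "g t \<in> U")
          case True
          then show ?thesis using loc V(4)[of t] by (cases "b (g t) = 0") (auto simp: W_def)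
        next
          case False
          then have "norm (g t - g t0) \<le> r" using t by (auto simp: dist_norm norm_minus_commute)
          then have "b (g t) = 1" by (rule b(5))
          then show ?thesis using loc by (simp add: W_def)
        qed
      qed
      ultimately show ?thesis using sW by blast
    qed
    then show ?thesis using C' unfolding extends_fields_def by blast
  qed
  then show ?thesis using r that by blast
qed

lemma extends_fields_range:
  assumes g: "parametrises_knot g"
  shows "extends_fields g (range g)"
proof -
  have per: "\<And>t. g (t + 2 * pi) = g t" and sm: "smooth g"
    using g by (auto simp: parametrises_knot_def smooth_loop_def)
  obtain r where r: "\<And>t. r t > 0" "\<And>t U. extends_fields g U \<Longrightarrow> extends_fields g (U \<union> ball (g t) (r t))"
  proof -
    have "\<forall>t. \<exists>r>0. \<forall>U. extends_fields g U \<longrightarrow> extends_fields g (U \<union> ball (g t) r)"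
      using extends_fields_step[OF g] by metis
    then show ?thesis using that by metis
  qed
  have "compact (g ` {0..2 * pi})"
    by (intro compact_continuous_image smooth_imp_continuous_on[OF sm]) auto
  moreover have "g ` {0..2 * pi} \<subseteq> (\<Union>t\<in>{0..2 * pi}. ball (g t) (r t))" using r(1) by force
  ultimately obtain T where T: "finite T" "T \<subseteq> {0..2 * pi}" "g ` {0..2 * pi} \<subseteq> (\<Union>t\<in>T. ball (g t) (r t))"
    by (elim compactE_image[where f="\<lambda>t. ball (g t) (r t)"]) (auto intro: open_ball)
  have "extends_fields g (\<Union>t\<in>T. ball (g t) (r t))"
    using T(1)
  proof induction
    case empty
    show ?case unfolding extends_fields_def
      by (auto intro!: exI[of _ 0] smooth_const exI[of _ "\<lambda>x. 0"] lipschitz_onI)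
  next
    case (insert t T)
    then show ?case using r(2)[OF insert.IH, of t] by (simp add: Un_commute)
  qed
  moreover have "range g \<subseteq> g ` {0..2 * pi}"
  proof
    fix x assume "x \<in> range g"
    then obtain t where t: "x = g t" by blast
    obtain k :: int where "t + 2 * pi * of_int k \<in> {0..<0 + 2 * pi}" using shift_to_period by blast
    then show "x \<in> g ` {0..2 * pi}" using periodic_int[of g t k, OF per] t
      by (intro image_eqI[of _ _ "t + 2 * pi * of_int k"]) auto
  qed
  ultimately have "extends_fields g (\<Union>t\<in>T. ball (g t) (r t))" "range g \<subseteq> (\<Union>t\<in>T. ball (g t) (r t))"
    using T(3) by auto
  then show ?thesis unfolding extends_fields_def by (meson subsetD)
qed

definition C1_close :: "real \<Rightarrow> (real \<Rightarrow> 'a) \<Rightarrow> (real \<Rightarrow> 'a::real_normed_vector) \<Rightarrow> bool" where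
  "C1_close e f g \<longleftrightarrow>
     (\<forall>t. norm (f t - g t) \<le> e \<and> norm (vector_derivative f (at t) - vector_derivative g (at t)) \<le> e)"

lemma C1_closeI:
  assumes "\<And>t. norm (f t - g t) \<le> e"
    "\<And>t. norm (vector_derivative f (at t) - vector_derivative g (at t)) \<le> e"
  shows "C1_close e f g"
  using assms by (simp add: C1_close_def)

lemma C1_closeD:
  assumes "C1_close e f g"
  shows "norm (f t - g t) \<le> e" "norm (vector_derivative f (at t) - vector_derivative g (at t)) \<le> e"
  using assms by (simp_all add: C1_close_def)

lemma C1_close_trans: "C1_close d f g \<Longrightarrow> C1_close e g h \<Longrightarrow> C1_close (d + e) f h"
  unfolding C1_close_def by (meson norm_diff_triangle_le)

text \<open>
  The displacement from a knot to a nearby loop extends to a vector field of small Lipschitz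
  constant, and the straight line from the identity to its displacement map is an ambient isotopy.
\<close>

theorem knot_stable:
  assumes g: "parametrises_knot g"
  obtains \<epsilon> where "\<epsilon> > 0"
    "\<And>h. smooth_loop h \<Longrightarrow> C1_close \<epsilon> h g \<Longrightarrow> parametrises_knot h \<and> ambient_isotopic (range g) (range h)"
proof -
  obtain C where C: "C \<ge> 0" and ext: "\<And>\<epsilon> \<delta>. \<epsilon> \<ge> 0 \<Longrightarrow> smooth_loop \<delta> \<Longrightarrow> (\<And>t. norm (\<delta> t) \<le> \<epsilon>) \<Longrightarrow>
     (\<And>t. norm (vector_derivative \<delta> (at t)) \<le> \<epsilon>) \<Longrightarrow>
     \<exists>V. smooth V \<and> (C * \<epsilon>)-lipschitz_on UNIV V \<and> (\<forall>x. norm (V x) \<le> C * \<epsilon>) \<and> (\<forall>t. g t \<in> range g \<longrightarrow> V (g t) = \<delta> t)"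
    using extends_fields_range[OF g] unfolding extends_fields_def by metis
  have sg: "smooth g" "\<And>t. g (t + 2 * pi) = g t"
    using g by (auto simp: parametrises_knot_def smooth_loop_def)
  define \<epsilon> where "\<epsilon> = 1 / (2 * (C + 1))"
  have \<epsilon>: "\<epsilon> > 0" "C * \<epsilon> \<le> 1/2" using C by (auto simp: \<epsilon>_def field_simps)
  have "parametrises_knot h \<and> ambient_isotopic (range g) (range h)"
    if h: "smooth_loop h" "C1_close \<epsilon> h g" for h
  proof -
    have sh: "smooth h" "\<And>t. h (t + 2 * pi) = h t" using h(1) by (auto simp: smooth_loop_def)
    have "vector_derivative (\<lambda>t. h t - g t) (at t) = vector_derivative h (at t) - vector_derivative g (at t)" for t
      by (intro vector_derivative_at has_vector_derivative_diff smooth_has_vector_derivative sh sg)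
    moreover have "smooth_loop (\<lambda>t. h t - g t)" using sh sg by (simp add: smooth_loop_def smooth_diff)
    ultimately obtain V where V: "smooth V" "(C * \<epsilon>)-lipschitz_on UNIV V" "\<And>t. V (g t) = h t - g t"
      using ext[of \<epsilon> "\<lambda>t. h t - g t"] C1_closeD[OF h(2)] \<epsilon>(1) by auto
    have V2: "(1/2)-lipschitz_on UNIV V" using V(2) \<epsilon>(2) by (rule lipschitz_on_le)
    have eq: "(\<lambda>t. (\<lambda>x. x + V x) (g t)) = h" by (simp add: V(3))
    have "parametrises_knot h"
      using parametrises_knot_diffeomorphism[OF diffeomorphism_perturb_id(1)[OF V(1) V2] g] by (simp only: eq)
    moreover have "ambient_isotopic (range g) (range h)"
      using ambient_isotopic_perturb[OF V(1) V2, of "range g"] by (simp add: image_image V(3))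
    ultimately show ?thesis by blast
  qed
  with \<epsilon>(1) that show ?thesis by blast
qed

section \<open>Trigonometric polynomials\<close>

abbreviation sinusoid :: "nat \<Rightarrow> 'a \<Rightarrow> 'a \<Rightarrow> real \<Rightarrow> 'a::real_normed_vector" where
  "sinusoid m a b t \<equiv> cos (real m * t) *\<^sub>R a + sin (real m * t) *\<^sub>R b"

text \<open>
  The set \<open>S\<close> of admitted frequencies is part of the notion because the construction needs both
  upper bounds, to control derivatives, and lower bounds, to control antiderivatives. Generation by
  single waves gives an induction principle without reference to a coefficient sequence.
\<close>

inductive trig_poly :: "nat set \<Rightarrow> (real \<Rightarrow> 'a::real_normed_vector) \<Rightarrow> bool" for S where
  zero: "trig_poly S (\<lambda>t. 0)"
| step: "m \<in> S \<Longrightarrow> trig_poly S p \<Longrightarrow> trig_poly S (\<lambda>t. p t + sinusoid m a b t)"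

lemma trig_poly_monomial: "m \<in> S \<Longrightarrow> trig_poly S (\<lambda>t. sinusoid m a b t)"
  using trig_poly.step[OF _ trig_poly.zero, of m S a b] by simp

lemma trig_poly_const: "trig_poly UNIV (\<lambda>t. c)"
  using trig_poly_monomial[of 0 UNIV c 0] by simp

lemma trig_poly_mono: "trig_poly S p \<Longrightarrow> S \<subseteq> T \<Longrightarrow> trig_poly T p"
  by (induction rule: trig_poly.induct) (auto intro: trig_poly.intros)

lemma trig_poly_add:
  assumes "trig_poly S p" "trig_poly S q"
  shows "trig_poly S (\<lambda>t. p t + q t)"
  using assms(2)
proof (induction rule: trig_poly.induct)
  case (step m q a b)
  then have "trig_poly S (\<lambda>t. (p t + q t) + sinusoid m a b t)"
    by (intro trig_poly.step)
  then show ?case by (simp add: add.assoc)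
qed (simp add: assms(1))

lemma trig_poly_linear_comp:
  assumes "linear L" shows "trig_poly S p \<Longrightarrow> trig_poly S (\<lambda>t. L (p t))"
proof (induction rule: trig_poly.induct)
  case zero
  then show ?case using linear_0[OF assms] by (simp add: trig_poly.zero)
next
  case (step m p a b)
  then show ?case
    using trig_poly.step[OF step.hyps(1) step.IH, of "L a" "L b"] by (simp add: linear_add[OF assms] linear_scale[OF assms])
qed

lemma trig_poly_scaleR: "trig_poly S p \<Longrightarrow> trig_poly S (\<lambda>t. c *\<^sub>R p t)"
  using trig_poly_linear_comp[of "\<lambda>x. c *\<^sub>R x"] by (simp add: linear_scale_self)

lemma trig_poly_sum: "(\<And>i. i \<in> I \<Longrightarrow> trig_poly S (p i)) \<Longrightarrow> trig_poly S (\<lambda>t. \<Sum>i\<in>I. p i t)"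
  by (induction I rule: infinite_finite_induct) (auto intro: trig_poly.zero trig_poly_add)

lemma trig_poly_monomial_int:
  "trig_poly UNIV (\<lambda>t. cos (of_int k * t) *\<^sub>R a + sin (of_int k * t) *\<^sub>R b)"
proof (cases "k \<ge> 0")
  case True
  then show ?thesis using trig_poly_monomial[of "nat k" UNIV a b] by simp
next
  case False
  then have "real (nat (- k)) = - of_int k" by simp
  then show ?thesis using trig_poly_monomial[of "nat (- k)" UNIV a "- b"] by simp
qed

lemma trig_poly_mult_monomial:
  fixes a b c d :: "'a::real_normed_algebra"
  shows "trig_poly UNIV (\<lambda>t. sinusoid m a b t * sinusoid n c d t)"
proof -
  define i j where "i = int m - int n" and "j = int m + int n"
  have i: "of_int i = real m - real n" and j: "of_int j = real m + real n" by (simp_all add: i_def j_def)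
  have "trig_poly UNIV (\<lambda>t. (cos (of_int i * t) *\<^sub>R ((1/2) *\<^sub>R (a * c + b * d)) + sin (of_int i * t) *\<^sub>R ((1/2) *\<^sub>R (b * c - a * d)))
     + (cos (of_int j * t) *\<^sub>R ((1/2) *\<^sub>R (a * c - b * d)) + sin (of_int j * t) *\<^sub>R ((1/2) *\<^sub>R (a * d + b * c))))"
    by (intro trig_poly_add trig_poly_monomial_int)
  moreover have "(cos (of_int i * t) *\<^sub>R ((1/2) *\<^sub>R (a * c + b * d)) + sin (of_int i * t) *\<^sub>R ((1/2) *\<^sub>R (b * c - a * d)))
     + (cos (of_int j * t) *\<^sub>R ((1/2) *\<^sub>R (a * c - b * d)) + sin (of_int j * t) *\<^sub>R ((1/2) *\<^sub>R (a * d + b * c)))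
     = sinusoid m a b t * sinusoid n c d t" for t
  proof -
    define C S C' S' where "C = cos (real m * t)" and "S = sin (real m * t)" and "C' = cos (real n * t)" and "S' = sin (real n * t)"
    have e: "cos (of_int i * t) = C * C' + S * S'" "sin (of_int i * t) = S * C' - C * S'"
      "cos (of_int j * t) = C * C' - S * S'" "sin (of_int j * t) = S * C' + C * S'"
      unfolding i j by (simp_all add: left_diff_distrib distrib_right cos_diff cos_add sin_diff sin_add C_def S_def C'_def S'_def)
    have h: "(p *\<^sub>R ((1/2) *\<^sub>R (w + x)) + q *\<^sub>R ((1/2) *\<^sub>R (y - z))) + (r *\<^sub>R ((1/2) *\<^sub>R (w - x)) + s *\<^sub>R ((1/2) *\<^sub>R (z + y)))
        = ((p + r) / 2) *\<^sub>R w + ((p - r) / 2) *\<^sub>R x + ((s + q) / 2) *\<^sub>R y + ((s - q) / 2) *\<^sub>R z" for p q r s and w x y z :: 'a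
      by (simp add: scaleR_add_right scaleR_diff_right scaleR_add_left scaleR_diff_left add_divide_distrib diff_divide_distrib)
    have "(C *\<^sub>R a + S *\<^sub>R b) * (C' *\<^sub>R c + S' *\<^sub>R d) =
      (C * C') *\<^sub>R (a * c) + (S * S') *\<^sub>R (b * d) + (S * C') *\<^sub>R (b * c) + (C * S') *\<^sub>R (a * d)"
      by (simp add: algebra_simps)
    also have "\<dots> = ((C * C' + S * S') *\<^sub>R ((1/2) *\<^sub>R (a * c + b * d)) + (S * C' - C * S') *\<^sub>R ((1/2) *\<^sub>R (b * c - a * d)))
     + ((C * C' - S * S') *\<^sub>R ((1/2) *\<^sub>R (a * c - b * d)) + (S * C' + C * S') *\<^sub>R ((1/2) *\<^sub>R (a * d + b * c)))"
      unfolding h by (simp add: mult.commute)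
    finally show ?thesis unfolding e by (simp only: C_def S_def C'_def S'_def)
  qed
  ultimately show ?thesis by simp
qed

lemma trig_poly_mult:
  fixes p q :: "real \<Rightarrow> 'a::real_normed_algebra"
  assumes "trig_poly UNIV p" "trig_poly UNIV q"
  shows "trig_poly UNIV (\<lambda>t. p t * q t)"
  using assms(2)
proof (induction rule: trig_poly.induct)
  case zero
  then show ?case by (simp add: trig_poly.zero)
next
  case (step n q c d)
  have "trig_poly UNIV (\<lambda>t. p t * sinusoid n c d t)"
    using assms(1)
  proof (induction rule: trig_poly.induct)
    case zero
    then show ?case by (simp add: trig_poly.zero)
  next
    case (step m p a b)
    then show ?case
      using trig_poly_add[OF step.IH trig_poly_mult_monomial[of m a b n c d]] by (simp add: distrib_right)
  qed
  from trig_poly_add[OF step.IH this] show ?case by (simp add: distrib_left)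
qed

lemma trig_poly_power:
  fixes p :: "real \<Rightarrow> 'a::real_normed_algebra_1"
  shows "trig_poly UNIV p \<Longrightarrow> trig_poly UNIV (\<lambda>t. p t ^ n)"
  by (induction n) (auto intro: trig_poly_mult trig_poly_const)

lemma trig_poly_periodic:
  assumes "trig_poly S p" shows "p (t + 2 * pi) = p t"
  using assms
proof (induction rule: trig_poly.induct)
  case (step m p a b)
  have *: "real m * (t + 2 * pi) = real m * t + 2 * real m * pi" by (simp add: algebra_simps)
  have "cos (real m * (t + 2 * pi)) = cos (real m * t)" "sin (real m * (t + 2 * pi)) = sin (real m * t)"
    unfolding * by (simp_all add: cos_add sin_add cos_2npi sin_2npi)
  then show ?case using step by simp
qed simp

subsection \<open>Derivatives and antiderivatives\<close>

text \<open>
  Differentiating a wave of frequency \<open>m\<close> multiplies it by \<open>m\<close> and advances its phase by a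
  quarter period. The same formula, started at a negative phase, gives the antiderivatives.
\<close>

definition wave :: "nat \<Rightarrow> real \<Rightarrow> 'a \<Rightarrow> 'a \<Rightarrow> nat \<Rightarrow> real \<Rightarrow> 'a::real_normed_vector" where
  "wave m c a b j t = real m ^ j *\<^sub>R (cos (real m * t + c + real j * (pi / 2)) *\<^sub>R a + sin (real m * t + c + real j * (pi / 2)) *\<^sub>R b)"

lemma derivatives_wave: "derivatives (wave m c a b)"
  unfolding derivatives_def
proof (intro allI)
  fix j t
  let ?\<alpha> = "real m * t + c + real j * (pi / 2)"
  have s: "real m * t + c + real (Suc j) * (pi / 2) = ?\<alpha> + pi / 2" by (simp add: algebra_simps)
  have "((\<lambda>t. cos (real m * t + c + real j * (pi / 2))) has_vector_derivative - (sin ?\<alpha> * real m)) (at t)"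
    "((\<lambda>t. sin (real m * t + c + real j * (pi / 2))) has_vector_derivative cos ?\<alpha> * real m) (at t)"
    unfolding has_real_derivative_iff_has_vector_derivative[symmetric]
    by (auto intro!: derivative_eq_intros)
  then have "(wave m c a b j has_vector_derivative
     real m ^ j *\<^sub>R ((- (sin ?\<alpha> * real m)) *\<^sub>R a + (cos ?\<alpha> * real m) *\<^sub>R b)) (at t)"
    unfolding wave_def
    by (intro bounded_linear.has_vector_derivative[OF bounded_linear_scaleR_right]
       bounded_linear.has_vector_derivative[OF bounded_linear_scaleR_left] has_vector_derivative_add)
  moreover have "real m ^ j *\<^sub>R ((- (sin ?\<alpha> * real m)) *\<^sub>R a + (cos ?\<alpha> * real m) *\<^sub>R b) = wave m c a b (Suc j) t"
    unfolding wave_def s by (simp add: cos_add sin_add algebra_simps)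
  ultimately show "(wave m c a b j has_vector_derivative wave m c a b (Suc j) t) (at t)" by simp
qed

lemma norm_wave_le: "norm (wave m c a b j t) \<le> real m ^ j * (norm a + norm b)"
proof -
  have "norm (cos x *\<^sub>R a + sin x *\<^sub>R b) \<le> norm a + norm b" for x
  proof -
    have "norm (cos x *\<^sub>R a + sin x *\<^sub>R b) \<le> \<bar>cos x\<bar> * norm a + \<bar>sin x\<bar> * norm b"
      by (metis norm_scaleR norm_triangle_ineq)
    also have "\<dots> \<le> 1 * norm a + 1 * norm b" by (intro add_mono mult_right_mono) auto
    finally show ?thesis by simp
  qed
  then show ?thesis unfolding wave_def by (simp add: mult_left_mono)
qed

lemma trig_poly_wave: "m \<in> S \<Longrightarrow> trig_poly S (wave m c a b j)"
proof -
  assume "m \<in> S"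
  define d where "d = c + real j * (pi / 2)"
  have "wave m c a b j t = cos (real m * t) *\<^sub>R (real m ^ j *\<^sub>R (cos d *\<^sub>R a + sin d *\<^sub>R b))
     + sin (real m * t) *\<^sub>R (real m ^ j *\<^sub>R (cos d *\<^sub>R b - sin d *\<^sub>R a))" for t
  proof -
    have *: "real m * t + c + real j * (pi / 2) = real m * t + d" by (simp add: d_def)
    show ?thesis unfolding wave_def * cos_add sin_add by (simp add: algebra_simps)
  qed
  then have "wave m c a b j = (\<lambda>t. cos (real m * t) *\<^sub>R (real m ^ j *\<^sub>R (cos d *\<^sub>R a + sin d *\<^sub>R b))
     + sin (real m * t) *\<^sub>R (real m ^ j *\<^sub>R (cos d *\<^sub>R b - sin d *\<^sub>R a)))" by blast
  then show ?thesis using trig_poly_monomial[OF \<open>m \<in> S\<close>] by (simp only:)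
qed

lemma trig_poly_derivatives:
  assumes "trig_poly S p" "S \<subseteq> {..D}"
  obtains F C where "F 0 = p" "derivatives F" "C \<ge> 0" "\<And>j t. norm (F j t) \<le> C * real D ^ j" "\<And>j. trig_poly S (F j)"
proof -
  have "\<exists>F C. F 0 = p \<and> derivatives F \<and> C \<ge> 0 \<and> (\<forall>j t. norm (F j t) \<le> C * real D ^ j) \<and> (\<forall>j. trig_poly S (F j))"
    using assms(1)
  proof (induction rule: trig_poly.induct)
    case zero
    show ?case by (intro exI[of _ "\<lambda>j t. 0"] exI[of _ 0]) (auto simp: derivatives_def intro: trig_poly.zero)
  next
    case (step m p a b)
    then obtain F C where F: "F 0 = p" "derivatives F" "C \<ge> 0" "\<And>j t. norm (F j t) \<le> C * real D ^ j" "\<And>j. trig_poly S (F j)"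
      by blast
    define G where "G j t = F j t + wave m 0 a b j t" for j t
    have "G 0 = (\<lambda>t. p t + sinusoid m a b t)" by (auto simp: G_def F wave_def)
    moreover have "derivatives G" unfolding G_def by (intro derivatives_add F derivatives_wave)
    moreover have "norm (G j t) \<le> (C + (norm a + norm b)) * real D ^ j" for j t
    proof -
      have "norm (G j t) \<le> norm (F j t) + norm (wave m 0 a b j t)" unfolding G_def by (rule norm_triangle_ineq)
      also have "\<dots> \<le> C * real D ^ j + real m ^ j * (norm a + norm b)" by (intro add_mono F norm_wave_le)
      also have "\<dots> \<le> C * real D ^ j + real D ^ j * (norm a + norm b)"
        using step(1) assms(2) by (intro add_mono mult_right_mono power_mono) auto
      finally show ?thesis by (simp add: algebra_simps)
    qed
    moreover have "trig_poly S (G j)" for j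
      unfolding G_def by (intro trig_poly_add F trig_poly_wave step)
    moreover have "C + (norm a + norm b) \<ge> 0" using F(3) by simp
    ultimately show ?case by blast
  qed
  then show ?thesis using that by blast
qed

lemma trig_poly_finite_frequencies:
  assumes "trig_poly S p" obtains D where "trig_poly (S \<inter> {..D}) p"
proof -
  have "\<exists>D. trig_poly (S \<inter> {..D}) p"
    using assms
  proof (induction rule: trig_poly.induct)
    case (step m p a b)
    then obtain D where "trig_poly (S \<inter> {..D}) p" by blast
    then have "trig_poly (S \<inter> {..max D m}) p" by (rule trig_poly_mono) auto
    then show ?case using step(1) by (intro exI[of _ "max D m"] trig_poly.step) auto
  qed (auto intro: trig_poly.zero)
  then show ?thesis using that by blast
qed

lemma trig_poly_smooth:
  fixes p :: "real \<Rightarrow> 'a::euclidean_space"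
  assumes "trig_poly S p" shows "smooth p"
proof -
  obtain D where "trig_poly (S \<inter> {..D}) p" using trig_poly_finite_frequencies[OF assms] .
  then obtain F where "F 0 = p" "derivatives F" using trig_poly_derivatives[of "S \<inter> {..D}" p D] by blast
  then show ?thesis using derivatives_imp_smooth[of F 0] by simp
qed

text \<open>The constant is the same for antiderivatives of all orders, so the order can be chosen last.\<close>

lemma trig_poly_antiderivatives:
  fixes p :: "real \<Rightarrow> 'a::real_normed_vector"
  assumes "trig_poly S p" "S \<subseteq> {N..}" "N \<ge> 1"
  shows "\<exists>C\<ge>0. \<forall>n. \<exists>F. F n = p \<and> derivatives F \<and>
    (\<forall>j t. j \<le> n \<longrightarrow> norm (F j t) \<le> C / real N ^ (n - j)) \<and> (\<forall>j. trig_poly S (F j))"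
  using assms(1)
proof (induction rule: trig_poly.induct)
  case zero
  have "\<forall>n. \<exists>F. F n = (\<lambda>t. 0) \<and> derivatives F \<and> (\<forall>j t. j \<le> n \<longrightarrow> norm (F j t) \<le> 0 / real N ^ (n - j)) \<and> (\<forall>j. trig_poly S (F j))"
    by (intro allI exI[of _ "\<lambda>j t. 0 :: 'a"]) (auto simp: derivatives_def intro: trig_poly.zero)
  then show ?case by blast
next
  case (step m p a b)
  then obtain C where C: "C \<ge> 0"
    "\<And>n. \<exists>F. F n = p \<and> derivatives F \<and> (\<forall>j t. j \<le> n \<longrightarrow> norm (F j t) \<le> C / real N ^ (n - j)) \<and> (\<forall>j. trig_poly S (F j))"
    by blast
  have m: "m \<ge> N" "real m > 0" "real N > 0" using step(1) assms by auto
  have "\<exists>G. G n = (\<lambda>t. p t + sinusoid m a b t) \<and> derivatives G \<and>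
      (\<forall>j t. j \<le> n \<longrightarrow> norm (G j t) \<le> (C + (norm a + norm b)) / real N ^ (n - j)) \<and> (\<forall>j. trig_poly S (G j))" for n
  proof -
    obtain F where F: "F n = p" "derivatives F" "\<And>j t. j \<le> n \<Longrightarrow> norm (F j t) \<le> C / real N ^ (n - j)" "\<And>j. trig_poly S (F j)"
      using C(2)[of n] by blast
    define W where "W = wave m (- real n * (pi / 2)) a b"
    define G where "G j t = F j t + inverse (real m ^ n) *\<^sub>R W j t" for j t
    have "G n = (\<lambda>t. p t + sinusoid m a b t)"
      using m by (auto simp: G_def F W_def wave_def)
    moreover have "derivatives G" unfolding G_def W_def by (intro derivatives_add derivatives_scaleR F derivatives_wave)
    moreover have "norm (G j t) \<le> (C + (norm a + norm b)) / real N ^ (n - j)" if j: "j \<le> n" for j t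
    proof -
      have "norm (inverse (real m ^ n) *\<^sub>R W j t) \<le> inverse (real m ^ n) * (real m ^ j * (norm a + norm b))"
        using norm_wave_le[of m "- real n * (pi / 2)" a b j t] m by (simp add: W_def mult_left_mono)
      also have "\<dots> = (norm a + norm b) / real m ^ (n - j)"
        using m j by (simp add: power_diff field_simps)
      also have "\<dots> \<le> (norm a + norm b) / real N ^ (n - j)"
        using m by (intro divide_left_mono power_mono mult_pos_pos) auto
      finally show ?thesis
        using norm_triangle_ineq[of "F j t" "inverse (real m ^ n) *\<^sub>R W j t"] F(3)[OF j, of t]
        by (simp add: G_def add_divide_distrib)
    qed
    moreover have "trig_poly S (G j)" for j
      unfolding G_def W_def by (intro trig_poly_add F trig_poly_scaleR trig_poly_wave step)
    ultimately show ?thesis by blast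
  qed
  moreover have "C + (norm a + norm b) \<ge> 0" using C(1) by simp
  ultimately show ?case by blast
qed

subsection \<open>Density\<close>

lemma cis_eq_imp: "cis s = cis t \<Longrightarrow> \<exists>k::int. s = t + 2 * pi * of_int k"
proof -
  assume "cis s = cis t"
  then have "exp (\<i> * s) = exp (\<i> * t)" by (simp add: cis_conv_exp)
  then obtain n :: int where "\<i> * s = \<i> * t + (of_int (2 * n) * pi) * \<i>" by (auto simp: exp_eq)
  then have "complex_of_real s = complex_of_real (t + 2 * pi * of_int n)" by (auto simp: algebra_simps complex_eq_iff)
  then show ?thesis by (metis of_real_eq_iff)
qed

text \<open>
  A continuous periodic function is a continuous function on the unit circle, since the circle
  carries the quotient topology of a compact period; polynomials on the circle are trigonometric
  polynomials, so the Stone--Weierstrass theorem applies.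
\<close>

lemma trig_poly_uniform_approx:
  fixes h :: "real \<Rightarrow> 'a::euclidean_space"
  assumes h: "continuous_on UNIV h" "\<And>t. h (t + 2 * pi) = h t" and e: "e > 0"
  obtains p where "trig_poly UNIV p" "\<And>t. norm (h t - p t) < e"
proof -
  define G where "G z = h (Arg z)" for z
  have G: "G (cis t) = h t" for t
  proof -
    have "cis (Arg (cis t)) = cis t" by (simp add: cis_Arg)
    then obtain k :: int where "Arg (cis t) = t + 2 * pi * of_int k" using cis_eq_imp by blast
    then show ?thesis using periodic_int[of h, OF h(2)] by (simp add: G_def)
  qed
  have S: "compact (sphere (0::complex) 1)" by simp
  have "continuous_on (sphere 0 1) G"
  proof (rule iffD2[OF continuous_on_closed_vimage[OF compact_imp_closed[OF S]]], intro allI impI)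
    fix B :: "'a set" assume B: "closed B"
    have "G -` B \<inter> sphere 0 1 = cis ` ({0..2 * pi} \<inter> h -` B)"
    proof (intro subset_antisym subsetI)
      fix z assume z: "z \<in> G -` B \<inter> sphere 0 1"
      then have "z \<noteq> 0" by auto
      then have "cis (Arg z) = z" using z by (auto simp: cis_Arg sgn_div_norm)
      moreover obtain k :: int where k: "Arg z + 2 * pi * of_int k \<in> {0..<0 + 2 * pi}" using shift_to_period by blast
      moreover have "cis (Arg z + 2 * pi * of_int k) = cis (Arg z)"
        by (simp add: cis_mult[symmetric] cis_multiple_2pi)
      moreover have "h (Arg z + 2 * pi * of_int k) \<in> B"
        using z periodic_int[of h, OF h(2)] by (simp add: G_def)
      ultimately show "z \<in> cis ` ({0..2 * pi} \<inter> h -` B)"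
        by (intro image_eqI[of _ _ "Arg z + 2 * pi * of_int k"]) auto
    qed (auto simp: G)
    moreover
    have "compact ({0..2 * pi} \<inter> h -` B)"
      using continuous_closed_preimage[OF continuous_on_subset[OF h(1) subset_UNIV], of "{0..2 * pi}" B] B
      by (simp add: compact_eq_bounded_closed bounded_Int)
    then have "compact (cis ` ({0..2 * pi} \<inter> h -` B))"
      by (rule compact_continuous_image[rotated]) (intro continuous_on_cis continuous_on_id)
    ultimately show "closed (G -` B \<inter> sphere 0 1)" by (simp add: compact_imp_closed)
  qed
  from Stone_Weierstrass_polynomial_function[OF S this e]
  obtain g where g: "polynomial_function g" "\<And>z. z \<in> sphere 0 1 \<Longrightarrow> norm (G z - g z) < e"
    by blast
  have real: "trig_poly UNIV (\<lambda>t. r (cis t))" if "real_polynomial_function r" for r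
    using that
  proof (induction rule: real_polynomial_function.induct)
    case (linear f)
    have "f (cis t) = cos t *\<^sub>R f 1 + sin t *\<^sub>R f \<i>" for t
    proof -
      have "cis t = cos t *\<^sub>R 1 + sin t *\<^sub>R \<i>" by (simp add: complex_eq_iff)
      then show ?thesis using bounded_linear.linear[OF linear] by (simp only: linear_add linear_scale)
    qed
    then show ?case using trig_poly_monomial[of 1 UNIV "f 1" "f \<i>"] by simp
  qed (auto intro: trig_poly_const trig_poly_add trig_poly_mult)
  have "trig_poly UNIV (\<lambda>t. \<Sum>b\<in>Basis. (g (cis t) \<bullet> b) *\<^sub>R b)"
  proof (rule trig_poly_sum)
    fix b :: 'a assume "b \<in> Basis"
    then have "real_polynomial_function (\<lambda>z. g z \<bullet> b)" using g(1) by (simp add: polynomial_function_iff_Basis_inner)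
    then have "trig_poly UNIV (\<lambda>t. g (cis t) \<bullet> b)" by (rule real)
    then show "trig_poly UNIV (\<lambda>t. (g (cis t) \<bullet> b) *\<^sub>R b)"
      by (intro trig_poly_linear_comp[of "\<lambda>x. x *\<^sub>R b"]) (auto intro: linearI simp: scaleR_add_left)
  qed
  then have "trig_poly UNIV (\<lambda>t. g (cis t))" by (simp add: euclidean_representation)
  moreover have "norm (h t - g (cis t)) < e" for t using g(2)[of "cis t"] by (simp add: G)
  ultimately show ?thesis by (rule that)
qed

lemma trig_poly_split_low:
  fixes p :: "real \<Rightarrow> 'a::real_normed_vector"
  assumes "trig_poly UNIV p"
  shows "\<exists>A B q. trig_poly {N..} q \<and> p = (\<lambda>t. (\<Sum>m<N. sinusoid m (A m) (B m) t) + q t)"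
  using assms
proof (induction rule: trig_poly.induct)
  case zero
  show ?case by (intro exI[of _ "\<lambda>m. 0"] exI[of _ "\<lambda>t. 0"]) (simp add: trig_poly.zero)
next
  case (step m p a b)
  then obtain A B q where q: "trig_poly {N..} q" "p = (\<lambda>t. (\<Sum>m<N. sinusoid m (A m) (B m) t) + q t)"
    by blast
  show ?case
  proof (cases "m < N")
    case True
    define A' where "A' i = A i + (if i = m then a else 0)" for i
    define B' where "B' i = B i + (if i = m then b else 0)" for i
    have "(\<Sum>i<N. sinusoid i (A' i) (B' i) t) =
       (\<Sum>i<N. sinusoid i (A i) (B i) t) + sinusoid m a b t" for t
    proof -
      have "(\<Sum>i<N. sinusoid i (A' i) (B' i) t) =
         (\<Sum>i<N. (sinusoid i (A i) (B i) t) + (if i = m then sinusoid i a b t else 0))"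
        by (intro sum.cong) (auto simp: A'_def B'_def scaleR_add_right)
      then show ?thesis using True by (simp add: sum.distrib)
    qed
    then show ?thesis using q by (intro exI[of _ A'] exI[of _ B'] exI[of _ q]) (auto simp: algebra_simps)
  next
    case False
    then have "trig_poly {N..} (\<lambda>t. q t + sinusoid m a b t)"
      using q(1) by (intro trig_poly.step) auto
    then show ?thesis using q(2)
      by (intro exI[of _ A] exI[of _ B] exI[of _ "\<lambda>t. q t + sinusoid m a b t"])
         (simp add: add.assoc)
  qed
qed

text \<open>
  To approximate a loop together with its derivative, integrate an approximation of the
  derivative; its mean has to be removed first, and it is small because the derivative of a loop
  has mean zero.
\<close>

lemma trig_poly_C1_approx:
  fixes h :: "real \<Rightarrow> real ^ 3"
  assumes h: "smooth_loop h" and e: "e > 0"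
  obtains p where "trig_poly UNIV p" "C1_close e p h"
proof -
  have sh: "smooth h" "\<And>t. h (t + 2 * pi) = h t" using h by (auto simp: smooth_loop_def)
  define h' where "h' t = vector_derivative h (at t)" for t
  have h': "(h has_vector_derivative h' t) (at t)" for t
    using smooth_has_vector_derivative[OF sh(1)] by (simp add: h'_def)
  have ch': "continuous_on UNIV h'"
    unfolding h'_def using smooth_imp_continuous_on[OF smooth_vector_derivative[OF sh(1)]] .
  have ph': "h' (t + 2 * pi) = h' t" for t
    unfolding h'_def using periodic_vector_derivative[of h "2 * pi" t] sh(2) by blast
  \<comment> \<open>The derivative will be off by \<open>2 * d\<close> and the loop by \<open>2 * d\<close> times the length of a period.\<close>
  define d where "d = e / 16"
  have d: "d > 0" using e by (simp add: d_def)
  obtain q where q: "trig_poly UNIV q" "\<And>t. norm (h' t - q t) < d"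
    using trig_poly_uniform_approx[OF ch' ph' d] by blast
  obtain A B r where r0: "trig_poly {1..} r" "q = (\<lambda>t. (\<Sum>m<1. sinusoid m (A m) (B m) t) + r t)"
    using trig_poly_split_low[OF q(1), of 1] by blast
  define c where "c = A 0"
  have r: "trig_poly {1..} r" "q = (\<lambda>t. c + r t)" using r0 by (simp_all add: c_def)
  obtain F where F: "F 1 = r" "derivatives F" "\<And>j. trig_poly {1..} (F j)"
  proof -
    from trig_poly_antiderivatives[OF r(1) subset_refl le_refl]
    have "\<exists>F. F 1 = r \<and> derivatives F \<and> (\<forall>j. trig_poly {1..} (F j))"  by metis
    then show ?thesis using that by (elim exE conjE) simp
  qed
  have F': "(F 0 has_vector_derivative r t) (at t)" for t
    using derivativesD[OF F(2), of 0 t] F(1) by simp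
  have lip: "norm (u s - u t) \<le> B * \<bar>s - t\<bar>"
    if "\<And>t. (u has_vector_derivative u' t) (at t)" "\<And>t. norm (u' t) \<le> B" for u u' :: "real \<Rightarrow> real ^ 3" and B s t
    using lipschitz_onD[OF vector_derivative_bound_lipschitz[OF that], of s t] by (simp add: dist_norm)
  have c: "norm c \<le> d"
  proof -
    have "norm ((h (2 * pi) - F 0 (2 * pi) - (2 * pi) *\<^sub>R c) - (h 0 - F 0 0 - 0 *\<^sub>R c)) \<le> d * \<bar>2 * pi - 0\<bar>"
    proof (rule lip[where u'="\<lambda>t. h' t - r t - c"])
      show "((\<lambda>t. h t - F 0 t - t *\<^sub>R c) has_vector_derivative h' t - r t - c) (at t)" for t
      proof (intro has_vector_derivative_diff h' F')
        show "((\<lambda>t. t *\<^sub>R c) has_vector_derivative c) (at t)"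
          by (simp add: has_vector_derivative_def has_derivative_scaleR_left)
      qed
      show "norm (h' t - r t - c) \<le> d" for t using q(2)[of t] by (simp add: r(2) algebra_simps)
    qed
    moreover have "h (2 * pi) = h 0" "F 0 (2 * pi) = F 0 0"
      using sh(2)[of 0] trig_poly_periodic[OF F(3)[of 0], of 0] by auto
    ultimately have "2 * pi * norm c \<le> d * (2 * pi)" by simp
    then show ?thesis by simp
  qed
  have dr: "norm (r t - h' t) \<le> 2 * d" for t
  proof -
    have "norm (r t - h' t) \<le> norm (h' t - q t) + norm c"
      using norm_triangle_ineq4[of "q t - h' t" c] by (simp add: r(2) norm_minus_commute algebra_simps)
    then show ?thesis using q(2)[of t] c by simp
  qed
  define p where "p t = F 0 t + (h 0 - F 0 0)" for t
  have tp: "trig_poly UNIV p" unfolding p_def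
    using F(3)[of 0] by (intro trig_poly_add trig_poly_const) (auto intro: trig_poly_mono)
  have p': "(p has_vector_derivative r t) (at t)" for t
    unfolding p_def using has_vector_derivative_add[OF F' has_vector_derivative_const] by simp
  have "norm (p t - h t) \<le> e" for t
  proof -
    obtain k :: int where k: "t + 2 * pi * of_int k \<in> {0..<0 + 2 * pi}" using shift_to_period by blast
    define s where "s = t + 2 * pi * of_int k"
    have eq: "p t - h t = p s - h s"
      using periodic_int[of p, OF trig_poly_periodic[OF tp]] periodic_int[of h, OF sh(2)] by (simp add: s_def)
    have "norm (p t - h t) = norm ((p s - h s) - (p 0 - h 0))" unfolding eq by (simp add: p_def)
    also have "\<dots> \<le> 2 * d * \<bar>s - 0\<bar>"
      by (rule lip[where u'="\<lambda>t. r t - h' t"]) (auto intro!: has_vector_derivative_diff p' h' dr)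
    also have "\<dots> \<le> 2 * d * 8" using k d pi_less_4 by (intro mult_left_mono) (auto simp: s_def)
    also have "\<dots> = e" by (simp add: d_def)
    finally show ?thesis .
  qed
  moreover have "norm (vector_derivative p (at t) - vector_derivative h (at t)) \<le> e" for t
    using dr[of t] d vector_derivative_at[OF p', of t] by (simp add: d_def h'_def)
  ultimately show ?thesis using that[OF tp C1_closeI] by blast
qed

subsection \<open>Countably many knot types\<close>

fun trig_of_list :: "(nat \<times> 'a \<times> 'a) list \<Rightarrow> real \<Rightarrow> 'a::real_normed_vector" where
  "trig_of_list [] t = 0"
| "trig_of_list ((m, a, b) # xs) t = trig_of_list xs t + sinusoid m a b t"

lemma trig_poly_of_list: "trig_poly UNIV (trig_of_list xs)"
proof (induction xs)
  case Nil
  have "trig_of_list ([] :: (nat \<times> 'a \<times> 'a) list) = (\<lambda>t. 0)" by (simp add: fun_eq_iff)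
  then show ?case by (simp only: trig_poly.zero)
next
  case (Cons x xs)
  obtain m a b where x: "x = (m, a, b)" by (cases x)
  have "trig_of_list (x # xs) = (\<lambda>t. trig_of_list xs t + sinusoid m a b t)"
    by (simp add: x fun_eq_iff)
  then show ?case using trig_poly.step[OF UNIV_I Cons, of m a b] by (simp only:)
qed

lemma trig_of_list_dense:
  fixes p :: "real \<Rightarrow> 'a::euclidean_space"
  assumes p: "trig_poly UNIV p" and D: "\<And>X::'a set. open X \<Longrightarrow> X \<noteq> {} \<Longrightarrow> \<exists>d\<in>D. d \<in> X"
  shows "e > 0 \<Longrightarrow> \<exists>xs\<in>lists (UNIV \<times> D \<times> D). C1_close e (trig_of_list xs) p"
  using p
proof (induction arbitrary: e rule: trig_poly.induct)
  case zero
  have "trig_of_list ([] :: (nat \<times> 'a \<times> 'a) list) = (\<lambda>t. 0)" by (simp add: fun_eq_iff)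
  then show ?case using zero by (intro bexI[of _ "[]"]) (auto simp: C1_close_def)
next
  case (step m p a b)
  define d where "d = e / (4 * (real m + 1))"
  have d: "d > 0" "real m ^ j * (d + d) \<le> e / 2" if "j \<le> 1" for j
  proof -
    have "real m ^ j \<le> real m + 1" using that by (cases j) auto
    then have "real m ^ j * (d + d) \<le> (real m + 1) * (d + d)"
      using step.prems by (intro mult_right_mono) (auto simp: d_def)
    also have "\<dots> = e / 2" by (simp add: d_def divide_simps)
    finally show "real m ^ j * (d + d) \<le> e / 2" .
  qed (use step.prems in \<open>auto simp: d_def\<close>)
  obtain xs where xs: "xs \<in> lists (UNIV \<times> D \<times> D)" "C1_close (e / 2) (trig_of_list xs) p"
    using step.IH[of "e / 2"] step.prems by auto
  obtain a' b' where ab: "a' \<in> D" "a' \<in> ball a d" "b' \<in> D" "b' \<in> ball b d"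
    using D[of "ball a d"] D[of "ball b d"] d(1)[of 0] by auto
  define W where "W = wave m 0 (a' - a) (b' - b)"
  have W: "norm (W j t) \<le> e / 2" if "j \<le> 1" for j t
  proof -
    have "norm (W j t) \<le> real m ^ j * (norm (a' - a) + norm (b' - b))" unfolding W_def by (rule norm_wave_le)
    also have "\<dots> \<le> real m ^ j * (d + d)" using ab by (intro mult_left_mono) (auto simp: dist_norm norm_minus_commute)
    also have "\<dots> \<le> e / 2" by (rule d(2)[OF that])
    finally show ?thesis .
  qed
  define p1 where "p1 t = p t + sinusoid m a b t" for t
  define q where "q = trig_of_list ((m, a', b') # xs)"
  have eq: "q t - p1 t = (trig_of_list xs t - p t) + W 0 t" for t
    by (simp add: q_def p1_def W_def wave_def algebra_simps)
  have "trig_poly UNIV p1" unfolding p1_def by (intro trig_poly.step) (use step in auto)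
  then have sm: "smooth q" "smooth p1" "smooth (trig_of_list xs)" "smooth p"
    unfolding q_def using trig_poly_of_list step.hyps(2) by (auto intro: trig_poly_smooth)
  have W0: "(W 0 has_vector_derivative W 1 t) (at t)" for t
    using derivativesD[OF derivatives_wave, of m 0 "a' - a" "b' - b" 0 t] by (simp add: W_def)
  have "vector_derivative q (at t) - vector_derivative p1 (at t) =
     (vector_derivative (trig_of_list xs) (at t) - vector_derivative p (at t)) + W 1 t" for t
  proof -
    have "((\<lambda>t. q t - p1 t) has_vector_derivative vector_derivative q (at t) - vector_derivative p1 (at t)) (at t)"
      by (intro has_vector_derivative_diff smooth_has_vector_derivative sm)
    moreover have "((\<lambda>t. (trig_of_list xs t - p t) + W 0 t) has_vector_derivative
       (vector_derivative (trig_of_list xs) (at t) - vector_derivative p (at t)) + W 1 t) (at t)"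
      by (intro has_vector_derivative_diff has_vector_derivative_add smooth_has_vector_derivative sm W0)
    ultimately show ?thesis unfolding eq by (rule vector_derivative_unique_at)
  qed
  then have "norm (vector_derivative q (at t) - vector_derivative p1 (at t)) \<le> e" for t
    using norm_triangle_mono[OF C1_closeD(2)[OF xs(2)] W[of 1]] by simp
  moreover have "norm (q t - p1 t) \<le> e" for t
    using norm_triangle_mono[OF C1_closeD(1)[OF xs(2)] W[of 0]] by (simp add: eq)
  moreover have "(m, a', b') # xs \<in> lists (UNIV \<times> D \<times> D)" using xs(1) ab by auto
  ultimately show ?case unfolding q_def p1_def[abs_def]
    by (intro bexI[of _ "(m, a', b') # xs"] C1_closeI)
qed

text \<open>
  By stability, every knot is isotopic to a nearby trigonometric polynomial with coefficients in a
  countable dense set.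
\<close>

theorem trig_poly_knot_types:
  assumes "parametrises_knot g"
  obtains L :: "nat \<Rightarrow> real \<Rightarrow> real ^ 3" where "\<And>k. parametrises_knot (L k)" "\<And>k. trig_poly UNIV (L k)"
    "\<And>K. knot K \<Longrightarrow> \<exists>k. ambient_isotopic (range (L k)) K"
proof -
  obtain D :: "(real ^ 3) set" where D: "countable D" "\<And>X. open X \<Longrightarrow> X \<noteq> {} \<Longrightarrow> \<exists>d\<in>D. d \<in> X"
    using countable_dense_setE by blast
  define Q where "Q = {q \<in> trig_of_list ` lists (UNIV \<times> D \<times> D). parametrises_knot q}"
  have "countable (trig_of_list ` lists (UNIV \<times> D \<times> D))" using D(1) by (intro countable_image countable_lists) auto
  then have Q: "countable Q" unfolding Q_def by (rule countable_subset[rotated]) auto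
  have near: "\<exists>q\<in>Q. ambient_isotopic (range q) (range h)" if h: "parametrises_knot h" for h
  proof -
    obtain \<epsilon> where \<epsilon>: "\<epsilon> > 0" "\<And>q. smooth_loop q \<Longrightarrow> C1_close \<epsilon> q h \<Longrightarrow>
      parametrises_knot q \<and> ambient_isotopic (range h) (range q)"
      using knot_stable[OF h] by blast
    have "smooth_loop h" using h by (simp add: parametrises_knot_def)
    then obtain p where p: "trig_poly UNIV p" "C1_close (\<epsilon> / 2) p h"
      using trig_poly_C1_approx[of h "\<epsilon> / 2"] \<epsilon>(1) by auto
    obtain xs where xs: "xs \<in> lists (UNIV \<times> D \<times> D)" "C1_close (\<epsilon> / 2) (trig_of_list xs) p"
      using trig_of_list_dense[OF p(1) D(2), of "\<epsilon> / 2"] \<epsilon>(1) by auto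
    have "smooth_loop (trig_of_list xs)"
      using trig_poly_of_list[of xs] by (simp add: smooth_loop_def trig_poly_smooth trig_poly_periodic)
    moreover have "C1_close \<epsilon> (trig_of_list xs) h" using C1_close_trans[OF xs(2) p(2)] by simp
    ultimately have "parametrises_knot (trig_of_list xs) \<and> ambient_isotopic (range h) (range (trig_of_list xs))"
      by (rule \<epsilon>(2))
    then show ?thesis using xs(1) ambient_isotopic_sym unfolding Q_def by blast
  qed
  then have "Q \<noteq> {}" using assms by blast
  then have mem: "from_nat_into Q k \<in> Q" for k by (rule from_nat_into)
  show ?thesis
  proof (rule that[of "from_nat_into Q"])
    show "parametrises_knot (from_nat_into Q k)" "trig_poly UNIV (from_nat_into Q k)" for k
      using mem[of k] by (auto simp: Q_def trig_poly_of_list)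
    fix K :: "(real ^ 3) set" assume "knot K"
    then obtain q where q: "q \<in> Q" "ambient_isotopic (range q) K" using near unfolding knot_def by blast
    then obtain k where "from_nat_into Q k = q" using from_nat_into_surj[OF Q] by blast
    then show "\<exists>k. ambient_isotopic (range (from_nat_into Q k)) K" using q by blast
  qed
qed

section \<open>Knots without low frequencies\<close>

subsection \<open>Linear systems depending polynomially on a parameter\<close>

text \<open>
  This is Gauss elimination without division: eliminating one variable multiplies the remaining
  equations by the pivot, and at parameter zero the reduced system is again diagonal with nonzero
  diagonal. Only the roots of the pivots, which are nonzero polynomials, have to be excluded.
\<close>

lemma solvable_cofinitely:
  fixes G :: "'i \<Rightarrow> 'i \<Rightarrow> 'a::field poly"
  assumes "finite I" "\<And>i j. i \<in> I \<Longrightarrow> j \<in> I \<Longrightarrow> poly (G i j) 0 \<noteq> 0 \<longleftrightarrow> i = j"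
  shows "finite {r. \<not> (\<forall>y. \<exists>\<alpha>. \<forall>i\<in>I. (\<Sum>j\<in>I. poly (G i j) r * \<alpha> j) = y i)}"
  using assms
proof (induction I arbitrary: G rule: finite_induct)
  case empty
  then show ?case by simp
next
  case (insert k I)
  define H where "H i j = G k k * G i j - G i k * G k j" for i j
  have H: "poly (H i j) 0 \<noteq> 0 \<longleftrightarrow> i = j" if "i \<in> I" "j \<in> I" for i j
  proof -
    have "poly (G k j) 0 = 0" "poly (G k k) 0 \<noteq> 0" "poly (G i j) 0 \<noteq> 0 \<longleftrightarrow> i = j"
      using insert.prems[of k j] insert.prems[of k k] insert.prems[of i j] insert.hyps that by auto
    then show ?thesis by (simp add: H_def)
  qed
  define B where "B = {r. \<not> (\<forall>y. \<exists>\<alpha>. \<forall>i\<in>I. (\<Sum>j\<in>I. poly (H i j) r * \<alpha> j) = y i)}"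
  have "finite B" unfolding B_def by (rule insert.IH[OF H])
  have "G k k \<noteq> 0" using insert.prems[of k k] by auto
  then have "finite {r. poly (G k k) r = 0}" by (rule poly_roots_finite)
  have "\<exists>\<alpha>. \<forall>i\<in>insert k I. (\<Sum>j\<in>insert k I. poly (G i j) r * \<alpha> j) = y i"
    if r: "r \<notin> B" "poly (G k k) r \<noteq> 0" for r y
  proof -
    define c where "c = poly (G k k) r"
    have c: "c \<noteq> 0" using r by (simp add: c_def)
    obtain \<alpha> where \<alpha>: "\<And>i. i \<in> I \<Longrightarrow> (\<Sum>j\<in>I. poly (H i j) r * \<alpha> j) = c * y i - poly (G i k) r * y k"
    proof -
      have "\<forall>y. \<exists>\<alpha>. \<forall>i\<in>I. (\<Sum>j\<in>I. poly (H i j) r * \<alpha> j) = y i" using r(1) by (simp add: B_def)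
      from spec[OF this, of "\<lambda>i. c * y i - poly (G i k) r * y k"] show ?thesis using that by blast
    qed
    define S where "S i = (\<Sum>j\<in>I. poly (G i j) r * \<alpha> j)" for i
    define \<beta> where "\<beta> j = (if j = k then (y k - S k) / c else \<alpha> j)" for j
    have S\<beta>: "(\<Sum>j\<in>insert k I. poly (G i j) r * \<beta> j) = poly (G i k) r * ((y k - S k) / c) + S i" for i
    proof -
      have "(\<Sum>j\<in>I. poly (G i j) r * \<beta> j) = S i"
        unfolding S_def using insert.hyps by (intro sum.cong) (auto simp: \<beta>_def)
      then show ?thesis using insert.hyps by (simp add: \<beta>_def)
    qed
    have "(\<Sum>j\<in>insert k I. poly (G i j) r * \<beta> j) = y i" if "i \<in> insert k I" for i
    proof (cases "i = k")
      case True
      then show ?thesis unfolding S\<beta> using c by (simp add: c_def)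
    next
      case False
      then have "i \<in> I" using that by simp
      from \<alpha>[OF this] have "c * S i - poly (G i k) r * S k = c * y i - poly (G i k) r * y k"
        by (simp add: H_def S_def c_def left_diff_distrib sum_subtractf sum_distrib_left mult.assoc)
      then show ?thesis unfolding S\<beta> using c by (simp add: field_simps)
    qed
    then show ?thesis by blast
  qed
  then have "{r. \<not> (\<forall>y. \<exists>\<alpha>. \<forall>i\<in>insert k I. (\<Sum>j\<in>insert k I. poly (G i j) r * \<alpha> j) = y i)} \<subseteq> B \<union> {r. poly (G k k) r = 0}"
    by blast
  then show ?case using \<open>finite B\<close> \<open>finite {r. poly (G k k) r = 0}\<close> by (meson finite_Un finite_subset)
qed

subsection \<open>Fourier coefficients\<close>

definition fourier :: "int \<Rightarrow> (real \<Rightarrow> complex) \<Rightarrow> complex" where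
  "fourier k f = integral {0..2 * pi} (\<lambda>t. cis (- (of_int k * t)) * f t)"

lemma fourier_integrable:
  "continuous_on UNIV f \<Longrightarrow> (\<lambda>t. cis (- (of_int k * t)) * f t) integrable_on {0..2 * pi}"
  by (intro integrable_continuous_interval continuous_intros) (auto intro: continuous_on_subset)

lemma fourier_add:
  assumes "continuous_on UNIV f" "continuous_on UNIV g"
  shows "fourier k (\<lambda>t. f t + g t) = fourier k f + fourier k g"
  using integral_add[OF fourier_integrable[OF assms(1)] fourier_integrable[OF assms(2)], of k k]
  by (simp add: fourier_def distrib_left)

lemma fourier_cmult: "fourier k (\<lambda>t. c * f t) = c * fourier k f"
  by (simp add: fourier_def mult.left_commute[of _ c])

lemma fourier_sum:
  assumes "finite I" "\<And>i. i \<in> I \<Longrightarrow> continuous_on UNIV (f i)"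
  shows "fourier k (\<lambda>t. \<Sum>i\<in>I. f i t) = (\<Sum>i\<in>I. fourier k (f i))"
  using assms
proof (induction I)
  case empty
  then show ?case by (simp add: fourier_def)
next
  case (insert i I)
  then show ?case by (simp add: fourier_add continuous_on_sum)
qed

lemma fourier_cnj: 
  assumes "continuous_on UNIV f"
  shows "fourier k (\<lambda>t. cnj (f t)) = cnj (fourier (- k) f)"
proof -
  have "cnj (fourier (- k) f) = integral {0..2 * pi} (cnj \<circ> (\<lambda>t. cis (- (of_int (- k) * t)) * f t))"
    unfolding fourier_def
    by (rule integral_linear[OF fourier_integrable[OF assms] bounded_linear_cnj, symmetric])
  also have "cnj \<circ> (\<lambda>t. cis (- (of_int (- k) * t)) * f t) = (\<lambda>t. cis (- (of_int k * t)) * cnj (f t))"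
    by (auto simp: fun_eq_iff cis_cnj)
  finally show ?thesis by (simp add: fourier_def)
qed

lemma fourier_cis: "fourier k (\<lambda>t. cis (of_int m * t)) = (if m = k then 2 * pi else 0)"
proof (cases "m = k")
  case True
  then show ?thesis by (simp add: fourier_def cis_mult scaleR_conv_of_real)
next
  case False
  define n where "n = real_of_int (m - k)"
  have n: "n \<noteq> 0" using False by (simp add: n_def)
  have "((\<lambda>t. cis (n * t)) has_integral (cis (n * (2 * pi)) / (\<i> * n) - cis (n * 0) / (\<i> * n))) {0..2 * pi}"
  proof (rule fundamental_theorem_of_calculus)
    fix t
    have "((\<lambda>t. n * t) has_derivative (\<lambda>h. n * h)) (at t within {0..2 * pi})"
      by (auto intro!: derivative_eq_intros)
    from bounded_linear.has_derivative[OF bounded_linear_divide has_derivative_cis[OF this]]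
    have "((\<lambda>t. cis (n * t) / (\<i> * n)) has_derivative (\<lambda>h. (n * h) *\<^sub>R (\<i> * cis (n * t)) / (\<i> * n))) (at t within {0..2 * pi})" .
    moreover have "(\<lambda>h. (n * h) *\<^sub>R (\<i> * cis (n * t)) / (\<i> * n)) = (\<lambda>h. h *\<^sub>R cis (n * t))"
      using n by (intro ext) (simp add: scaleR_conv_of_real field_simps)
    ultimately show "((\<lambda>t. cis (n * t) / (\<i> * n)) has_vector_derivative cis (n * t)) (at t within {0..2 * pi})"
      unfolding has_vector_derivative_def by simp
  qed simp
  moreover have "cis (n * (2 * pi)) = 1" using cis_multiple_2pi[of n] by (simp add: n_def mult.commute)
  ultimately have "((\<lambda>t. cis (n * t)) has_integral 0) {0..2 * pi}" by simp
  then show ?thesis using False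
    by (simp add: fourier_def cis_mult n_def algebra_simps integral_unique)
qed

lemma cos_sin_cis:
  "of_real (cos x *\<^sub>R a + sin x *\<^sub>R b) = Complex (a / 2) (- b / 2) * cis x + Complex (a / 2) (b / 2) * cis (- x)"
  by (simp add: complex_eq_iff algebra_simps)

lemma fourier_monomial:
  "fourier k (\<lambda>t. of_real (sinusoid m a b t)) =
     Complex (a / 2) (- b / 2) * (if int m = k then 2 * pi else 0) + Complex (a / 2) (b / 2) * (if - int m = k then 2 * pi else 0)"
proof -
  have "fourier k (\<lambda>t. of_real (sinusoid m a b t)) =
    fourier k (\<lambda>t. Complex (a / 2) (- b / 2) * cis (of_int (int m) * t) + Complex (a / 2) (b / 2) * cis (of_int (- int m) * t))"
    unfolding cos_sin_cis by simp
  also have "\<dots> = fourier k (\<lambda>t. Complex (a / 2) (- b / 2) * cis (of_int (int m) * t)) +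
     fourier k (\<lambda>t. Complex (a / 2) (b / 2) * cis (of_int (- int m) * t))"
    by (intro fourier_add continuous_intros)
  finally show ?thesis unfolding fourier_cmult fourier_cis .
qed

definition high_pass :: "nat \<Rightarrow> (real \<Rightarrow> real) \<Rightarrow> bool" where
  "high_pass N f \<longleftrightarrow> (\<forall>k. \<bar>k\<bar> < int N \<longrightarrow> fourier k (\<lambda>t. of_real (f t)) = 0)"

lemma trig_poly_continuous: "trig_poly S p \<Longrightarrow> continuous_on UNIV p"
  by (induction rule: trig_poly.induct) (auto intro!: continuous_intros)

lemma trig_poly_high_pass:
  assumes "trig_poly {N..} q" shows "high_pass N q"
  using assms
proof (induction rule: trig_poly.induct)
  case zero
  show ?case by (simp add: high_pass_def fourier_def)
next
  case (step m q a b)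
  have "continuous_on UNIV (\<lambda>t. complex_of_real (q t))"
    using trig_poly_continuous[OF step.hyps(2)] by (intro continuous_intros)
  moreover have "continuous_on UNIV (\<lambda>t. complex_of_real (sinusoid m a b t))"
    by (intro continuous_intros)
  ultimately have "fourier k (\<lambda>t. of_real (q t + sinusoid m a b t)) =
     fourier k (\<lambda>t. of_real (q t)) + fourier k (\<lambda>t. of_real (sinusoid m a b t))" for k
    unfolding of_real_add by (rule fourier_add)
  then show ?case using step unfolding high_pass_def fourier_monomial by auto
qed

text \<open>Low waves are linearly independent under the Fourier coefficients of the same frequencies, and high
  waves do not contribute to these.\<close>

lemma high_pass_trig_poly:
  assumes "trig_poly UNIV (f :: real \<Rightarrow> real)" "high_pass N f"
  shows "trig_poly {N..} f"
proof -
  obtain A B q where q: "trig_poly {N..} q" "f = (\<lambda>t. (\<Sum>m<N. sinusoid m (A m) (B m) t) + q t)"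
    using trig_poly_split_low[OF assms(1), of N] by blast
  define M where "M m t = complex_of_real (sinusoid m (A m) (B m) t)" for m t
  have cM: "continuous_on UNIV (M m)" for m unfolding M_def by (intro continuous_intros)
  have cq: "continuous_on UNIV (\<lambda>t. complex_of_real (q t))"
    using trig_poly_continuous[OF q(1)] by (intro continuous_intros)
  have *: "(\<Sum>m<N. fourier (int k) (M m)) = 0" if "k < N" for k
  proof -
    have "0 = fourier (int k) (\<lambda>t. of_real (f t))" using assms(2) that by (simp add: high_pass_def)
    also have "(\<lambda>t. complex_of_real (f t)) = (\<lambda>t. (\<Sum>m<N. M m t) + of_real (q t))" by (simp add: q(2) M_def)
    also have "fourier (int k) \<dots> = fourier (int k) (\<lambda>t. \<Sum>m<N. M m t) + fourier (int k) (\<lambda>t. of_real (q t))"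
      by (intro fourier_add cq continuous_on_sum cM)
    also have "fourier (int k) (\<lambda>t. of_real (q t)) = 0"
      using trig_poly_high_pass[OF q(1)] that by (simp add: high_pass_def)
    also have "fourier (int k) (\<lambda>t. \<Sum>m<N. M m t) = (\<Sum>m<N. fourier (int k) (M m))"
      by (intro fourier_sum cM) auto
    finally show ?thesis by simp
  qed
  have "sinusoid k (A k) (B k) t = 0" if "k < N" for k t
  proof -
    have "fourier (int k) (M m) = 0" if "m \<noteq> k" for m
      using that unfolding M_def fourier_monomial by auto
    then have "(\<Sum>m<N. fourier (int k) (M m)) = (\<Sum>m<N. if m = k then fourier (int k) (M k) else 0)"
      by (intro sum.cong) auto
    then have "fourier (int k) (M k) = 0" using *[OF that] that by simp
    then have "A k = 0" "k \<noteq> 0 \<Longrightarrow> B k = 0"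
      unfolding M_def fourier_monomial by (auto simp: complex_eq_iff split: if_splits)
    then show ?thesis by (cases "k = 0") auto
  qed
  then have "f = q" unfolding q(2) by (intro ext) simp
  then show ?thesis using q(1) by simp
qed

subsection \<open>Shears that remove low frequencies\<close>

text \<open>By the binomial theorem, the Fourier coefficients of the powers of \<open>w + r q\<close> are
  polynomials in \<open>r\<close>, to which \<open>solvable_cofinitely\<close> applies.\<close>

lemma fourier_power_poly:
  assumes q: "continuous_on UNIV q" and w: "continuous_on UNIV w"
  shows "\<exists>P. \<forall>r. poly P r = fourier k (\<lambda>t. (w t + r * q t) ^ n)"
proof -
  define P where "P = (\<Sum>i\<le>n. monom (of_nat (n choose i) * fourier k (\<lambda>t. q t ^ i * w t ^ (n - i))) i)"
  have "poly P r = fourier k (\<lambda>t. (w t + r * q t) ^ n)" for r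
  proof -
    have "(w t + r * q t) ^ n = (\<Sum>i\<le>n. (of_nat (n choose i) * r ^ i) * (q t ^ i * w t ^ (n - i)))" for t
      using binomial_ring[of "r * q t" "w t" n] by (simp add: add.commute power_mult_distrib mult.assoc)
    then have "fourier k (\<lambda>t. (w t + r * q t) ^ n) =
        fourier k (\<lambda>t. \<Sum>i\<le>n. (of_nat (n choose i) * r ^ i) * (q t ^ i * w t ^ (n - i)))" by simp
    also have "\<dots> = (\<Sum>i\<le>n. fourier k (\<lambda>t. (of_nat (n choose i) * r ^ i) * (q t ^ i * w t ^ (n - i))))"
      by (intro fourier_sum continuous_intros q w) auto
    also have "\<dots> = poly P r"
      unfolding fourier_cmult by (simp add: P_def poly_sum poly_monom mult.assoc mult.commute mult.left_commute)
    finally show ?thesis by simp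
  qed
  then show ?thesis by blast
qed

text \<open>
  The planar curve \<open>exp (\<i> N t) + exp (- \<i> (N + 1) t)\<close> contains only high frequencies, but
  among the frequencies below \<open>N\<close> its power with exponent \<open>2 * m\<close>, for \<open>m < N\<close>, contains exactly one,
  namely \<open>- m\<close>: two factors of different kinds contribute \<open>- 1\<close>, and any surplus of one kind
  shifts the frequency by a multiple of \<open>2 * N + 1\<close>.
\<close>

definition comb :: "nat \<Rightarrow> real \<Rightarrow> complex" where
  "comb N t = cis (real N * t) + cis (- (real (Suc N) * t))"

lemma continuous_comb: "continuous_on UNIV (comb N)"
  unfolding comb_def by (intro continuous_intros)

lemma fourier_comb_power:
  assumes "m < N" "\<bar>k\<bar> < int N"
  shows "fourier k (\<lambda>t. comb N t ^ (2 * m)) \<noteq> 0 \<longleftrightarrow> k = - int m"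
proof -
  define f where "f j = int N * int j - int (Suc N) * (int (2 * m) - int j)" for j
  have "comb N t ^ (2 * m) = (\<Sum>j\<le>2*m. of_nat ((2 * m) choose j) * cis (of_int (f j) * t))" for t
  proof -
    have "cis (real N * t) ^ j * cis (- (real (Suc N) * t)) ^ (2 * m - j) = cis (of_int (f j) * t)" if "j \<le> 2 * m" for j
      unfolding Complex.DeMoivre cis_mult using that
      by (intro arg_cong[where f=cis]) (simp add: f_def of_nat_diff algebra_simps)
    then show ?thesis unfolding comb_def binomial_ring by (intro sum.cong) (auto simp: mult.assoc)
  qed
  then have "fourier k (\<lambda>t. comb N t ^ (2 * m)) = fourier k (\<lambda>t. \<Sum>j\<le>2*m. of_nat ((2 * m) choose j) * cis (of_int (f j) * t))"
    by simp
  also have "\<dots> = (\<Sum>j\<le>2*m. fourier k (\<lambda>t. of_nat ((2 * m) choose j) * cis (of_int (f j) * t)))"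
    by (intro fourier_sum continuous_intros) auto
  also have "\<dots> = (\<Sum>j\<le>2*m. if j = m \<and> k = - int m then of_nat ((2 * m) choose j) * complex_of_real (2 * pi) else 0)"
  proof (intro sum.cong refl)
    fix j
    have "f j = k \<longleftrightarrow> (2 * int N + 1) * (int j - int m) = int m + k"
      by (simp add: f_def algebra_simps)
    also have "\<dots> \<longleftrightarrow> int j - int m = 0 \<and> int m + k = 0"
    proof
      assume *: "(2 * int N + 1) * (int j - int m) = int m + k"
      have "int j - int m = 0"
      proof (rule ccontr)
        assume "int j - int m \<noteq> 0"
        then have "(2 * int N + 1) * 1 \<le> (2 * int N + 1) * \<bar>int j - int m\<bar>" by (intro mult_left_mono) auto
        also have "\<dots> = \<bar>int m + k\<bar>" using * by (simp add: abs_mult flip: *)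
        finally show False using assms abs_triangle_ineq[of "int m" k] by simp
      qed
      then show "int j - int m = 0 \<and> int m + k = 0" using * by simp
    qed auto
    finally have "f j = k \<longleftrightarrow> j = m \<and> k = - int m" by auto
    then show "fourier k (\<lambda>t. of_nat ((2 * m) choose j) * cis (of_int (f j) * t)) =
       (if j = m \<and> k = - int m then of_nat ((2 * m) choose j) * complex_of_real (2 * pi) else 0)"
      unfolding fourier_cmult fourier_cis by auto
  qed
  also have "\<dots> = (if k = - int m then of_nat ((2 * m) choose m) * complex_of_real (2 * pi) else 0)"
    by (cases "k = - int m") auto
  finally show ?thesis by auto
qed

text \<open>
  On \<open>comb\<close>, the function with index \<open>m\<close> excites the single low frequency \<open>- m\<close>;
  conjugation covers the negative indices.
\<close>

definition even_power :: "int \<Rightarrow> complex \<Rightarrow> complex" where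
  "even_power m u = (if m \<ge> 0 then u ^ (2 * nat m) else cnj u ^ (2 * nat (- m)))"

lemma even_power_add: "even_power m (w + of_real r * q) =
    (if m \<ge> 0 then (w + of_real r * q) ^ (2 * nat m) else (cnj w + of_real r * cnj q) ^ (2 * nat (- m)))"
  by (simp add: even_power_def)

lemma continuous_even_power: "continuous_on S f \<Longrightarrow> continuous_on S (\<lambda>t. even_power m (f t))"
  by (cases "m \<ge> 0") (auto simp: even_power_def intro!: continuous_on_power continuous_on_cnj)

lemma smooth_even_power: "smooth (even_power m)"
  using smooth_power[OF smooth_ident] smooth_power[OF smooth_linear[OF bounded_linear_cnj]]
  by (cases "m \<ge> 0") (simp_all add: even_power_def[abs_def])

lemma trig_poly_even_power: "trig_poly UNIV u \<Longrightarrow> trig_poly UNIV (\<lambda>t. even_power m (u t))"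
  using trig_poly_linear_comp[OF bounded_linear.linear[OF bounded_linear_cnj], of UNIV u]
  by (cases "m \<ge> 0") (simp_all add: even_power_def trig_poly_power)

lemma fourier_even_power_comb:
  assumes "\<bar>m\<bar> < int N" "\<bar>k\<bar> < int N"
  shows "fourier (- k) (\<lambda>t. even_power m (comb N t)) \<noteq> 0 \<longleftrightarrow> k = m"
proof (cases "m \<ge> 0")
  case True
  then show ?thesis using fourier_comb_power[of "nat m" N "- k"] assms by (auto simp: even_power_def)
next
  case False
  have "fourier (- k) (\<lambda>t. even_power m (comb N t)) = fourier (- k) (\<lambda>t. cnj (comb N t ^ (2 * nat (- m))))"
    using False by (simp add: even_power_def)
  also have "\<dots> = cnj (fourier k (\<lambda>t. comb N t ^ (2 * nat (- m))))"
    using fourier_cnj[of "\<lambda>t. comb N t ^ (2 * nat (- m))" "- k"] continuous_comb[of N] by (simp add: continuous_on_power)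
  finally show ?thesis using fourier_comb_power[of "nat (- m)" N k] assms False by auto
qed

text \<open>
  For a planar curve \<open>q\<close>, cancelling the low frequencies of \<open>Y\<close> by a combination of even powers
  of \<open>q + s * comb N\<close> is a linear system. Scaled by \<open>r = 1 / s\<close> it depends polynomially on \<open>r\<close>
  and is diagonal at \<open>r = 0\<close>, so it is solvable for arbitrarily large \<open>r\<close>, that is,
  for arbitrarily small \<open>s\<close>. The real part of the combination serves for the real function \<open>Y\<close>.
\<close>

lemma shear_function_exists:
  assumes q: "continuous_on UNIV q" and \<epsilon>: "\<epsilon> > 0"
  obtains s where "0 < s" "s \<le> \<epsilon>"
    "\<And>Y. continuous_on UNIV Y \<Longrightarrow> \<exists>A :: complex \<Rightarrow> real. smooth A \<and> (\<forall>u. trig_poly UNIV u \<longrightarrow> trig_poly UNIV (\<lambda>t. A (u t))) \<and>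
       high_pass N (\<lambda>t. Y t + A (q t + of_real s * comb N t))"
proof -
  define I where "I = {k::int. \<bar>k\<bar> < int N}"
  have "I = {- int N<..<int N}" by (auto simp: I_def)
  then have "finite I" by simp
  define w where "w = comb N"
  have w: "continuous_on UNIV w" by (simp add: w_def continuous_comb)
  have "\<exists>P. \<forall>r::real. poly P (of_real r) = fourier (- k) (\<lambda>t. even_power m (w t + of_real r * q t))" for k m
  proof (cases "m \<ge> 0")
    case True
    then show ?thesis using fourier_power_poly[OF q w, of "- k" "2 * nat m"] unfolding even_power_add by auto
  next
    case False
    have "continuous_on UNIV (\<lambda>t. cnj (q t))" "continuous_on UNIV (\<lambda>t. cnj (w t))"
      by (intro continuous_on_cnj q w)+
    then show ?thesis using False fourier_power_poly[of "\<lambda>t. cnj (q t)" "\<lambda>t. cnj (w t)" "- k" "2 * nat (- m)"]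
      unfolding even_power_add by auto
  qed
  then obtain G where G: "\<And>k m r. poly (G k m) (of_real r) = fourier (- k) (\<lambda>t. even_power m (w t + of_real r * q t))"
    by metis
  have "poly (G k m) 0 \<noteq> 0 \<longleftrightarrow> k = m" if "k \<in> I" "m \<in> I" for k m
    using G[of k m 0] fourier_even_power_comb[of m N k] that by (simp add: I_def w_def)
  define Bad where "Bad = {r. \<not> (\<forall>y. \<exists>\<alpha>. \<forall>k\<in>I. (\<Sum>m\<in>I. poly (G k m) r * \<alpha> m) = y k)}"
  have "finite Bad"
    unfolding Bad_def by (rule solvable_cofinitely[OF \<open>finite I\<close>]) fact
  then have "finite (of_real -` Bad :: real set)" by (rule finite_vimageI) (simp add: inj_def)
  then have "infinite ({1 / \<epsilon>..} - of_real -` Bad :: real set)" using infinite_Ici by (rule Diff_infinite_finite)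
  then have "{1 / \<epsilon>..} - of_real -` Bad \<noteq> ({} :: real set)" by (rule infinite_imp_nonempty)
  then obtain r :: real where "r \<in> {1 / \<epsilon>..} - of_real -` Bad" by blast
  then have r: "r \<ge> 1 / \<epsilon>" "of_real r \<notin> Bad" by auto
  have "r > 0" using r(1) \<epsilon> by (meson divide_pos_pos less_le_trans zero_less_one)
  define s where "s = 1 / r"
  have s: "0 < s" "s \<le> \<epsilon>" using \<open>r > 0\<close> r(1) \<epsilon> by (auto simp: s_def field_simps)
  have "\<exists>A :: complex \<Rightarrow> real. smooth A \<and> (\<forall>u. trig_poly UNIV u \<longrightarrow> trig_poly UNIV (\<lambda>t. A (u t))) \<and>
       high_pass N (\<lambda>t. Y t + A (q t + of_real s * comb N t))" if Y: "continuous_on UNIV Y" for Y :: "real \<Rightarrow> real"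
  proof -
    have cY: "continuous_on UNIV (\<lambda>t. complex_of_real (Y t))" by (intro continuous_intros Y)
    have "\<forall>y. \<exists>\<alpha>. \<forall>k\<in>I. (\<Sum>m\<in>I. poly (G k m) (of_real r) * \<alpha> m) = y k"
      using r(2) by (simp add: Bad_def)
    from spec[OF this, of "\<lambda>k. - fourier (- k) (\<lambda>t. of_real (Y t))"]
    obtain \<alpha> where \<alpha>: "\<And>k. k \<in> I \<Longrightarrow> (\<Sum>m\<in>I. poly (G k m) (of_real r) * \<alpha> m) = - fourier (- k) (\<lambda>t. of_real (Y t))" by blast
    define Z where "Z u = (\<Sum>m\<in>I. \<alpha> m * even_power m (of_real r * u))" for u
    define A where "A u = Re (Z u)" for u
    define E where "E t = q t + of_real s * comb N t" for t
    have rE: "of_real r * E t = w t + of_real r * q t" for t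
      using \<open>r > 0\<close> by (simp add: E_def w_def s_def algebra_simps)
    have cE: "continuous_on UNIV (\<lambda>t. w t + of_real r * q t)" by (intro continuous_intros q w)
    have cZ: "continuous_on UNIV (\<lambda>t. Z (E t))"
      unfolding Z_def rE by (intro continuous_intros continuous_even_power cE)
    have sZ: "smooth Z"
      unfolding Z_def
      by (intro smooth_sum smooth_mult smooth_const smooth_compose[OF smooth_even_power] smooth_ident)
    have "smooth A" unfolding A_def by (rule smooth_linear_comp[OF bounded_linear_Re sZ])
    moreover have "trig_poly UNIV (\<lambda>t. A (u t))" if "trig_poly UNIV u" for u
      unfolding A_def Z_def
      by (intro trig_poly_linear_comp[OF bounded_linear.linear[OF bounded_linear_Re]] trig_poly_sum trig_poly_mult
            trig_poly_const trig_poly_even_power that)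
    moreover have "high_pass N (\<lambda>t. Y t + A (E t))"
      unfolding high_pass_def
    proof (intro allI impI)
      define F where "F t = of_real (Y t) + Z (E t)" for t
      have cF: "continuous_on UNIV F" unfolding F_def by (intro continuous_intros cY cZ)
      have F0: "fourier k F = 0" if "\<bar>k\<bar> < int N" for k
      proof -
        have "- k \<in> I" using that by (simp add: I_def)
        have "fourier k F = fourier k (\<lambda>t. of_real (Y t)) + fourier k (\<lambda>t. Z (E t))"
          unfolding F_def by (rule fourier_add[OF cY cZ])
        also have "fourier k (\<lambda>t. Z (E t)) = (\<Sum>m\<in>I. fourier k (\<lambda>t. \<alpha> m * even_power m (w t + of_real r * q t)))"
          unfolding Z_def rE using \<open>finite I\<close> by (intro fourier_sum continuous_intros continuous_even_power cE)
        also have "\<dots> = (\<Sum>m\<in>I. poly (G (- k) m) (of_real r) * \<alpha> m)"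
          unfolding fourier_cmult using G[of "- k"] by (simp add: mult.commute)
        also have "\<dots> = - fourier k (\<lambda>t. of_real (Y t))" using \<alpha>[OF \<open>- k \<in> I\<close>] by simp
        finally show ?thesis by simp
      qed
      fix k assume k: "\<bar>k\<bar> < int N"
      have "complex_of_real (Y t + A (E t)) = (1/2) * (F t + cnj (F t))" for t
        using complex_add_cnj[of "F t"] by (simp add: F_def A_def)
      then have "fourier k (\<lambda>t. of_real (Y t + A (E t))) = fourier k (\<lambda>t. (1/2) * (F t + cnj (F t)))"
        by (simp only:)
      also have "\<dots> = (1/2) * (fourier k F + cnj (fourier (- k) F))"
        unfolding fourier_cmult fourier_cnj[OF cF, symmetric]
        by (intro arg_cong[where f="\<lambda>x. 1/2 * x"] fourier_add continuous_on_cnj cF)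
      also have "\<dots> = 0" using F0[of k] F0[of "- k"] k by simp
      finally show "fourier k (\<lambda>t. of_real (Y t + A (E t))) = 0" .
    qed
    ultimately show ?thesis unfolding E_def by blast
  qed
  with s that show ?thesis by blast
qed

lemma trig_poly_C1_bound:
  fixes p :: "real \<Rightarrow> 'a::euclidean_space"
  assumes "trig_poly S p"
  obtains B where "B > 0" "\<And>t. norm (p t) \<le> B" "\<And>t. norm (vector_derivative p (at t)) \<le> B"
proof -
  obtain D where "trig_poly (S \<inter> {..D}) p" using trig_poly_finite_frequencies[OF assms] .
  then obtain F C where F: "F 0 = p" "derivatives F" "C \<ge> 0" "\<And>j t. norm (F j t) \<le> C * real D ^ j"
    using trig_poly_derivatives[of "S \<inter> {..D}" p D] by blast
  have "vector_derivative p (at t) = F 1 t" for t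
    using vector_derivative_at[OF derivativesD[OF F(2), of 0 t]] F(1) by simp
  then have "norm (vector_derivative p (at t)) \<le> C + C * real D + 1" for t
    using F(4)[of 1 t] F(3) by simp
  moreover have "norm (p t) \<le> C + C * real D + 1" for t
  proof -
    have "0 \<le> C * real D" using F(3) by simp
    then show ?thesis using F(4)[of 0 t] F(1) by simp
  qed
  moreover have "C + C * real D + 1 > 0" using F(3) by (simp add: add_nonneg_pos)
  ultimately show ?thesis using that by blast
qed

lemma trig_poly_comb:
  "trig_poly {N..} (\<lambda>t. Re (comb N t))" "trig_poly {N..} (\<lambda>t. Im (comb N t))"
proof -
  have "Re (comb N t) = sinusoid N 1 0 t + (cos (real (Suc N) * t) *\<^sub>R 1 + sin (real (Suc N) * t) *\<^sub>R 0)"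
    "Im (comb N t) = sinusoid N 0 1 t + (cos (real (Suc N) * t) *\<^sub>R 0 + sin (real (Suc N) * t) *\<^sub>R (- 1))" for t
    by (simp_all add: comb_def)
  then show "trig_poly {N..} (\<lambda>t. Re (comb N t))" "trig_poly {N..} (\<lambda>t. Im (comb N t))"
    by (simp_all only:) (intro trig_poly_add trig_poly_monomial; simp)+
qed

text \<open>
  Adding a small multiple of \<open>comb N\<close> to two coordinates does not change the knot type and adds
  only high frequencies. The third coordinate is then changed by a function of the first two,
  which is a shear of space and hence isotopic to the identity.
\<close>

lemma remove_low_frequencies_coordinate:
  fixes g :: "real \<Rightarrow> real ^ 3"
  assumes g: "trig_poly UNIV g" "parametrises_knot g" and ijk: "i \<noteq> j" "i \<noteq> k" "j \<noteq> k"
  obtains h where "trig_poly UNIV h" "parametrises_knot h" "ambient_isotopic (range g) (range h)"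
    "trig_poly {N..} (\<lambda>t. h t $ k)"
    "trig_poly {N..} (\<lambda>t. g t $ i) \<Longrightarrow> trig_poly {N..} (\<lambda>t. h t $ i)"
    "trig_poly {N..} (\<lambda>t. g t $ j) \<Longrightarrow> trig_poly {N..} (\<lambda>t. h t $ j)"
proof -
  have nth: "trig_poly S (\<lambda>t. u t $ l)" if "trig_poly S u" for u :: "real \<Rightarrow> real ^ 3" and l S
    using trig_poly_linear_comp[OF bounded_linear.linear[OF bounded_linear_vec_nth] that] .
  have coord: "trig_poly S (\<lambda>t. u t *\<^sub>R (axis l 1 :: real ^ 3))" if "trig_poly S u" for u l S
    using trig_poly_linear_comp[OF bounded_linear.linear[OF bounded_linear_scaleR_left] that] .
  define p where "p t = Re (comb N t) *\<^sub>R (axis i 1 :: real ^ 3) + Im (comb N t) *\<^sub>R axis j 1" for t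
  have p: "trig_poly {N..} p" unfolding p_def by (intro trig_poly_add coord trig_poly_comb)
  have p': "trig_poly UNIV p" using p by (rule trig_poly_mono) simp
  obtain B where B: "B > 0" "\<And>t. norm (p t) \<le> B" "\<And>t. norm (vector_derivative p (at t)) \<le> B"
    using trig_poly_C1_bound[OF p] by blast
  obtain \<epsilon> where \<epsilon>: "\<epsilon> > 0" "\<And>h. smooth_loop h \<Longrightarrow> C1_close \<epsilon> h g \<Longrightarrow>
      parametrises_knot h \<and> ambient_isotopic (range g) (range h)"
    using knot_stable[OF g(2)] by blast
  define q where "q t = of_real (g t $ i) + \<i> * of_real (g t $ j)" for t
  have cg: "continuous_on UNIV g" by (rule trig_poly_continuous[OF g(1)])
  have cq: "continuous_on UNIV q" unfolding q_def by (intro continuous_intros cg)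
  have "\<epsilon> / B > 0" using \<epsilon>(1) B(1) by simp
  then obtain s where s: "0 < s" "s \<le> \<epsilon> / B"
    "\<And>Y. continuous_on UNIV Y \<Longrightarrow> \<exists>A :: complex \<Rightarrow> real. smooth A \<and> (\<forall>u. trig_poly UNIV u \<longrightarrow> trig_poly UNIV (\<lambda>t. A (u t))) \<and>
       high_pass N (\<lambda>t. Y t + A (q t + of_real s * comb N t))"
    using shear_function_exists[OF cq] by blast
  have sB: "s * B \<le> \<epsilon>" using s(2) B(1) by (simp add: field_simps)
  define g1 where "g1 t = g t + s *\<^sub>R p t" for t
  have g1: "trig_poly UNIV g1" unfolding g1_def by (intro trig_poly_add g trig_poly_scaleR p')
  have sm: "smooth g1" "smooth g" "smooth p" using g1 g(1) p by (auto intro: trig_poly_smooth)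
  have knot1: "parametrises_knot g1 \<and> ambient_isotopic (range g) (range g1)"
  proof (rule \<epsilon>(2)[OF _ C1_closeI])
    show "smooth_loop g1" using sm trig_poly_periodic[OF g1] by (simp add: smooth_loop_def)
    show "norm (g1 t - g t) \<le> \<epsilon>" for t
      using order_trans[OF mult_left_mono[OF B(2)] sB] s(1) by (simp add: g1_def)
    have "vector_derivative g1 (at t) = vector_derivative g (at t) + s *\<^sub>R vector_derivative p (at t)" for t
      unfolding g1_def
      by (intro vector_derivative_at has_vector_derivative_add smooth_has_vector_derivative sm
           bounded_linear.has_vector_derivative[OF bounded_linear_scaleR_right])
    then show "norm (vector_derivative g1 (at t) - vector_derivative g (at t)) \<le> \<epsilon>" for t
      using order_trans[OF mult_left_mono[OF B(3)] sB] s(1) by simp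
  qed
  have "continuous_on UNIV (\<lambda>t. g1 t $ k)" using trig_poly_continuous[OF g1] by (intro continuous_intros)
  from s(3)[OF this] obtain A :: "complex \<Rightarrow> real" where A: "smooth A"
    "\<And>u. trig_poly UNIV u \<Longrightarrow> trig_poly UNIV (\<lambda>t. A (u t))"
    "high_pass N (\<lambda>t. g1 t $ k + A (q t + of_real s * comb N t))" by blast
  define P where "P x = of_real (x $ i) + \<i> * of_real (x $ j)" for x :: "real ^ 3"
  have P: "bounded_linear P"
    unfolding P_def
    by (intro bounded_linear_add bounded_linear_vec_nth bounded_linear_compose[OF bounded_linear_of_real]
       bounded_linear_compose[OF bounded_linear_mult_right])
  define S where "S x = x + A (P x) *\<^sub>R (axis k 1 :: real ^ 3)" for x
  have AP: "smooth (\<lambda>x. A (P x))" by (intro smooth_compose[OF A(1)] smooth_linear P)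
  have inv: "A (P (x + c *\<^sub>R axis k 1)) = A (P x)" for x c
    using ijk by (simp add: P_def axis_def)
  define h where "h t = S (g1 t)" for t
  have Pg: "P (g1 t) = q t + of_real s * comb N t" for t
    using ijk by (simp add: P_def g1_def p_def q_def axis_def complex_eq_iff)
  have hk: "h t $ k = g1 t $ k + A (q t + of_real s * comb N t)" for t
    by (simp add: h_def S_def Pg axis_def)
  have hij: "h t $ i = g t $ i + s *\<^sub>R p t $ i" "h t $ j = g t $ j + s *\<^sub>R p t $ j" for t
    using ijk by (auto simp: h_def S_def g1_def axis_def)
  have th: "trig_poly UNIV h"
    unfolding h_def S_def
    by (intro trig_poly_add g1 coord A(2) trig_poly_linear_comp[OF bounded_linear.linear[OF P]])
  show ?thesis
  proof (rule that[of h])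
    show "trig_poly UNIV h" by (rule th)
    show "parametrises_knot h"
      unfolding h_def S_def using parametrises_knot_diffeomorphism[OF diffeomorphism_shear[OF AP inv]] knot1 by blast
    have "ambient_isotopic (range g1) (S ` range g1)"
      unfolding S_def by (rule ambient_isotopic_shear[OF AP inv])
    moreover have "S ` range g1 = range h" by (auto simp: h_def)
    ultimately show "ambient_isotopic (range g) (range h)" using knot1 ambient_isotopic_trans by metis
    show "trig_poly {N..} (\<lambda>t. h t $ k)"
      by (rule high_pass_trig_poly[OF nth[OF th]]) (use A(3) in \<open>simp only: hk\<close>)
    show "trig_poly {N..} (\<lambda>t. h t $ i)" if "trig_poly {N..} (\<lambda>t. g t $ i)"
      unfolding hij by (intro trig_poly_add that nth trig_poly_scaleR p)
    show "trig_poly {N..} (\<lambda>t. h t $ j)" if "trig_poly {N..} (\<lambda>t. g t $ j)"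
      unfolding hij by (intro trig_poly_add that nth trig_poly_scaleR p)
  qed
qed

text \<open>The coordinates are treated one after the other; the perturbations of the later steps keep the
  low frequencies of the earlier coordinates at zero.\<close>

theorem remove_low_frequencies:
  fixes g :: "real \<Rightarrow> real ^ 3"
  assumes "trig_poly UNIV g" "parametrises_knot g"
  obtains h where "trig_poly {N..} h" "parametrises_knot h" "ambient_isotopic (range g) (range h)"
proof -
  have d: "(1::3) \<noteq> 2" "(1::3) \<noteq> 3" "(2::3) \<noteq> 3" "(2::3) \<noteq> 1" "(3::3) \<noteq> 1" "(3::3) \<noteq> 2" by simp_all
  obtain g1 :: "real \<Rightarrow> real ^ 3" where g1: "trig_poly UNIV g1" "parametrises_knot g1" "ambient_isotopic (range g) (range g1)"
    "trig_poly {N..} (\<lambda>t. g1 t $ 3)"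
    using remove_low_frequencies_coordinate[where i=1 and j=2 and k=3 and N=N, OF assms] d by blast
  obtain g2 :: "real \<Rightarrow> real ^ 3" where g2: "trig_poly UNIV g2" "parametrises_knot g2" "ambient_isotopic (range g1) (range g2)"
    "trig_poly {N..} (\<lambda>t. g2 t $ 1)" "trig_poly {N..} (\<lambda>t. g2 t $ 3)"
    using remove_low_frequencies_coordinate[where i=2 and j=3 and k=1 and N=N, OF g1(1,2)] d g1(4) by metis
  obtain h :: "real \<Rightarrow> real ^ 3" where h: "trig_poly UNIV h" "parametrises_knot h" "ambient_isotopic (range g2) (range h)"
    "trig_poly {N..} (\<lambda>t. h t $ 2)" "trig_poly {N..} (\<lambda>t. h t $ 1)" "trig_poly {N..} (\<lambda>t. h t $ 3)"
    using remove_low_frequencies_coordinate[where i=1 and j=3 and k=2 and N=N, OF g2(1,2)] d g2(4,5) by metis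
  have "trig_poly {N..} (\<lambda>t. \<Sum>i\<in>UNIV. (h t $ i) *\<^sub>R (axis i 1 :: real ^ 3))"
  proof (rule trig_poly_sum)
    fix i :: 3
    have "trig_poly {N..} (\<lambda>t. h t $ i)" using h(4-6) exhaust_3[of i] by auto
    then show "trig_poly {N..} (\<lambda>t. (h t $ i) *\<^sub>R (axis i 1 :: real ^ 3))"
      by (rule trig_poly_linear_comp[OF bounded_linear.linear[OF bounded_linear_scaleR_left]])
  qed
  moreover have "(\<Sum>i\<in>UNIV. (h t $ i) *\<^sub>R (axis i 1 :: real ^ 3)) = h t" for t
    using basis_expansion[of "h t"] by (simp add: scalar_mult_eq_scaleR)
  ultimately have "trig_poly {N..} h" by simp
  moreover have "ambient_isotopic (range g) (range h)"
    using g1(3) g2(3) h(3) ambient_isotopic_trans by blast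
  ultimately show ?thesis using h(2) that by blast
qed

section \<open>Generic embeddedness of all derivatives\<close>

lemma smooth_differentiable: "smooth f \<Longrightarrow> f differentiable (at x within S)"
  using smooth_frechet(1) differentiableI differentiable_at_withinI by blast

lemma differentiable_Pair':
  assumes "f differentiable (at x within S)" "g differentiable (at x within S)"
  shows "(\<lambda>x. (f x, g x)) differentiable (at x within S)"
  using assms unfolding differentiable_def by (auto intro: has_derivative_Pair)

lemma smooth_sin: "smooth (sin :: real \<Rightarrow> real)" and smooth_cos: "smooth (cos :: real \<Rightarrow> real)"
  using trig_poly_smooth[OF trig_poly_monomial[of 1 UNIV 0 "1::real"]]
    trig_poly_smooth[OF trig_poly_monomial[of 1 UNIV "1::real" 0]] by simp_all

text \<open>Rotated pairs: the unique solution \<open>(a, b)\<close> of \<open>cos \<mu> a + sin \<mu> b = w\<close>, \<open>cos \<mu> b - sin \<mu> a = v\<close>.\<close>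

definition rotated :: "real \<Rightarrow> 'a \<Rightarrow> 'a \<Rightarrow> 'a \<times> 'a::real_vector" where
  "rotated \<mu> v w = (cos \<mu> *\<^sub>R w - sin \<mu> *\<^sub>R v, sin \<mu> *\<^sub>R w + cos \<mu> *\<^sub>R v)"

lemma rotated_unique:
  assumes "cos \<mu> *\<^sub>R b - sin \<mu> *\<^sub>R a = v"
  shows "(a, b) = rotated \<mu> v (cos \<mu> *\<^sub>R a + sin \<mu> *\<^sub>R b)"
proof -
  have sc: "(c * c) *\<^sub>R x + (s * s) *\<^sub>R x = x" if "s\<^sup>2 + c\<^sup>2 = 1" for s c :: real and x :: 'a
    using that by (simp add: power2_eq_square add.commute flip: scaleR_add_left)
  note sc = sc[OF sin_cos_squared_add[of \<mu>]]
  have "cos \<mu> *\<^sub>R (cos \<mu> *\<^sub>R a + sin \<mu> *\<^sub>R b) - sin \<mu> *\<^sub>R v = (cos \<mu> * cos \<mu>) *\<^sub>R a + (sin \<mu> * sin \<mu>) *\<^sub>R a"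
    unfolding assms[symmetric] by (simp add: algebra_simps)
  moreover have "sin \<mu> *\<^sub>R (cos \<mu> *\<^sub>R a + sin \<mu> *\<^sub>R b) + cos \<mu> *\<^sub>R v = (cos \<mu> * cos \<mu>) *\<^sub>R b + (sin \<mu> * sin \<mu>) *\<^sub>R b"
    unfolding assms[symmetric] by (simp add: algebra_simps)
  ultimately show ?thesis unfolding rotated_def by (simp add: sc)
qed

lemma differentiable_rotated:
  assumes "\<mu> differentiable (at x within S)" "v differentiable (at x within S)" "w differentiable (at x within S)"
  shows "(\<lambda>x. rotated (\<mu> x) (v x) (w x)) differentiable (at x within S)"
proof -
  have "(\<lambda>x. cos (\<mu> x)) differentiable (at x within S)" "(\<lambda>x. sin (\<mu> x)) differentiable (at x within S)"
    using differentiable_chain_within[OF assms(1) smooth_differentiable[OF smooth_cos]]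
      differentiable_chain_within[OF assms(1) smooth_differentiable[OF smooth_sin]]
    by (simp_all add: o_def)
  then show ?thesis unfolding rotated_def
    by (intro differentiable_Pair' differentiable_add differentiable_diff differentiable_scaleR assms)
qed

text \<open>
  A double point or a critical point of \<open>h + cos (t + \<phi>) a + sin (t + \<phi>) b\<close> fixes a rotated component of
  \<open>(a, b)\<close> as a function of the parameters involved. The bad pairs are therefore covered by the
  images of differentiable maps with at most five real parameters, and have measure zero in
  dimension six.
\<close>

lemma negligible_not_knot:
  fixes h :: "real \<Rightarrow> real ^ 3"
  assumes h: "smooth_loop h"
  shows "negligible {(a, b). \<not> parametrises_knot (\<lambda>t. h t + (cos (t + \<phi>) *\<^sub>R a + sin (t + \<phi>) *\<^sub>R b))}"
proof -
  have sh: "smooth h" "\<And>t. h (t + 2 * pi) = h t" using h by (auto simp: smooth_loop_def)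
  define F1 :: "real \<times> real \<times> (real ^ 3) \<Rightarrow> (real ^ 3) \<times> (real ^ 3)" where
    "F1 p = rotated ((fst p + fst (snd p)) / 2 + \<phi>)
       (inverse (2 * sin ((fst p - fst (snd p)) / 2)) *\<^sub>R (h (fst (snd p)) - h (fst p))) (snd (snd p))" for p
  define S1 :: "(real \<times> real \<times> (real ^ 3)) set" where "S1 = {p. sin ((fst p - fst (snd p)) / 2) \<noteq> 0}"
  define F2 :: "real \<times> (real ^ 3) \<Rightarrow> (real ^ 3) \<times> (real ^ 3)" where
    "F2 p = rotated (fst p + \<phi>) (- vector_derivative h (at (fst p))) (snd p)" for p
  have half: "smooth (\<lambda>x. f x / 2)" if "smooth f" for f :: "real \<times> real \<times> (real ^ 3) \<Rightarrow> real"
    using smooth_scaleR[OF smooth_const[of "1/2"] that] by simp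
  have "F1 differentiable_on S1"
    unfolding differentiable_on_def
  proof
    fix p assume p: "p \<in> S1"
    have "(\<lambda>p::real \<times> real \<times> (real ^ 3). 2 * sin ((fst p - fst (snd p)) / 2)) differentiable (at p within S1)"
      by (intro smooth_differentiable smooth_mult smooth_const smooth_compose[OF smooth_sin] half smooth_diff smooth_fst smooth_snd smooth_ident)
    then have "(\<lambda>p. inverse (2 * sin ((fst p - fst (snd p)) / 2))) differentiable (at p within S1)"
      by (rule differentiable_inverse) (use p in \<open>simp add: S1_def\<close>)
    then show "F1 differentiable (at p within S1)"
      unfolding F1_def
      by (intro differentiable_rotated differentiable_scaleR; assumption?)
         (intro smooth_differentiable smooth_add smooth_const half smooth_diff smooth_compose[OF sh(1)] smooth_fst smooth_snd smooth_ident)+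
  qed
  then have n1: "negligible (F1 ` S1)" by (intro negligible_differentiable_image_lowdim) simp_all
  have "F2 differentiable_on UNIV"
    unfolding differentiable_on_def F2_def
    by (intro ballI differentiable_rotated smooth_differentiable smooth_add smooth_minus smooth_const
         smooth_compose[OF smooth_vector_derivative[OF sh(1)]] smooth_fst smooth_snd smooth_ident)
  then have n2: "negligible (F2 ` UNIV)" by (intro negligible_differentiable_image_lowdim) simp_all
  have "{(a, b). \<not> parametrises_knot (\<lambda>t. h t + (cos (t + \<phi>) *\<^sub>R a + sin (t + \<phi>) *\<^sub>R b))} \<subseteq> F1 ` S1 \<union> range F2"
  proof clarify
    fix a b
    define k where "k t = h t + (cos (t + \<phi>) *\<^sub>R a + sin (t + \<phi>) *\<^sub>R b)" for t
    assume nk: "\<not> parametrises_knot (\<lambda>t. h t + (cos (t + \<phi>) *\<^sub>R a + sin (t + \<phi>) *\<^sub>R b))" and "(a, b) \<notin> range F2"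
    have sk: "smooth k" unfolding k_def
      by (intro smooth_add sh smooth_scaleR smooth_const smooth_compose[OF smooth_sin] smooth_compose[OF smooth_cos] smooth_ident)
    have pk: "k (t + 2 * pi) = k t" for t
    proof -
      have "t + 2 * pi + \<phi> = t + \<phi> + 2 * pi" by simp
      then show ?thesis by (simp only: k_def sh sin_periodic cos_periodic)
    qed
    have "vector_derivative k (at t) \<noteq> 0" for t
    proof
      assume "vector_derivative k (at t) = 0"
      moreover have "(k has_vector_derivative (vector_derivative h (at t) + ((- sin (t + \<phi>)) *\<^sub>R a + cos (t + \<phi>) *\<^sub>R b))) (at t)"
      proof -
        have "((\<lambda>t. cos (t + \<phi>)) has_vector_derivative - sin (t + \<phi>)) (at t)"
          "((\<lambda>t. sin (t + \<phi>)) has_vector_derivative cos (t + \<phi>)) (at t)"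
          unfolding has_real_derivative_iff_has_vector_derivative[symmetric]
          by (auto intro!: derivative_eq_intros)
        then show ?thesis unfolding k_def
          by (intro has_vector_derivative_add smooth_has_vector_derivative sh
              bounded_linear.has_vector_derivative[OF bounded_linear_scaleR_left])
      qed
      ultimately have "vector_derivative h (at t) + ((- sin (t + \<phi>)) *\<^sub>R a + cos (t + \<phi>) *\<^sub>R b) = 0"
        using vector_derivative_at by metis
      then have "cos (t + \<phi>) *\<^sub>R b - sin (t + \<phi>) *\<^sub>R a = - vector_derivative h (at t)"
        by (simp add: algebra_simps add_eq_0_iff)
      from rotated_unique[OF this]
      have "(a, b) = F2 (t, cos (t + \<phi>) *\<^sub>R a + sin (t + \<phi>) *\<^sub>R b)" by (simp add: F2_def)
      then show False using \<open>(a, b) \<notin> range F2\<close> by blast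
    qed
    moreover have "\<not> parametrises_knot k" using nk by (simp only: k_def[abs_def] not_False_eq_True)
    ultimately have "\<not> inj_on k {0..<2 * pi}"
      using sk pk by (simp add: parametrises_knot_def smooth_loop_def)
    then obtain t s where ts: "t \<in> {0..<2 * pi}" "s \<in> {0..<2 * pi}" "t \<noteq> s" "k t = k s"
      by (auto simp: inj_on_def)
    define \<mu> where "\<mu> = (t + s) / 2 + \<phi>"
    define \<sigma> where "\<sigma> = sin ((t - s) / 2)"
    have \<sigma>: "\<sigma> \<noteq> 0"
    proof
      assume "\<sigma> = 0"
      then have "(t - s) / 2 = 0" unfolding \<sigma>_def by (rule sin_eq_0_pi[rotated 2]) (use ts in auto)
      then show False using ts(3) by simp
    qed
    have cs: "cos (t + \<phi>) - cos (s + \<phi>) = - (2 * \<sigma>) * sin \<mu>" "sin (t + \<phi>) - sin (s + \<phi>) = (2 * \<sigma>) * cos \<mu>"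
      unfolding cos_diff_cos[of "t + \<phi>"] sin_diff_sin[of "t + \<phi>"] \<mu>_def \<sigma>_def
      using sin_minus[of "(t - s) / 2"] by (simp_all add: add_divide_distrib diff_divide_distrib add.commute add.left_commute)
    have "0 = k t - k s" using ts by simp
    also have "\<dots> = (h t - h s) + ((cos (t + \<phi>) - cos (s + \<phi>)) *\<^sub>R a + (sin (t + \<phi>) - sin (s + \<phi>)) *\<^sub>R b)"
      by (simp add: k_def algebra_simps)
    also have "\<dots> = (h t - h s) + (2 * \<sigma>) *\<^sub>R (cos \<mu> *\<^sub>R b - sin \<mu> *\<^sub>R a)"
      unfolding cs by (simp add: algebra_simps)
    finally have "(2 * \<sigma>) *\<^sub>R (cos \<mu> *\<^sub>R b - sin \<mu> *\<^sub>R a) = h s - h t" by (simp add: algebra_simps add_eq_0_iff)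
    then have "cos \<mu> *\<^sub>R b - sin \<mu> *\<^sub>R a = inverse (2 * \<sigma>) *\<^sub>R (h s - h t)"
      using \<sigma> by (metis divideR_right mult_eq_0_iff zero_neq_numeral)
    from rotated_unique[OF this]
    have "(a, b) = F1 (t, s, cos \<mu> *\<^sub>R a + sin \<mu> *\<^sub>R b)" by (simp add: F1_def \<mu>_def \<sigma>_def)
    moreover have "(t, s, cos \<mu> *\<^sub>R a + sin \<mu> *\<^sub>R b) \<in> S1" using \<sigma> by (simp add: S1_def \<sigma>_def)
    ultimately show "(a, b) \<in> F1 ` S1" by blast
  qed
  then show ?thesis using n1 n2 by (meson negligible_Un negligible_subset)
qed

text \<open>Countably many negligible sets do not fill a ball, so one small pair serves all derivatives.\<close>

lemma generic_derivatives_knots: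
  fixes F :: "nat \<Rightarrow> real \<Rightarrow> real ^ 3"
  assumes F: "derivatives F" "\<And>n t. F n (t + 2 * pi) = F n t" and e: "e > 0"
  obtains a b where "norm a + norm b \<le> e" "\<And>n. parametrises_knot (\<lambda>t. F n t + wave 1 0 a b n t)"
proof -
  define B where "B n = {(a, b). \<not> parametrises_knot (\<lambda>t. F n t + (cos (t + real n * (pi / 2)) *\<^sub>R a + sin (t + real n * (pi / 2)) *\<^sub>R b))}" for n
  have "negligible (B n)" for n
    unfolding B_def
    by (intro negligible_not_knot) (simp add: smooth_loop_def F(2) derivatives_imp_smooth[OF F(1)])
  then have "negligible (\<Union>n. B n)" by (rule negligible_Union_nat)
  moreover have "\<not> negligible (ball (0 :: (real ^ 3) \<times> (real ^ 3)) (e / 2))" using e by (intro open_not_negligible) auto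
  ultimately have "\<not> ball 0 (e / 2) \<subseteq> (\<Union>n. B n)" using negligible_subset by blast
  then obtain p where "p \<in> ball 0 (e / 2)" "p \<notin> (\<Union>n. B n)" by blast
  then obtain a b where ab: "(a, b) \<in> ball 0 (e / 2)" "\<And>n. (a, b) \<notin> B n" by (cases p) auto
  have "norm a \<le> e / 2" "norm b \<le> e / 2"
    using ab(1) norm_fst_le[of a b] norm_snd_le[of b a] by auto
  moreover have "parametrises_knot (\<lambda>t. F n t + wave 1 0 a b n t)" for n
    using ab(2)[of n] by (simp add: B_def wave_def)
  ultimately show ?thesis using that[of a b] by simp
qed

section \<open>Realising one more knot type\<close>

text \<open>
  A high derivative of a trigonometric polynomial of degree \<open>D\<close> grows like \<open>D ^ n\<close>. A knot
  \<open>L\<close> represented with frequencies above \<open>D + 1\<close> can therefore be multiplied by a factor that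
  drowns this growth, and its \<open>n\<close>-fold antiderivative is still as small as desired together with
  its low derivatives.
\<close>

lemma add_knot_type:
  fixes P :: "nat \<Rightarrow> real \<Rightarrow> real ^ 3"
  assumes P: "derivatives P" "trig_poly UNIV (P 0)"
    and L: "trig_poly UNIV L" "parametrises_knot L" and e: "e > 0"
  obtains n G where "n > n0" "derivatives G" "trig_poly UNIV (G 0)"
    "\<And>j t. j \<le> Suc n0 \<Longrightarrow> norm (G j t) \<le> e"
    "\<And>h. smooth_loop h \<Longrightarrow> (\<And>t. norm (h t - (P n t + G n t)) \<le> 1) \<Longrightarrow>
       (\<And>t. norm (vector_derivative h (at t) - (P (Suc n) t + G (Suc n) t)) \<le> 1) \<Longrightarrow>
       ambient_isotopic (range h) (range L)"
proof -
  obtain D where D: "trig_poly (UNIV \<inter> {..D}) (P 0)" using trig_poly_finite_frequencies[OF P(2)] .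
  obtain C where C: "C \<ge> 0" "\<And>j t. norm (P j t) \<le> C * real D ^ j"
  proof (rule trig_poly_derivatives[OF D])
    fix F C assume F: "F 0 = P 0" "derivatives F" "C \<ge> 0" "\<And>j t. norm (F j t) \<le> C * real D ^ j"
    have "F = P" using derivatives_unique[OF F(2) P(1) F(1)] .
    then show ?thesis using that F(3,4) by blast
  qed simp
  define E where "E = real D + 1"
  define N where "N = D + 2"
  have E: "E \<ge> 1" "real N = E + 1" "real D \<le> E" by (simp_all add: E_def N_def)
  obtain L' where L': "trig_poly {N..} L'" "parametrises_knot L'" "ambient_isotopic (range L) (range L')"
    using remove_low_frequencies[OF L] .
  obtain \<epsilon> where \<epsilon>: "\<epsilon> > 0" "\<And>h. smooth_loop h \<Longrightarrow> C1_close \<epsilon> h L' \<Longrightarrow>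
      parametrises_knot h \<and> ambient_isotopic (range L') (range h)"
    using knot_stable[OF L'(2)] by blast
  have "1 \<le> N" by (simp add: N_def)
  from trig_poly_antiderivatives[OF L'(1) subset_refl this]
  obtain A where A: "A \<ge> 0" "\<And>n. \<exists>F. F n = L' \<and> derivatives F \<and>
      (\<forall>j t. j \<le> n \<longrightarrow> norm (F j t) \<le> A / real N ^ (n - j)) \<and> (\<forall>j. trig_poly {N..} (F j))"
    by auto
  \<comment> \<open>The factor that lifts the tolerance of \<open>L'\<close> above one plus the derivatives of \<open>P\<close> involved.\<close>
  define c where "c n = (1 + C * E ^ Suc n) / \<epsilon>" for n
  have c: "c n > 0" "c n * \<epsilon> = 1 + C * E ^ Suc n" for n
    using \<epsilon>(1) C(1) E(1) by (auto simp: c_def intro!: divide_pos_pos add_pos_nonneg)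
  have "(\<lambda>n. (A * real N ^ Suc n0 / \<epsilon>) * ((1 / real N) ^ n + C * E * (E / real N) ^ n)) \<longlonglongrightarrow>
      (A * real N ^ Suc n0 / \<epsilon>) * (0 + C * E * 0)"
    using E by (intro tendsto_intros LIMSEQ_power_zero) auto
  then have "\<forall>\<^sub>F n in sequentially. (A * real N ^ Suc n0 / \<epsilon>) * ((1 / real N) ^ n + C * E * (E / real N) ^ n) < e"
    using e by (intro order_tendstoD) auto
  then obtain m where m: "\<And>n. n \<ge> m \<Longrightarrow> (A * real N ^ Suc n0 / \<epsilon>) * ((1 / real N) ^ n + C * E * (E / real N) ^ n) < e"
    unfolding eventually_sequentially by blast
  define n where "n = max m (Suc n0)"
  obtain F where F: "F n = L'" "derivatives F" "\<And>j t. j \<le> n \<Longrightarrow> norm (F j t) \<le> A / real N ^ (n - j)" "\<And>j. trig_poly {N..} (F j)"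
    using A(2)[of n] by auto
  define G where "G j t = c n *\<^sub>R F j t" for j t
  have dG: "derivatives G" unfolding G_def by (intro derivatives_scaleR F)
  have "trig_poly {N..} (G 0)" unfolding G_def by (intro trig_poly_scaleR F)
  then have tG: "trig_poly UNIV (G 0)" by (rule trig_poly_mono) simp
  show ?thesis
  proof (rule that[of n G])
    show "n > n0" by (simp add: n_def)
    show "norm (G j t) \<le> e" if j: "j \<le> Suc n0" for j t
    proof -
      have jn: "j \<le> n" using j by (simp add: n_def)
      have N0: "real N > 0" "real N \<ge> 1" using E by auto
      have "norm (G j t) = c n * norm (F j t)" using c(1)[of n] by (simp add: G_def)
      also have "\<dots> \<le> c n * (A / real N ^ (n - j))" using c(1)[of n] by (intro mult_left_mono F jn) simp
      also have "A / real N ^ (n - j) = A * real N ^ j / real N ^ n"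
        using jn N0 by (simp add: power_diff)
      also have "c n * (A * real N ^ j / real N ^ n) \<le> c n * (A * real N ^ Suc n0 / real N ^ n)"
        using c(1)[of n] A(1) N0 j by (intro mult_left_mono divide_right_mono power_increasing) auto
      also have "\<dots> = (A * real N ^ Suc n0 / \<epsilon>) * ((1 / real N) ^ n + C * E * (E / real N) ^ n)"
        using N0 \<epsilon>(1) by (simp add: c_def power_divide field_simps)
      also have "\<dots> \<le> e" using m[of n] by (simp add: n_def)
      finally show ?thesis .
    qed
    fix h :: "real \<Rightarrow> real ^ 3"
    assume h: "smooth_loop h" "\<And>t. norm (h t - (P n t + G n t)) \<le> 1"
      "\<And>t. norm (vector_derivative h (at t) - (P (Suc n) t + G (Suc n) t)) \<le> 1"
    define k where "k t = inverse (c n) *\<^sub>R h t" for t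
    have sh: "smooth h" "\<And>t. h (t + 2 * pi) = h t" using h(1) by (auto simp: smooth_loop_def)
    have sk: "smooth_loop k"
      unfolding smooth_loop_def k_def using sh by (auto intro: smooth_scaleR smooth_const)
    have dk: "vector_derivative k (at t) = inverse (c n) *\<^sub>R vector_derivative h (at t)" for t
      unfolding k_def
      by (intro vector_derivative_at bounded_linear.has_vector_derivative[OF bounded_linear_scaleR_right]
          smooth_has_vector_derivative sh)
    have dL: "vector_derivative L' (at t) = F (Suc n) t" for t
      using vector_derivative_at[OF derivativesD[OF F(2), of n t]] by (simp add: F(1))
    have PE: "norm (P j t) \<le> C * E ^ Suc n" if "j \<le> Suc n" for j t
    proof -
      have "norm (P j t) \<le> C * real D ^ j" by (rule C)
      also have "\<dots> \<le> C * E ^ j" using C(1) E by (intro mult_left_mono power_mono) auto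
      also have "\<dots> \<le> C * E ^ Suc n" using C(1) E that by (intro mult_left_mono power_increasing) auto
      finally show ?thesis .
    qed
    have near: "norm (inverse (c n) *\<^sub>R x - y) \<le> \<epsilon>" if "norm (x - (p + c n *\<^sub>R y)) \<le> 1" "norm p \<le> C * E ^ Suc n" for x y p :: "real ^ 3"
    proof -
      have "inverse (c n) *\<^sub>R x - y = inverse (c n) *\<^sub>R ((x - (p + c n *\<^sub>R y)) + p)"
        using c(1)[of n] by (simp add: algebra_simps)
      then have "norm (inverse (c n) *\<^sub>R x - y) = inverse (c n) * norm ((x - (p + c n *\<^sub>R y)) + p)"
        using c(1)[of n] by simp
      also have "\<dots> \<le> inverse (c n) * (1 + C * E ^ Suc n)"
        using c(1)[of n] by (intro mult_left_mono norm_triangle_mono that) simp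
      also have "\<dots> = \<epsilon>" using c(1)[of n] c(2)[of n, symmetric] by simp
      finally show ?thesis .
    qed
    have "norm (k t - L' t) \<le> \<epsilon>" for t
      unfolding k_def by (rule near[OF _ PE[of n t]]) (use h(2)[of t] in \<open>simp_all add: G_def F(1)\<close>)
    moreover have "norm (vector_derivative k (at t) - vector_derivative L' (at t)) \<le> \<epsilon>" for t
      unfolding dk dL by (rule near[OF _ PE[of "Suc n" t]]) (use h(3)[of t] in \<open>simp_all add: G_def\<close>)
    ultimately have "ambient_isotopic (range L') (range k)" using \<epsilon>(2)[OF sk C1_closeI] by blast
    moreover have "ambient_isotopic (range k) (range h)"
    proof -
      have "(\<lambda>x. c n *\<^sub>R x) ` range k = range h"
        using c(1)[of n] by (auto simp: k_def image_image)
      then show ?thesis using ambient_isotopic_scale[OF c(1)[of n], of "range k"] by simp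
    qed
    ultimately show "ambient_isotopic (range h) (range L)"
      using L'(3) ambient_isotopic_trans ambient_isotopic_sym by meson
  qed (use dG tG in auto)
qed

section \<open>Limits of curves with all derivatives\<close>

text \<open>
  The order up to which consecutive terms are close grows with the index. Every single order
  is eventually covered, so all derivatives converge, and the limit inherits at each index the
  closeness up to the order of that index.
\<close>

lemma rapid_limit:
  fixes P :: "nat \<Rightarrow> nat \<Rightarrow> real \<Rightarrow> 'a::banach"
  assumes P: "\<And>k. derivatives (P k)" and "strict_mono n"
    and diff: "\<And>k j t. j \<le> Suc (n k) \<Longrightarrow> norm (P (Suc k) j t - P k j t) \<le> \<delta> / 2 ^ Suc k" and \<delta>: "\<delta> > 0"
  obtains F where "derivatives F" "\<And>j k t. j \<le> Suc (n k) \<Longrightarrow> norm (F j t - P k j t) \<le> \<delta> / 2 ^ k"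
    "\<And>j t. (\<lambda>k. P k j t) \<longlonglongrightarrow> F j t"
proof -
  have tail: "norm (P (k + i) j t - P k j t) \<le> \<delta> / 2 ^ k - \<delta> / 2 ^ (k + i)" if "j \<le> Suc (n k)" for i j k t
  proof (induction i)
    case (Suc i)
    have "n k \<le> n (k + i)" using \<open>strict_mono n\<close> by (simp add: strict_mono_less_eq)
    then have "norm (P (Suc (k + i)) j t - P (k + i) j t) \<le> \<delta> / 2 ^ Suc (k + i)" using that by (intro diff) simp
    then have "norm (P (k + Suc i) j t - P k j t) \<le> \<delta> / 2 ^ Suc (k + i) + (\<delta> / 2 ^ k - \<delta> / 2 ^ (k + i))"
      using norm_triangle_mono[OF _ Suc] by fastforce
    also have "\<dots> = \<delta> / 2 ^ k - \<delta> / 2 ^ (k + Suc i)" by (simp add: field_simps)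
    finally show ?case .
  qed simp
  have tail': "norm (P l j t - P k j t) \<le> \<delta> / 2 ^ k" if "j \<le> Suc (n k)" "k \<le> l" for j k l t
  proof -
    have "norm (P l j t - P k j t) \<le> \<delta> / 2 ^ k - \<delta> / 2 ^ l" using tail[OF that(1), of "l - k" t] that(2) by simp
    then show ?thesis using \<delta> by (smt (verit) divide_nonneg_pos zero_less_power)
  qed
  have small: "\<exists>k\<ge>k0. \<delta> / 2 ^ k < r" if "r > 0" for r :: real and k0
  proof -
    have "(\<lambda>k. \<delta> * (1/2) ^ k) \<longlonglongrightarrow> \<delta> * 0" by (intro tendsto_intros LIMSEQ_power_zero) simp
    then have "\<forall>\<^sub>F k in sequentially. \<delta> * (1/2) ^ k < r" using that by (intro order_tendstoD) auto
    then have "\<forall>\<^sub>F k in sequentially. \<delta> * (1/2) ^ k < r \<and> k0 \<le> k" by (intro eventually_conj eventually_ge_at_top)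
    then have "\<exists>k. \<delta> * (1/2) ^ k < r \<and> k0 \<le> k" by (rule eventually_happens'[OF sequentially_bot])
    then obtain k where "\<delta> * (1/2) ^ k < r" "k0 \<le> k" by blast
    then have "\<delta> / 2 ^ k < r" by (simp add: power_one_over)
    with \<open>k0 \<le> k\<close> show ?thesis by blast
  qed
  have kn: "k \<le> n k" for k using \<open>strict_mono n\<close> by (rule strict_mono_imp_increasing)
  have "convergent (\<lambda>k. P k j t)" for j t
    unfolding Cauchy_convergent_iff[symmetric]
  proof (rule metric_CauchyI)
    fix r :: real assume "r > 0"
    then obtain k where k: "k \<ge> j" "\<delta> / 2 ^ k < r / 2" using small[of "r / 2" j] by auto
    have jk: "j \<le> Suc (n k)" using k(1) kn[of k] by simp
    have "dist (P a j t) (P b j t) < r" if "a \<ge> k" "b \<ge> k" for a b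
    proof -
      have "dist (P a j t) (P b j t) \<le> dist (P a j t) (P k j t) + dist (P b j t) (P k j t)" by (rule dist_triangle2)
      also have "\<dots> \<le> \<delta> / 2 ^ k + \<delta> / 2 ^ k" using tail'[OF jk] that by (intro add_mono) (auto simp: dist_norm)
      finally show ?thesis using k(2) by linarith
    qed
    then show "\<exists>k. \<forall>a\<ge>k. \<forall>b\<ge>k. dist (P a j t) (P b j t) < r" by blast
  qed
  then obtain F where F: "\<And>j t. (\<lambda>k. P k j t) \<longlonglongrightarrow> F j t" unfolding convergent_def by metis
  have FP: "norm (F j t - P k j t) \<le> \<delta> / 2 ^ k" if "j \<le> Suc (n k)" for j k t
  proof (rule Lim_norm_ubound[OF sequentially_bot])
    show "(\<lambda>l. P l j t - P k j t) \<longlonglongrightarrow> F j t - P k j t" by (intro tendsto_intros F)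
    show "\<forall>\<^sub>F l in sequentially. norm (P l j t - P k j t) \<le> \<delta> / 2 ^ k"
      using tail'[OF that] by (auto simp: eventually_sequentially)
  qed
  have dF: "derivatives F"
    unfolding derivatives_def
  proof (intro allI)
    fix j t
    have "\<exists>u. \<forall>t\<in>UNIV. (\<lambda>k. P k j t) \<longlonglongrightarrow> u t \<and> (u has_derivative (\<lambda>h. h *\<^sub>R F (Suc j) t)) (at t within UNIV)"
    proof (rule has_derivative_sequence[where f'="\<lambda>k t h. h *\<^sub>R P k (Suc j) t"])
      show "((P k j) has_derivative (\<lambda>h. h *\<^sub>R P k (Suc j) t)) (at t within UNIV)" for k t
        using derivativesD[OF P] by (simp add: has_vector_derivative_def)
      show "\<forall>\<^sub>F k in sequentially. \<forall>t\<in>UNIV. \<forall>h. norm (h *\<^sub>R P k (Suc j) t - h *\<^sub>R F (Suc j) t) \<le> r * norm h" if r: "r > 0" for r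
      proof -
        obtain k where k: "k \<ge> j" "\<delta> / 2 ^ k < r" using small[OF r] by blast
        have "norm (h *\<^sub>R P l (Suc j) t - h *\<^sub>R F (Suc j) t) \<le> r * norm h" if l: "l \<ge> k" for l t and h :: real
        proof -
          have "Suc j \<le> Suc (n l)" using k(1) l kn[of l] by simp
          then have "norm (F (Suc j) t - P l (Suc j) t) \<le> \<delta> / 2 ^ l" by (rule FP)
          also have "\<dots> \<le> \<delta> / 2 ^ k" using l \<delta> by (intro divide_left_mono power_increasing) auto
          finally have "norm (P l (Suc j) t - F (Suc j) t) \<le> r" using k(2) by (simp add: norm_minus_commute)
          then show ?thesis by (simp add: mult.commute[of r] mult_left_mono flip: scaleR_diff_right)
        qed
        then show ?thesis by (auto simp: eventually_sequentially)
      qed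
      show "(\<lambda>k. P k j 0) \<longlonglongrightarrow> F j 0" by (rule F)
    qed auto
    then obtain u where u: "\<And>t. (\<lambda>k. P k j t) \<longlonglongrightarrow> u t" "\<And>t. (u has_derivative (\<lambda>h. h *\<^sub>R F (Suc j) t)) (at t)" by auto
    have "u = F j" using LIMSEQ_unique[OF u(1) F] by (intro ext)
    then show "(F j has_vector_derivative F (Suc j) t) (at t)" using u(2) by (simp add: has_vector_derivative_def)
  qed
  show ?thesis using that[OF dF FP F] .
qed

section \<open>Ultraknots\<close>

theorem corollary1p4:
  fixes K :: "(real ^ 3) set"
  assumes "knot K"
  shows "\<exists>U. ultraknot U \<and> ambient_isotopic K U"
proof -
  obtain g where g: "parametrises_knot g" "K = range g" using assms by (auto simp: knot_def)
  obtain L :: "nat \<Rightarrow> real \<Rightarrow> real ^ 3" where L: "\<And>k. parametrises_knot (L k)" "\<And>k. trig_poly UNIV (L k)"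
    "\<And>K. knot K \<Longrightarrow> \<exists>k. ambient_isotopic (range (L k)) K"
    using trig_poly_knot_types[OF g(1)] by blast
  obtain \<epsilon> where \<epsilon>: "\<epsilon> > 0" "\<And>h. smooth_loop h \<Longrightarrow> C1_close \<epsilon> h g \<Longrightarrow>
      parametrises_knot h \<and> ambient_isotopic (range g) (range h)"
    using knot_stable[OF g(1)] by blast
  \<comment> \<open>One \<open>\<delta>\<close> is spent on all added terms together, another on the final generic perturbation.\<close>
  define \<delta> where "\<delta> = min (1/2) (\<epsilon> / 4)"
  have \<delta>: "\<delta> > 0" "2 * \<delta> \<le> 1" "2 * \<delta> + \<epsilon> / 2 \<le> \<epsilon>" using \<epsilon>(1) by (auto simp: \<delta>_def)
  have "smooth_loop g" using g(1) by (simp add: parametrises_knot_def)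
  then obtain p where p: "trig_poly UNIV p" "C1_close (\<epsilon> / 2) p g"
    using trig_poly_C1_approx[of g "\<epsilon> / 2"] \<epsilon>(1) by auto

  \<comment> \<open>The stages of the construction: a trigonometric polynomial with its derivatives, and the
    order of the derivative that realises the knot type added last.\<close>
  define good where "good x \<longleftrightarrow> derivatives (fst x) \<and> trig_poly UNIV (fst x 0)" for x :: "(nat \<Rightarrow> real \<Rightarrow> real ^ 3) \<times> nat"
  define realises where "realises F n M \<longleftrightarrow> (\<forall>h. smooth_loop h \<longrightarrow> (\<forall>t. norm (h t - F n t) \<le> 1) \<longrightarrow>
       (\<forall>t. norm (vector_derivative h (at t) - F (Suc n) t) \<le> 1) \<longrightarrow> ambient_isotopic (range h) (range M))"
    for F :: "nat \<Rightarrow> real \<Rightarrow> real ^ 3" and n :: nat and M :: "real \<Rightarrow> real ^ 3"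
  define stage where "stage k x y \<longleftrightarrow> snd x < snd y \<and>
      (\<forall>j\<le>Suc (snd x). \<forall>t. norm (fst y j t - fst x j t) \<le> \<delta> / 2 ^ Suc k) \<and> realises (fst y) (snd y) (L k)"
    for k :: nat and x y :: "(nat \<Rightarrow> real \<Rightarrow> real ^ 3) \<times> nat"
  obtain P0 where P0: "P0 0 = p" "derivatives P0"
    using smooth_imp_derivatives[OF trig_poly_smooth[OF p(1)]] that[of "\<lambda>n. nth_deriv n p"]
    by (simp add: nth_deriv_def)
  have "\<exists>x. \<forall>k. (good (x k) \<and> (k = 0 \<longrightarrow> x k = (P0, 0))) \<and> stage k (x k) (x (Suc k))"
  proof (rule dependent_nat_choice)
    show "\<exists>x. good x \<and> (0 = (0::nat) \<longrightarrow> x = (P0, 0))"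
      using P0 p(1) by (intro exI[of _ "(P0, 0)"]) (simp add: good_def)
    fix x and k :: nat assume "good x \<and> (k = 0 \<longrightarrow> x = (P0, 0))"
    then have x: "derivatives (fst x)" "trig_poly UNIV (fst x 0)" by (auto simp: good_def)
    have "\<delta> / 2 ^ Suc k > 0" using \<delta>(1) by simp
    show "\<exists>y. (good y \<and> (Suc k = 0 \<longrightarrow> y = (P0, 0))) \<and> stage k x y"
    proof (rule add_knot_type[OF x L(2)[of k] L(1)[of k] \<open>\<delta> / 2 ^ Suc k > 0\<close>, of "snd x"])
      fix n G
      assume G: "n > snd x" "derivatives G" "trig_poly UNIV (G 0)" "\<And>j t. j \<le> Suc (snd x) \<Longrightarrow> norm (G j t) \<le> \<delta> / 2 ^ Suc k"
        "\<And>h. smooth_loop h \<Longrightarrow> (\<And>t. norm (h t - (fst x n t + G n t)) \<le> 1) \<Longrightarrow>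
         (\<And>t. norm (vector_derivative h (at t) - (fst x (Suc n) t + G (Suc n) t)) \<le> 1) \<Longrightarrow>
         ambient_isotopic (range h) (range (L k))"
      define y where "y = (\<lambda>j t. fst x j t + G j t, n)"
      have "good y" using G x by (simp add: good_def y_def derivatives_add trig_poly_add)
      moreover have "stage k x y" using G(1,4,5) by (simp add: stage_def realises_def y_def)
      ultimately show ?thesis by blast
    qed
  qed
  then obtain x where x: "\<And>k. good (x k)" "x 0 = (P0, 0)" "\<And>k. stage k (x k) (x (Suc k))" by blast
  define P where "P k = fst (x k)" for k
  define n where "n k = snd (x k)" for k
  have P: "derivatives (P k)" "trig_poly UNIV (P k 0)" for k using x(1)[of k] by (auto simp: good_def P_def)
  have P_0: "P 0 = P0" "n 0 = 0" using x(2) by (auto simp: P_def n_def)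
  have n: "n k < n (Suc k)" for k using x(3)[of k] by (auto simp: stage_def n_def)
  have diff: "norm (P (Suc k) j t - P k j t) \<le> \<delta> / 2 ^ Suc k" if "j \<le> Suc (n k)" for j k t
    using x(3)[of k] that by (auto simp: stage_def n_def P_def)
  have realises: "realises (P (Suc k)) (n (Suc k)) (L k)" for k
    using x(3)[of k] by (auto simp: stage_def n_def P_def)
  have "strict_mono n" using n by (simp add: strict_mono_Suc_iff)
  have per: "P k j (t + 2 * pi) = P k j t" for k j t
  proof (induction j arbitrary: t)
    case 0
    then show ?case using trig_poly_periodic[OF P(2)] by blast
  next
    case (Suc j)
    have "P k (Suc j) s = vector_derivative (P k j) (at s)" for s
      using vector_derivative_at[OF derivativesD[OF P(1)]] by simp
    then show ?case using periodic_vector_derivative[of "P k j" "2 * pi" t] Suc by simp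
  qed

  obtain F where F: "derivatives F" "\<And>j k t. j \<le> Suc (n k) \<Longrightarrow> norm (F j t - P k j t) \<le> \<delta> / 2 ^ k"
    "\<And>j t. (\<lambda>k. P k j t) \<longlonglongrightarrow> F j t"
    using rapid_limit[OF P(1) \<open>strict_mono n\<close> diff \<delta>(1)] by blast
  have pF: "F j (t + 2 * pi) = F j t" for j t
    using F(3)[of j "t + 2 * pi"] unfolding per by (rule LIMSEQ_unique[OF _ F(3)])
  obtain a b where ab: "norm a + norm b \<le> \<delta>" "\<And>m. parametrises_knot (\<lambda>t. F m t + wave 1 0 a b m t)"
    using generic_derivatives_knots[OF F(1) pF \<delta>(1)] by blast
  define H where "H m t = F m t + wave 1 0 a b m t" for m t
  have H: "parametrises_knot (H m)" for m using ab(2)[of m] by (simp add: H_def[abs_def])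
  have dH: "derivatives H" unfolding H_def by (intro derivatives_add F(1) derivatives_wave)
  have HP: "norm (H j t - P k j t) \<le> 2 * \<delta>" if "j \<le> Suc (n k)" for j k t
  proof -
    have "norm (wave 1 0 a b j t) \<le> \<delta>" using norm_wave_le[of 1 0 a b j t] ab(1) by simp
    moreover have "norm (F j t - P k j t) \<le> \<delta>"
    proof -
      have "\<delta> / 2 ^ k \<le> \<delta> / 1" using \<delta>(1) by (intro divide_left_mono) auto
      then show ?thesis using F(2)[OF that, of t] by simp
    qed
    ultimately show ?thesis
      using norm_triangle_mono[of "F j t - P k j t" \<delta> "wave 1 0 a b j t" \<delta>] by (simp add: H_def algebra_simps)
  qed
  have vH: "vector_derivative (H m) (at t) = H (Suc m) t" for m t
    using vector_derivative_at[OF derivativesD[OF dH]] .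
  have sH: "smooth_loop (H m)" for m using H by (simp add: parametrises_knot_def)
  have types: "ambient_isotopic (range (H (n (Suc k)))) (range (L k))" for k
  proof -
    have "norm (H j t - P (Suc k) j t) \<le> 1" if "j \<le> Suc (n (Suc k))" for j t
      using HP[OF that, of t] \<delta>(2) by simp
    then show ?thesis using realises[of k] sH unfolding realises_def vH[symmetric]
      by (simp add: vH)
  qed
  have "ultraknot (range (H 0))"
    unfolding ultraknot_def
  proof (intro exI[of _ "H 0"] conjI allI impI)
    fix M assume "knot M"
    then obtain k where "ambient_isotopic (range (L k)) M" using L(3) by blast
    then have "ambient_isotopic (range (nth_deriv (n (Suc k)) (H 0))) M"
      using types ambient_isotopic_trans unfolding nth_deriv_eq[OF dH] by blast
    moreover have "n (Suc k) \<ge> 1" using n[of k] by simp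
    ultimately show "\<exists>m\<ge>1. ambient_isotopic (range (nth_deriv m (H 0))) M" by blast
  qed (use H in \<open>auto simp: nth_deriv_eq[OF dH]\<close>)
  moreover have "ambient_isotopic K (range (H 0))"
  proof -
    have vp: "vector_derivative p (at t) = P 0 1 t" for t
      using vector_derivative_at[OF derivativesD[OF P0(2), of 0 t]] by (simp add: P0(1) P_0)
    have "norm (H 0 t - g t) \<le> \<epsilon>" for t
      using norm_triangle_mono[OF HP[of 0 0 t] C1_closeD(1)[OF p(2), of t]] \<delta>(3) by (simp add: P_0 P0(1))
    moreover have "norm (vector_derivative (H 0) (at t) - vector_derivative g (at t)) \<le> \<epsilon>" for t
      using norm_triangle_mono[OF HP[of 1 0 t] C1_closeD(2)[OF p(2), of t]] \<delta>(3) by (simp add: vp vH)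
    ultimately show ?thesis using \<epsilon>(2)[OF sH C1_closeI] g(2) by blast
  qed
  ultimately show ?thesis by blast
qed

end
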